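(* Let $u$ be the weak solution of the diffusion problem with $u\in H^1_0(\Omega)\cap H^2(\Omega)$ and $u|_{\Omega_i}\in H^\ell(\Omega_i)$, $i=1,2$, for an integer $\ell\ge2$, let $u_2^*\in H^\ell(\Omega_2^* )$ be the solution of the auxiliary problem on the patch $\Omega_2^*$, and assume that the overlap width satisfies $0<d_o<1$. Then there is a constant $c_2>0$, independent of $h$, such that $$\|\rho\nabla(u_2^*-u)\|_{L^2(\Omega_2^* )}\le c_2\,d_o^{\frac12}\Big(\|f\|_{L^2(\Omega_{o21})}+\|\rho_2\nabla u_2^*\|_{L^2(F_{o12})}\Big).$$
   Context: **Model problem.** $\Omega\subset\mathbb R^d$, $d\in\{2,3\}$, is a bounded Lipschitz domain, $\overline\Omega=\overline{\Omega_1}\cup\overline{\Omega_2}$ with $\Omega_1,\Omega_2$ disjoint open subdomains and interface $F_{12}=\partial\Omega_1\cap\partial\Omega_2$. The coefficient $\rho$ equals a constant $\rho_i>0$ on $\Omega_i$; $f\in L^2(\Omega)$. $u\in H_0^1(\Omega)$ is the weak solution: $\int_\Omega\rho\nabla u\cdot\nabla\phi\,dx=\int_\Omega f\phi\,dx$ for all $\phi\in H^1_0(\Omega)$. **Overlapping patches.** $\overline\Omega=\overline{\Omega_1^*}\cup\overline{\Omega_2^*}$ with overlap $\Omega_{o21}=\Omega_1^*\cap\Omega_2^*\subset\Omega$; $F_{o12}=\partial\Omega_1^*\cap\Omega_2^*$, $F_{o21}=\partial\Omega_2^*\cap\Omega_1^*$, $\partial\Omega_{o21}=F_{o12}\cup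 F_{o21}$. Assumptions: $\Omega_1^*=\Omega_1$; $F_{o12}=F_{12}$ is a planar face with unit normal $n_{F_{o12}}$ exterior to $\Omega_1^*$; $F_{o21}$ is a graph $z=\zeta_o(x,y)$, $0\le x\le x_M$, $0\le y\le y_M$, of a smooth function over $F_{o12}$ (analogously in 2d). With $\mathbf\Phi_{o12}:F_{o12}\to F_{o21}$, $\mathbf\Phi_{o12}(x)=x+\zeta_o(x)n_{F_{o12}}$ ($\zeta_o$ real-valued), the width is $d_o=\max_{x\in F_{o12}}|x-\mathbf\Phi_{o12}(x)|$; it satisfies $d_o\le Ch^\lambda$ with $C>0$, $\lambda\ge1$, where $h$ is the discretization mesh size (on $\Omega_2^*$, $\rho=\rho_1$ in $\Omega_{o21}$ and $\rho=\rho_2$ in $\Omega_2$). **Auxiliary problem on $\Omega_2^*$.** $u_2^*\in H^1(\Omega_2^* )$ with $u_2^*=0$ on $\partial\Omega_2^*\cap\partial\Omega$, $u_2^*=u$ on $F_{o21}$, and $\int_{\Omega_2^*}\rho_2\nabla u_2^*\cdot\nabla\phi\,dx=\int_{\Omega_2^*}f\phi\,dx$ for all $\phi\in H^1_0(\Omega_2^* )$ (note that $\rho_2$ is used also in $\Omega_{o21}$). *)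

theory Defs
  imports "HOL-Analysis.Analysis"
begin

definition pderiv_dir :: "'a::euclidean_space \<Rightarrow> ('a \<Rightarrow> real) \<Rightarrow> 'a \<Rightarrow> real" where
  "pderiv_dir b f x = frechet_derivative f (at x) b"

text \<open>The sets \<open>S\<close> below are always open.\<close>

primrec Ck_on :: "nat \<Rightarrow> 'a::euclidean_space set \<Rightarrow> ('a \<Rightarrow> real) \<Rightarrow> bool" where
  "Ck_on 0 S f \<longleftrightarrow> continuous_on S f"
| "Ck_on (Suc k) S f \<longleftrightarrow>
     (\<forall>x\<in>S. f differentiable (at x)) \<and> (\<forall>b\<in>Basis. Ck_on k S (pderiv_dir b f))"

definition smooth_on :: "'a::euclidean_space set \<Rightarrow> ('a \<Rightarrow> real) \<Rightarrow> bool" where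
  "smooth_on S f \<longleftrightarrow> (\<forall>k. Ck_on k S f)"

definition test_functions :: "'a::euclidean_space set \<Rightarrow> ('a \<Rightarrow> real) set" where
  "test_functions D = {\<phi>. smooth_on UNIV \<phi> \<and>
     compact (closure {x. \<phi> x \<noteq> 0}) \<and> closure {x. \<phi> x \<noteq> 0} \<subseteq> D}"

definition L2 :: "'a measure \<Rightarrow> ('a \<Rightarrow> 'b::euclidean_space) set" where
  "L2 M = {f \<in> borel_measurable M. integrable M (\<lambda>x. (norm (f x))\<^sup>2)}"

definition L2_norm :: "'a measure \<Rightarrow> ('a \<Rightarrow> 'b::euclidean_space) \<Rightarrow> real" where
  "L2_norm M f = sqrt (\<integral>x. (norm (f x))\<^sup>2 \<partial>M)"

definition locally_integrable_on ::
  "('a::euclidean_space \<Rightarrow> 'b::euclidean_space) \<Rightarrow> 'a set \<Rightarrow> bool" where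
  "locally_integrable_on f D \<longleftrightarrow>
     (\<forall>K. compact K \<and> K \<subseteq> D \<longrightarrow> integrable (lebesgue_on K) f)"

definition has_weak_pderiv ::
  "'a::euclidean_space set \<Rightarrow> 'a \<Rightarrow> ('a \<Rightarrow> real) \<Rightarrow> ('a \<Rightarrow> real) \<Rightarrow> bool" where
  "has_weak_pderiv D b v g \<longleftrightarrow>
     locally_integrable_on v D \<and> locally_integrable_on g D \<and>
     (\<forall>\<phi>\<in>test_functions D.
        (\<integral>x. v x * pderiv_dir b \<phi> x \<partial>lebesgue_on D) = - (\<integral>x. g x * \<phi> x \<partial>lebesgue_on D))"

definition has_weak_gradient ::
  "'a::euclidean_space set \<Rightarrow> ('a \<Rightarrow> real) \<Rightarrow> ('a \<Rightarrow> 'a) \<Rightarrow> bool" where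
  "has_weak_gradient D v G \<longleftrightarrow> (\<forall>b\<in>Basis. has_weak_pderiv D b v (\<lambda>x. G x \<bullet> b))"

text \<open>A representative; weak gradients are unique only almost everywhere on \<open>D\<close>.\<close>

definition weak_gradient :: "'a::euclidean_space set \<Rightarrow> ('a \<Rightarrow> real) \<Rightarrow> 'a \<Rightarrow> 'a" where
  "weak_gradient D v = (SOME G. has_weak_gradient D v G)"

primrec sobolev :: "nat \<Rightarrow> 'a::euclidean_space set \<Rightarrow> ('a \<Rightarrow> real) set" where
  "sobolev 0 D = L2 (lebesgue_on D)"
| "sobolev (Suc k) D =
     {v \<in> L2 (lebesgue_on D). \<forall>b\<in>Basis. \<exists>g\<in>sobolev k D. has_weak_pderiv D b v g}"

definition H1_norm :: "'a::euclidean_space set \<Rightarrow> ('a \<Rightarrow> real) \<Rightarrow> real" where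
  "H1_norm D v =
     sqrt ((L2_norm (lebesgue_on D) v)\<^sup>2 + (L2_norm (lebesgue_on D) (weak_gradient D v))\<^sup>2)"

definition H10 :: "'a::euclidean_space set \<Rightarrow> ('a \<Rightarrow> real) set" where
  "H10 D = {v \<in> sobolev 1 D. \<exists>\<phi>. (\<forall>k. \<phi> k \<in> test_functions D) \<and>
     (\<lambda>k::nat. H1_norm D (\<lambda>x. \<phi> k x - v x)) \<longlonglongrightarrow> 0}"

text \<open>
  Homogeneous Dirichlet condition on a part \<open>\<Gamma>\<close> of the boundary of \<open>D\<close> for a function that is
  merely in $H^1(D)$: it is an $H^1(D)$-limit of smooth functions vanishing near \<open>\<Gamma>\<close>
  (cf. Gilbarg--Trudinger, Section 8.10).
\<close>

definition zero_on_boundary_part ::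
  "'a::euclidean_space set \<Rightarrow> 'a set \<Rightarrow> ('a \<Rightarrow> real) \<Rightarrow> bool" where
  "zero_on_boundary_part D \<Gamma> v \<longleftrightarrow> v \<in> sobolev 1 D \<and>
     (\<exists>\<phi>. (\<forall>k. smooth_on UNIV (\<phi> k) \<and> \<phi> k \<in> sobolev 1 D \<and>
               (\<exists>U. open U \<and> \<Gamma> \<subseteq> U \<and> (\<forall>x\<in>U. \<phi> k x = 0))) \<and>
          (\<lambda>k::nat. H1_norm D (\<lambda>x. \<phi> k x - v x)) \<longlonglongrightarrow> 0)"

text \<open>
  Surface measure on a subset \<open>F\<close> of a hyperplane with unit normal \<open>n\<close>: the area of \<open>A\<close> is the
  volume of the cylinder of height 1 over \<open>A\<close>.
\<close>

definition face_measure :: "'a::euclidean_space \<Rightarrow> 'a set \<Rightarrow> 'a measure" where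
  "face_measure n F = (let p = (SOME p. p \<in> F) in
     restrict_space
       (distr (lebesgue_on {x. 0 \<le> (x - p) \<bullet> n \<and> (x - p) \<bullet> n \<le> 1}) borel
          (\<lambda>x. x - ((x - p) \<bullet> n) *\<^sub>R n))
       F)"

text \<open>
  Trace of $v \in H^1(D)$ on a planar face \<open>F \<subseteq> D\<close>: the $L^2(F)$-limit of the restrictions of
  functions in $C^\infty(D) \cap H^1(D)$ that converge to \<open>v\<close> in $H^1(D)$.
\<close>

definition has_trace_on_face ::
  "'a::euclidean_space set \<Rightarrow> 'a \<Rightarrow> 'a set \<Rightarrow> ('a \<Rightarrow> real) \<Rightarrow> ('a \<Rightarrow> real) \<Rightarrow> bool" where
  "has_trace_on_face D n F v g \<longleftrightarrow> v \<in> sobolev 1 D \<and> g \<in> L2 (face_measure n F) \<and>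
     (\<exists>\<phi>. (\<forall>k. smooth_on D (\<phi> k) \<and> \<phi> k \<in> sobolev 1 D \<and> \<phi> k \<in> L2 (face_measure n F)) \<and>
          (\<lambda>k::nat. H1_norm D (\<lambda>x. \<phi> k x - v x)) \<longlonglongrightarrow> 0 \<and>
          (\<lambda>k. L2_norm (face_measure n F) (\<lambda>x. \<phi> k x - g x)) \<longlonglongrightarrow> 0)"

definition has_gradient_trace_on_face ::
  "'a::euclidean_space set \<Rightarrow> 'a \<Rightarrow> 'a set \<Rightarrow> ('a \<Rightarrow> real) \<Rightarrow> ('a \<Rightarrow> 'a) \<Rightarrow> bool" where
  "has_gradient_trace_on_face D n F v G \<longleftrightarrow> G \<in> L2 (face_measure n F) \<and>
     (\<forall>b\<in>Basis. has_trace_on_face D n F (\<lambda>x. weak_gradient D v x \<bullet> b) (\<lambda>x. G x \<bullet> b))"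

definition domain :: "'a::euclidean_space set \<Rightarrow> bool" where
  "domain D \<longleftrightarrow> open D \<and> connected D \<and> D \<noteq> {}"

text \<open>
  The argument \<open>x - (x \<bullet> n) *\<^sub>R n\<close> of \<open>\<gamma>\<close> is the component of \<open>x\<close> orthogonal to \<open>n\<close>, so only the
  restriction of \<open>\<gamma>\<close> to the hyperplane orthogonal to \<open>n\<close> matters.
\<close>

definition bounded_lipschitz_domain :: "'a::euclidean_space set \<Rightarrow> bool" where
  "bounded_lipschitz_domain D \<longleftrightarrow> domain D \<and> bounded D \<and>
     (\<forall>p\<in>frontier D. \<exists>r>0. \<exists>n \<gamma> L. norm n = 1 \<and> L-lipschitz_on UNIV \<gamma> \<and>
        D \<inter> ball p r = {x \<in> ball p r. x \<bullet> n > \<gamma> (x - (x \<bullet> n) *\<^sub>R n)})"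

text \<open>
  The inclusion says that \<open>\<Omega>\<close> has no internal boundary other than the interface; it excludes, e.g.,
  a subdomain with a crack.
\<close>

definition two_subdomains :: "'a::euclidean_space set \<Rightarrow> 'a set \<Rightarrow> 'a set \<Rightarrow> bool" where
  "two_subdomains \<Omega> \<Omega>1 \<Omega>2 \<longleftrightarrow> domain \<Omega>1 \<and> domain \<Omega>2 \<and> \<Omega>1 \<subseteq> \<Omega> \<and> \<Omega>2 \<subseteq> \<Omega> \<and>
     \<Omega>1 \<inter> \<Omega>2 = {} \<and> closure \<Omega> = closure \<Omega>1 \<union> closure \<Omega>2 \<and>
     \<Omega> \<subseteq> \<Omega>1 \<union> \<Omega>2 \<union> (frontier \<Omega>1 \<inter> frontier \<Omega>2)"

text \<open>Off \<open>\<Omega>1 \<union> \<Omega>2\<close>, i.e. on the interface (a null set), the value is irrelevant.\<close>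

definition diffusion_coeff :: "'a set \<Rightarrow> real \<Rightarrow> real \<Rightarrow> 'a \<Rightarrow> real" where
  "diffusion_coeff \<Omega>1 \<rho>1 \<rho>2 x = (if x \<in> \<Omega>1 then \<rho>1 else \<rho>2)"

definition weak_solution ::
  "'a::euclidean_space set \<Rightarrow> ('a \<Rightarrow> real) \<Rightarrow> ('a \<Rightarrow> real) \<Rightarrow> ('a \<Rightarrow> real) \<Rightarrow> bool" where
  "weak_solution \<Omega> \<rho> f u \<longleftrightarrow> u \<in> H10 \<Omega> \<and>
     (\<forall>\<phi>\<in>H10 \<Omega>.
        (\<integral>x. \<rho> x * (weak_gradient \<Omega> u x \<bullet> weak_gradient \<Omega> \<phi> x) \<partial>lebesgue_on \<Omega>) =
        (\<integral>x. f x * \<phi> x \<partial>lebesgue_on \<Omega>))"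

text \<open>A closed rectangle (a segment in two dimensions) in a hyperplane with unit normal \<open>n\<close>.\<close>

definition rectangular_face :: "'a::euclidean_space \<Rightarrow> 'a set \<Rightarrow> bool" where
  "rectangular_face n F \<longleftrightarrow> norm n = 1 \<and>
     (\<exists>p E M. finite E \<and> card E = DIM('a) - 1 \<and> pairwise orthogonal E \<and>
        (\<forall>e\<in>E. norm e = 1 \<and> e \<bullet> n = 0 \<and> M e > 0) \<and>
        F = {p + (\<Sum>e\<in>E. s e *\<^sub>R e) | s. \<forall>e\<in>E. 0 \<le> s e \<and> s e \<le> (M e :: real)})"

definition exterior_normal :: "'a::euclidean_space set \<Rightarrow> 'a set \<Rightarrow> 'a \<Rightarrow> bool" where
  "exterior_normal D F n \<longleftrightarrow>
     (\<forall>x\<in>F. \<exists>\<epsilon>>0. \<forall>t. 0 < t \<and> t < \<epsilon> \<longrightarrow> x - t *\<^sub>R n \<in> D \<and> x + t *\<^sub>R n \<notin> D)"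

text \<open>\<open>inner_face D1 D2\<close> is $F_{o12}$ for the patches $\Omega_1^* = D1$, $\Omega_2^* = D2$, and
  \<open>inner_face D2 D1\<close> is $F_{o21}$.\<close>

definition inner_face :: "'a::euclidean_space set \<Rightarrow> 'a set \<Rightarrow> 'a set" where
  "inner_face D1 D2 = frontier D1 \<inter> D2"

definition face_map :: "('a::euclidean_space \<Rightarrow> real) \<Rightarrow> 'a \<Rightarrow> 'a \<Rightarrow> 'a" where
  "face_map \<zeta> n x = x + \<zeta> x *\<^sub>R n"

definition overlap_width :: "'a::euclidean_space set \<Rightarrow> ('a \<Rightarrow> real) \<Rightarrow> 'a \<Rightarrow> real" where
  "overlap_width F \<zeta> n = (SUP x\<in>F. norm (x - face_map \<zeta> n x))"

text \<open>
  $F_{12}$ is closed while $F_{o12}$ and $F_{o21}$ do not contain their edges (these lie outside the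
  open patches). Hence $F_{o12} = F_{12}$ is an identity up to the edges of the face, and
  $\partial\Omega_{o21} = F_{o12} \cup F_{o21}$ is an identity up to closure. The function \<open>\<zeta>\<close>
  only matters on the face.
\<close>

definition overlapping_patches ::
  "'a::euclidean_space set \<Rightarrow> 'a set \<Rightarrow> 'a set \<Rightarrow> 'a set \<Rightarrow> 'a set \<Rightarrow> 'a \<Rightarrow> ('a \<Rightarrow> real) \<Rightarrow> bool" where
  "overlapping_patches \<Omega> \<Omega>1 \<Omega>2 \<Omega>1s \<Omega>2s n \<zeta> \<longleftrightarrow>
     open \<Omega>1s \<and> open \<Omega>2s \<and> \<Omega>1s \<subseteq> \<Omega> \<and> \<Omega>2s \<subseteq> \<Omega> \<and>
     closure \<Omega> = closure \<Omega>1s \<union> closure \<Omega>2s \<and>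
     \<Omega>1s = \<Omega>1 \<and> \<Omega>2 \<subseteq> \<Omega>2s \<and>
     frontier (\<Omega>1s \<inter> \<Omega>2s) = closure (inner_face \<Omega>1s \<Omega>2s) \<union> closure (inner_face \<Omega>2s \<Omega>1s) \<and>
     rectangular_face n (frontier \<Omega>1 \<inter> frontier \<Omega>2) \<and>
     inner_face \<Omega>1s \<Omega>2s = rel_interior (frontier \<Omega>1 \<inter> frontier \<Omega>2) \<and>
     exterior_normal \<Omega>1s (inner_face \<Omega>1s \<Omega>2s) n \<and>
     smooth_on UNIV \<zeta> \<and>
     inner_face \<Omega>2s \<Omega>1s = face_map \<zeta> n ` inner_face \<Omega>1s \<Omega>2s"

definition auxiliary_solution ::
  "'a::euclidean_space set \<Rightarrow> 'a set \<Rightarrow> 'a set \<Rightarrow> real \<Rightarrow> ('a \<Rightarrow> real) \<Rightarrow> ('a \<Rightarrow> real) \<Rightarrow>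
     ('a \<Rightarrow> real) \<Rightarrow> bool" where
  "auxiliary_solution \<Omega> \<Omega>1s \<Omega>2s \<rho>2 f u u2 \<longleftrightarrow> u2 \<in> sobolev 1 \<Omega>2s \<and>
     zero_on_boundary_part \<Omega>2s (frontier \<Omega>2s \<inter> frontier \<Omega>) u2 \<and>
     zero_on_boundary_part \<Omega>2s (inner_face \<Omega>2s \<Omega>1s) (\<lambda>x. u2 x - u x) \<and>
     (\<forall>\<phi>\<in>H10 \<Omega>2s.
        (\<integral>x. \<rho>2 * (weak_gradient \<Omega>2s u2 x \<bullet> weak_gradient \<Omega>2s \<phi> x) \<partial>lebesgue_on \<Omega>2s) =
        (\<integral>x. f x * \<phi> x \<partial>lebesgue_on \<Omega>2s))"

end

theory Submission imports Defs "HOL-Real_Asymp.Real_Asymp" begin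

text \<open>
  Put \<open>w = u2 - u\<close>. Subtracting the two weak equations gives, for every test function \<open>\<phi>\<close> of
  \<open>\<Omega>2s\<close>, that the energy product of \<open>w\<close> and \<open>\<phi>\<close> is \<open>\<rho>1 - \<rho>2\<close> times the integral of
  \<open>\<nabla>u2 \<bullet> \<nabla>\<phi>\<close> over the overlap. Green's formula turns the latter into an integral of \<open>f \<phi>\<close> over the
  overlap plus a flux integral over the planar face, and since \<open>\<phi>\<close> vanishes on the opposite face,
  integration along the normal bounds the two by \<open>d\<^sub>o\<close> and \<open>d\<^sub>o\<^sup>1\<^sup>/\<^sup>2\<close> times the norm of
  \<open>\<nabla>\<phi>\<close>, respectively. It remains to take \<open>\<phi> = w\<close>. The two boundary conditions on \<open>w\<close> come with two
  different approximating sequences \<open>\<psi>\<close> and \<open>\<eta>\<close>, each vanishing near one part of the boundary; the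
  function \<open>\<psi> \<eta> (\<psi> + \<eta>) / (\<psi>\<^sup>2 + \<eta>\<^sup>2 + \<epsilon>\<^sup>2)\<close> vanishes near the whole boundary, is close to \<open>w\<close>, and its
  gradient is at most four times those of \<open>\<psi>\<close> and \<open>\<eta>\<close> together. Hence these test functions converge to \<open>w\<close>
  weakly and with a controlled gradient norm, which is enough.
\<close>

section \<open>Smooth functions and bumps\<close>

text \<open>The obstacle is the choice \<phi> = \<open>w\<close>: neither boundary condition alone
  supplies test functions of the patch that approximate \<open>w\<close>, and a nonlinear
  combination of two sequences gives no strong convergence of gradients. None is required. The
  energy identity is linear in the gradient of \<phi>, and the factor paired with it is the fixed
  field \<rho> times the gradient of \<open>w\<close>, so weak convergence identifies the limit. The
  bound on the gradients, 4 times the norm of the gradient of \<open>w\<close> from each sequence,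
  then leaves one power of this norm on the right against two on the left; hence the factor 8 in the
  constant. The two parts on which \<open>w\<close> vanishes must cover the whole frontier of the
  patch. The doubtful points are those on the edge of the interface, which have to be shown to lie
  outside \<Omega>. Weak convergence follows from boundedness together with convergence against test
  functions. The density behind this step comes from a monotone class argument on bounded Borel
  functions, not from mollification, and the same argument yields the fundamental lemma of the
  calculus of variations.\<close>

lemma pderiv_dir_eq:
  assumes "(f has_derivative f') (at x)"
  shows "pderiv_dir b f x = f' b"
  using frechet_derivative_at[OF assms] by (simp add: pderiv_dir_def)

lemma pderiv_dir_cong_open:
  assumes "open S" "x \<in> S" "\<And>y. y \<in> S \<Longrightarrow> f y = g y"
  shows "pderiv_dir b f x = pderiv_dir b g x"
proof -
  have "\<And>D. (f has_derivative D) (at x) \<longleftrightarrow> (g has_derivative D) (at x)"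
    using has_derivative_transform_within_open[OF _ assms(1,2)] assms(3) by metis
  then show ?thesis by (simp add: pderiv_dir_def frechet_derivative_def)
qed

lemma differentiable_cong_open:
  assumes "open S" "x \<in> S" "\<And>y. y \<in> S \<Longrightarrow> f y = g y" "f differentiable (at x)"
  shows "g differentiable (at x)"
  using assms has_derivative_transform_within_open[OF _ assms(1,2)] unfolding differentiable_def by metis

lemma Ck_on_cong:
  assumes "open S" "\<And>x. x \<in> S \<Longrightarrow> f x = g x" "Ck_on k S f"
  shows "Ck_on k S g"
  using assms(2,3)
proof (induction k arbitrary: f g)
  case 0
  then show ?case by (auto intro: continuous_on_eq)
next
  case (Suc k)
  have "g differentiable (at x)" if "x \<in> S" for x
    using differentiable_cong_open[OF assms(1) that] Suc.prems that by auto
  moreover have "Ck_on k S (pderiv_dir b g)" if "b \<in> Basis" for b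
    using Suc.IH[of "pderiv_dir b f"] Suc.prems pderiv_dir_cong_open[OF assms(1)] that
    by (metis Ck_on.simps(2))
  ultimately show ?case by simp
qed

lemma Ck_on_subset: "Ck_on k S f \<Longrightarrow> T \<subseteq> S \<Longrightarrow> Ck_on k T f"
  by (induction k arbitrary: f) (auto intro: continuous_on_subset)

lemma Ck_on_Suc_lower: "Ck_on (Suc k) S f \<Longrightarrow> Ck_on k S f"
proof (induction k arbitrary: f)
  case 0
  then show ?case
    by (auto simp: continuous_at_imp_continuous_on differentiable_imp_continuous_within)
qed simp

text \<open>Differentiability at a point depends only on a neighbourhood of it. Extensions by zero
  are shown to be smooth this way, piece by piece on an open cover.\<close>

lemma Ck_on_local:
  assumes "\<And>x. x \<in> S \<Longrightarrow> \<exists>T. open T \<and> x \<in> T \<and> Ck_on k T f"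
  shows "Ck_on k S f"
  using assms
proof (induction k arbitrary: f)
  case 0
  have "\<exists>T. open T \<and> x \<in> T \<and> continuous_on T f" if "x \<in> S" for x
    using 0[OF that] by simp
  then have "continuous (at x) f" if "x \<in> S" for x
    using that continuous_on_eq_continuous_at by blast
  then show ?case
    by (simp add: continuous_at_imp_continuous_on)
next
  case (Suc k)
  have "f differentiable (at x)" if "x \<in> S" for x
    using Suc.prems[OF that] by auto
  moreover have "Ck_on k S (pderiv_dir b f)" if "b \<in> Basis" for b
    by (rule Suc.IH) (use Suc.prems that in fastforce)
  ultimately show ?case by simp
qed

lemma Ck_on_const: "Ck_on k S (\<lambda>x. c)"
proof (induction k arbitrary: c)
  case (Suc k)
  have "pderiv_dir b (\<lambda>x::'a. c) = (\<lambda>x. 0)" for b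
    by (rule ext, subst pderiv_dir_eq[OF has_derivative_const]) simp
  then show ?case using Suc by simp
qed simp

lemma pderiv_dir_add:
  assumes "f differentiable (at x)" "g differentiable (at x)"
  shows "pderiv_dir b (\<lambda>x. f x + g x) x = pderiv_dir b f x + pderiv_dir b g x"
  unfolding pderiv_dir_def
  by (subst frechet_derivative_at[symmetric, OF has_derivative_add])
    (use assms in \<open>auto simp: frechet_derivative_works[symmetric]\<close>)

lemma pderiv_dir_mult:
  assumes "f differentiable (at x)" "g differentiable (at x)"
  shows "pderiv_dir b (\<lambda>x. f x * g x) x = f x * pderiv_dir b g x + pderiv_dir b f x * g x"
  unfolding pderiv_dir_def
  by (subst frechet_derivative_at[symmetric, OF has_derivative_mult])
    (use assms in \<open>auto simp: frechet_derivative_works[symmetric]\<close>)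

lemma pderiv_dir_inverse:
  assumes "f differentiable (at x)" "f x \<noteq> 0"
  shows "pderiv_dir b (\<lambda>x. inverse (f x)) x = - (pderiv_dir b f x * (inverse (f x) * inverse (f x)))"
proof -
  have "(f has_derivative frechet_derivative f (at x)) (at x)"
    using assms(1) by (simp add: frechet_derivative_works)
  from pderiv_dir_eq[OF Deriv.has_derivative_inverse[OF assms(2) this]]
  show ?thesis by (simp add: pderiv_dir_def algebra_simps)
qed

lemma Ck_on_add:
  assumes "open S" "Ck_on k S f" "Ck_on k S g"
  shows "Ck_on k S (\<lambda>x. f x + g x)"
  using assms(2,3)
proof (induction k arbitrary: f g)
  case 0
  then show ?case by (auto intro: continuous_intros)
next
  case (Suc k)
  have "Ck_on k S (pderiv_dir b (\<lambda>x. f x + g x))" if b: "b \<in> Basis" for b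
    by (rule Ck_on_cong[OF assms(1) _ Suc.IH[of "pderiv_dir b f" "pderiv_dir b g"]])
      (use Suc.prems b in \<open>auto simp: pderiv_dir_add\<close>)
  then show ?case using Suc.prems by (auto intro: differentiable_add)
qed

lemma Ck_on_mult:
  assumes "open S" "Ck_on k S f" "Ck_on k S g"
  shows "Ck_on k S (\<lambda>x. f x * g x)"
  using assms(2,3)
proof (induction k arbitrary: f g)
  case 0
  then show ?case by (auto intro: continuous_intros)
next
  case (Suc k)
  have "Ck_on k S (pderiv_dir b (\<lambda>x. f x * g x))" if b: "b \<in> Basis" for b
  proof (rule Ck_on_cong[OF assms(1)])
    show "Ck_on k S (\<lambda>x. f x * pderiv_dir b g x + pderiv_dir b f x * g x)"
      using Suc.prems b
      by (intro Ck_on_add Suc.IH assms(1)) (auto intro: Ck_on_Suc_lower simp del: Ck_on.simps, auto)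
  qed (use Suc.prems b in \<open>auto simp: pderiv_dir_mult\<close>)
  then show ?case using Suc.prems by auto
qed

lemma Ck_on_inverse:
  assumes "open S" "Ck_on k S f" "\<And>x. x \<in> S \<Longrightarrow> f x \<noteq> 0"
  shows "Ck_on k S (\<lambda>x. inverse (f x))"
  using assms(2)
proof (induction k)
  case 0
  then show ?case using assms(3) by (auto intro: continuous_on_inverse)
next
  case (Suc k)
  have *: "Ck_on k S (\<lambda>x. inverse (f x))"
    using Suc Ck_on_Suc_lower by blast
  have "Ck_on k S (pderiv_dir b (\<lambda>x. inverse (f x)))" if b: "b \<in> Basis" for b
  proof (rule Ck_on_cong[OF assms(1)])
    show "Ck_on k S (\<lambda>x. (- 1) * (pderiv_dir b f x * (inverse (f x) * inverse (f x))))"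
      using Suc.prems b * by (intro Ck_on_mult assms(1) Ck_on_const) auto
  qed (use Suc.prems b assms(3) in \<open>auto simp: pderiv_dir_inverse\<close>)
  then show ?case using Suc.prems assms(3)
    by (auto simp: differentiable_inverse)
qed

lemma smooth_on_const: "smooth_on S (\<lambda>x. c)"
  by (simp add: smooth_on_def Ck_on_const)

lemma smooth_on_add: "open S \<Longrightarrow> smooth_on S f \<Longrightarrow> smooth_on S g \<Longrightarrow> smooth_on S (\<lambda>x. f x + g x)"
  by (simp add: smooth_on_def Ck_on_add)

lemma smooth_on_mult: "open S \<Longrightarrow> smooth_on S f \<Longrightarrow> smooth_on S g \<Longrightarrow> smooth_on S (\<lambda>x. f x * g x)"
  by (simp add: smooth_on_def Ck_on_mult)

lemma smooth_on_diff: "open S \<Longrightarrow> smooth_on S f \<Longrightarrow> smooth_on S g \<Longrightarrow> smooth_on S (\<lambda>x. f x - g x)"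
  using smooth_on_add[of S f "\<lambda>x. (-1) * g x"] smooth_on_mult[of S "\<lambda>x. -1" g] smooth_on_const[of S "-1"]
  by simp

lemma smooth_on_divide:
  "open S \<Longrightarrow> smooth_on S f \<Longrightarrow> smooth_on S g \<Longrightarrow> (\<And>x. x \<in> S \<Longrightarrow> g x \<noteq> 0) \<Longrightarrow> smooth_on S (\<lambda>x. f x / g x)"
  by (simp add: smooth_on_def Ck_on_mult Ck_on_inverse divide_inverse)

lemma smooth_on_sum:
  assumes "open S" "finite I" "\<And>i. i \<in> I \<Longrightarrow> smooth_on S (f i)"
  shows "smooth_on S (\<lambda>x. \<Sum>i\<in>I. f i x)"
  using assms(2,3) by (induction I) (auto simp: smooth_on_const smooth_on_add assms(1))

lemma smooth_on_prod:
  assumes "open S" "finite I" "\<And>i. i \<in> I \<Longrightarrow> smooth_on S (f i)"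
  shows "smooth_on S (\<lambda>x. \<Prod>i\<in>I. f i x)"
  using assms(2,3) by (induction I) (auto simp: smooth_on_const smooth_on_mult assms(1))

lemma smooth_on_subset: "smooth_on S f \<Longrightarrow> T \<subseteq> S \<Longrightarrow> smooth_on T f"
  by (auto simp: smooth_on_def intro: Ck_on_subset)

lemma smooth_on_cong: "open S \<Longrightarrow> (\<And>x. x \<in> S \<Longrightarrow> f x = g x) \<Longrightarrow> smooth_on S f \<Longrightarrow> smooth_on S g"
  by (auto simp: smooth_on_def intro: Ck_on_cong)

lemma smooth_on_local:
  assumes "\<And>x. x \<in> S \<Longrightarrow> \<exists>T. open T \<and> x \<in> T \<and> smooth_on T f"
  shows "smooth_on S f"
  using assms Ck_on_local unfolding smooth_on_def by metis

lemma smooth_on_pderiv_dir: "smooth_on S f \<Longrightarrow> b \<in> Basis \<Longrightarrow> smooth_on S (pderiv_dir b f)"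
  unfolding smooth_on_def by (metis Ck_on.simps(2))

lemma smooth_on_imp_differentiable: "smooth_on S f \<Longrightarrow> x \<in> S \<Longrightarrow> f differentiable (at x)"
  unfolding smooth_on_def by (metis Ck_on.simps(2))

lemma smooth_on_imp_continuous_on: "smooth_on S f \<Longrightarrow> continuous_on S f"
  unfolding smooth_on_def by (metis Ck_on.simps(1))

text \<open>The case \<open>m = 0\<close> is the classical function that is flat at the origin. The
  powers in the denominator make the family closed under differentiation up to linear
  combinations.\<close>

definition flat_exp :: "nat \<Rightarrow> real \<Rightarrow> real" where
  "flat_exp m t = (if t \<le> 0 then 0 else exp (- (1 / t)) / t ^ m)"

lemma flat_exp_pos_iff: "flat_exp m t > 0 \<longleftrightarrow> t > 0" "flat_exp m t \<ge> 0" "t \<le> 0 \<Longrightarrow> flat_exp m t = 0"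
  by (auto simp: flat_exp_def)

lemma flat_exp_deriv:
  "(flat_exp m has_real_derivative (flat_exp (m + 2) t - real m * flat_exp (m + 1) t)) (at t)"
proof -
  consider "t < 0" | "t = 0" | "t > 0" by linarith
  then show ?thesis
  proof cases
    case 1
    have "((\<lambda>t. 0) has_real_derivative (flat_exp (m + 2) t - real m * flat_exp (m + 1) t)) (at t)"
      using 1 by (auto simp: flat_exp_def)
    then show ?thesis
      by (rule has_field_derivative_transform_within_open[of _ _ _ "{..<0}"]) (use 1 in \<open>auto simp: flat_exp_def\<close>)
  next
    case 2
    \<comment> \<open>The two one-sided limits of the difference quotient are treated separately: on
      the right the exponential beats every power, on the left the function is zero.\<close>
    have "((\<lambda>h. flat_exp m h / h) \<longlongrightarrow> 0) (at_right 0)"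
    proof (rule Lim_transform_eventually)
      show "((\<lambda>h. exp (- (1 / h)) / h ^ (Suc m)) \<longlongrightarrow> 0) (at_right (0::real))"
        by real_asymp
      show "\<forall>\<^sub>F x in at_right 0. exp (- (1 / x)) / x ^ Suc m = flat_exp m x / x"
        by (auto simp: eventually_at_filter flat_exp_def)
    qed
    moreover have "((\<lambda>h. flat_exp m h / h) \<longlongrightarrow> 0) (at_left 0)"
      by (rule tendsto_eventually) (auto simp: eventually_at_filter flat_exp_def)
    ultimately have "((\<lambda>h. flat_exp m h / h) \<longlongrightarrow> 0) (at 0)"
      by (simp add: filterlim_split_at)
    then have "(flat_exp m has_real_derivative 0) (at 0)"
      by (simp add: DERIV_def flat_exp_def)
    then show ?thesis using 2 by (simp add: flat_exp_def)
  next
    case 3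
    have "((\<lambda>t. exp (- (1 / t)) / t ^ m) has_real_derivative (flat_exp (m + 2) t - real m * flat_exp (m + 1) t)) (at t)"
      using 3 by (auto intro!: derivative_eq_intros simp: flat_exp_def)
        (cases m; auto simp: field_simps power2_eq_square)
    then show ?thesis
      by (rule has_field_derivative_transform_within_open[of _ _ _ "{0<..}"]) (use 3 in \<open>auto simp: flat_exp_def\<close>)
  qed
qed

text \<open>Affine inner functions suffice for boxes. The induction on the order covers all
  \<open>m\<close> at once, because one derivative involves the members \<open>m + 1\<close> and
  \<open>m + 2\<close>.\<close>

lemma smooth_on_flat_exp_affine: "smooth_on UNIV (\<lambda>x. flat_exp m (v \<bullet> x + c))"
proof -
  have "\<forall>m. Ck_on k UNIV (\<lambda>x. flat_exp m (v \<bullet> x + c))" for k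
  proof (induction k)
    case 0
    have "continuous_on UNIV (flat_exp m)" for m
      using DERIV_isCont[OF flat_exp_deriv] continuous_at_imp_continuous_on by blast
    then show ?case
      using continuous_on_compose2[where s = UNIV and t = UNIV and f = "\<lambda>x. v \<bullet> x + c"]
      by (auto simp: continuous_on_add continuous_on_inner)
  next
    case (Suc k)
    show ?case
    proof
      fix m
      let ?d = "\<lambda>t. flat_exp (m + 2) t - real m * flat_exp (m + 1) t"
      have D: "((\<lambda>x. flat_exp m (v \<bullet> x + c)) has_derivative (\<lambda>h. (v \<bullet> h) * ?d (v \<bullet> x + c))) (at x)" for x
      proof -
        have "((\<lambda>x. v \<bullet> x + c) has_derivative (\<lambda>h. v \<bullet> h)) (at x)"
          by (auto intro!: derivative_eq_intros)
        from has_derivative_compose[OF this flat_exp_deriv[of m, unfolded has_field_derivative_def]]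
        show ?thesis by (simp only: mult.commute)
      qed
      have "Ck_on k UNIV (pderiv_dir b (\<lambda>x. flat_exp m (v \<bullet> x + c)))" for b
      proof (rule Ck_on_cong[OF open_UNIV])
        show "Ck_on k UNIV (\<lambda>x. (v \<bullet> b) * (flat_exp (m + 2) (v \<bullet> x + c) + (- real m) * flat_exp (m + 1) (v \<bullet> x + c)))"
          using Suc by (intro Ck_on_mult Ck_on_add Ck_on_const) auto
      qed (use pderiv_dir_eq[OF D] in auto)
      then show "Ck_on (Suc k) UNIV (\<lambda>x. flat_exp m (v \<bullet> x + c))"
        using D by (auto simp: differentiable_def)
    qed
  qed
  then show ?thesis by (simp add: smooth_on_def)
qed

text \<open>A product over the coordinates of two flat exponentials, one for each of the two
  opposite sides of the box; it is positive exactly where all factors are.\<close>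

lemma smooth_box_bump:
  fixes a b :: "'a::euclidean_space"
  obtains P :: "'a \<Rightarrow> real" where "smooth_on UNIV P" "\<And>x. P x \<ge> 0" "\<And>x. P x > 0 \<longleftrightarrow> x \<in> box a b"
proof
  let ?P = "\<lambda>x. \<Prod>i\<in>Basis. (flat_exp 0 (i \<bullet> x + (- (a \<bullet> i))) * flat_exp 0 ((-i) \<bullet> x + b \<bullet> i))"
  show "smooth_on UNIV ?P"
    by (intro smooth_on_prod smooth_on_mult smooth_on_flat_exp_affine) auto
  show nn: "?P x \<ge> 0" for x
    by (auto intro!: prod_nonneg simp: flat_exp_pos_iff)
  show "?P x > 0 \<longleftrightarrow> x \<in> box a b" for x
  proof
    assume "x \<in> box a b"
    then show "?P x > 0"
      by (auto intro!: prod_pos simp: flat_exp_pos_iff box_def inner_commute)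
  next
    assume "?P x > 0"
    then have "\<forall>i\<in>Basis. flat_exp 0 (i \<bullet> x + (- (a \<bullet> i))) * flat_exp 0 ((-i) \<bullet> x + b \<bullet> i) \<noteq> 0"
      by (metis (no_types, lifting) finite_Basis less_irrefl prod_zero)
    then show "x \<in> box a b"
      by (auto simp: flat_exp_def box_def inner_commute split: if_splits)
  qed
qed

section \<open>A monotone class principle for test functions\<close>

lemma test_functions_mono: "D \<subseteq> E \<Longrightarrow> test_functions D \<subseteq> test_functions E"
  by (auto simp: test_functions_def)

text \<open>An open set is a countable union of boxes, each with a bump \<open>P n\<close>. The sums
  \<open>Q k\<close> of the first bumps, multiplied by \<open>k\<close>, grow to infinity on
  \<open>U\<close> and vanish off it, so \<open>Q k / (1 + Q k)\<close> lies between 0 and 1 and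
  tends to the indicator. The supports stay in \<open>K\<close> because \<open>K\<close> is
  closed.\<close>

lemma open_indicator_test_approx:
  fixes U :: "'a::euclidean_space set"
  assumes "open U" "U \<subseteq> K" "compact K" "K \<subseteq> D"
  obtains \<phi> :: "nat \<Rightarrow> 'a \<Rightarrow> real" where
    "\<And>k. \<phi> k \<in> test_functions D" "\<And>k x. 0 \<le> \<phi> k x \<and> \<phi> k x \<le> 1" "\<And>k x. x \<notin> K \<Longrightarrow> \<phi> k x = 0"
    "\<And>x. (\<lambda>k. \<phi> k x) \<longlonglongrightarrow> indicator U x"
proof -
  obtain \<D> where D: "countable \<D>" "\<D> \<subseteq> Pow U" "\<And>X. X \<in> \<D> \<Longrightarrow> \<exists>a b. X = box a b" "\<Union>\<D> = U"
    using open_countable_Union_open_box[OF \<open>open U\<close>] by blast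
  \<comment> \<open>The empty set, itself a degenerate box, is inserted so that the family is
    nonempty and its enumeration by the naturals is onto even when \<open>U\<close> is
    empty.\<close>
  define B where "B n = from_nat_into (insert {} \<D>) n" for n
  have range_B: "range B = insert {} \<D>"
    unfolding B_def using D(1) by (metis countable_insert insert_not_empty range_from_nat_into)
  have "box 0 0 = ({} :: 'a set)" by (simp add: box_eq_empty)
  then have "\<exists>a b. X = box a b" if "X \<in> insert {} \<D>" for X :: "'a set"
    using D(3) that by (metis insertE)
  then have "\<exists>a b. B n = box a b" for n
    using range_B by blast
  then have "\<exists>P. smooth_on UNIV P \<and> (\<forall>x. P x \<ge> 0) \<and> (\<forall>x. P x > (0::real) \<longleftrightarrow> x \<in> B n)" for n
    using smooth_box_bump by metis
  then obtain P where P: "\<And>n. smooth_on UNIV (P n)" "\<And>n x. P n x \<ge> (0::real)" "\<And>n x. P n x > 0 \<longleftrightarrow> x \<in> B n"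
    by metis
  define Q where "Q k x = real k * (\<Sum>n<k. P n x)" for k x
  define \<phi> where "\<phi> k x = Q k x / (1 + Q k x)" for k x
  have Q0: "Q k x \<ge> 0" for k x
    unfolding Q_def using P(2) by (simp add: sum_nonneg)
  have PU: "P n x = 0" if "x \<notin> U" for n x
  proof -
    have "x \<notin> B n" using range_B D(4) that by blast
    then show ?thesis using P(2,3)[of n x] by fastforce
  qed
  have out: "\<phi> k x = 0" if "x \<notin> U" for k x
    using PU[OF that] by (simp add: \<phi>_def Q_def)
  have sm: "smooth_on UNIV (\<phi> k)" for k
  proof -
    have "smooth_on UNIV (Q k)"
      unfolding Q_def by (intro smooth_on_mult smooth_on_const smooth_on_sum P) auto
    moreover have "1 + Q k x \<noteq> 0" for x using Q0[of k x] by linarith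
    ultimately show ?thesis
      unfolding \<phi>_def by (intro smooth_on_divide smooth_on_add smooth_on_const) auto
  qed
  have cl: "closure {x. \<phi> k x \<noteq> 0} \<subseteq> K" for k
    using out assms by (intro closure_minimal compact_imp_closed) auto
  show ?thesis
  proof (rule that)
    show "\<phi> k \<in> test_functions D" for k
      using sm cl[of k] assms closed_subset
      by (auto simp: test_functions_def compact_eq_bounded_closed intro: bounded_subset)
    show "0 \<le> \<phi> k x \<and> \<phi> k x \<le> 1" for k x
      using Q0[of k x] by (auto simp: \<phi>_def field_simps)
    show "\<phi> k x = 0" if "x \<notin> K" for k x using out that assms by blast
    show "(\<lambda>k. \<phi> k x) \<longlonglongrightarrow> indicator U x" for x
    proof (cases "x \<in> U")
      case False
      then show ?thesis using out by simp
    next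
      case True
      then obtain m where m: "x \<in> B m" using range_B D(4) by (metis UnionE imageE insertCI)
      then have Pm: "P m x > 0" using P(3) by blast
      have "1 - \<phi> k x \<le> 1 / (1 + real k * P m x)" if "k > m" for k
      proof -
        have "P m x \<le> (\<Sum>n<k. P n x)" using P(2) that by (intro member_le_sum) auto
        then have *: "real k * P m x \<le> Q k x" unfolding Q_def by (intro mult_left_mono) auto
        have "1 - \<phi> k x = 1 / (1 + Q k x)"
          using Q0[of k x] by (simp add: \<phi>_def field_simps)
        also have "\<dots> \<le> 1 / (1 + real k * P m x)"
          using * Pm by (intro divide_left_mono) (auto intro!: mult_pos_pos add_pos_nonneg simp: Q0)
        finally show ?thesis .
      qed
      then have ev: "\<forall>\<^sub>F k in sequentially. 1 - \<phi> k x \<le> 1 / (1 + real k * P m x)"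
        by (auto intro: eventually_mono[OF eventually_gt_at_top[of m]])
      have "(\<lambda>k. 1 - \<phi> k x) \<longlonglongrightarrow> 0"
      proof (rule tendsto_sandwich[of "\<lambda>_. 0", OF _ ev])
        show "(\<lambda>k. 1 / (1 + real k * P m x)) \<longlonglongrightarrow> 0" using Pm by real_asymp
        show "\<forall>\<^sub>F k in sequentially. 0 \<le> 1 - \<phi> k x"
          using Q0[of _ x] by (intro always_eventually allI) (simp add: \<phi>_def pos_divide_le_eq add_pos_nonneg)
      qed auto
      from tendsto_diff[OF tendsto_const[of 1] this] True show ?thesis by simp
    qed
  qed
qed

text \<open>A property that is linear and stable under bounded pointwise limits with a common
  compact support passes from test functions to indicators of open sets, from these by a Dynkin
  argument to indicators of Borel sets, and then through simple functions and monotone limits to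
  bounded Borel functions.\<close>

lemma bounded_borel_test_induct:
  fixes P :: "('a::euclidean_space \<Rightarrow> real) \<Rightarrow> bool"
  assumes D: "open D"
    and test: "\<And>\<phi>. \<phi> \<in> test_functions D \<Longrightarrow> P \<phi>"
    and lin: "\<And>f g a b. P f \<Longrightarrow> P g \<Longrightarrow> P (\<lambda>x. a * f x + b * g x)"
    and lim: "\<And>K M u v. compact K \<Longrightarrow> K \<subseteq> D \<Longrightarrow> (\<And>i::nat. u i \<in> borel_measurable borel) \<Longrightarrow>
      (\<And>i x. \<bar>u i x\<bar> \<le> M) \<Longrightarrow> (\<And>i x. x \<notin> K \<Longrightarrow> u i x = 0) \<Longrightarrow>
      (\<And>x. (\<lambda>i. u i x) \<longlonglongrightarrow> v x) \<Longrightarrow> (\<And>i. P (u i)) \<Longrightarrow> P v"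
    and v: "v \<in> borel_measurable borel" "\<And>x. \<bar>v x\<bar> \<le> M" "\<And>x. x \<notin> K \<Longrightarrow> v x = 0"
    and K: "compact K" "K \<subseteq> D"
  shows "P v"
proof -
  obtain e where e: "e > 0" "(\<Union>x\<in>K. cball x e) \<subseteq> D"
    using compact_subset_open_imp_cball_epsilon_subset[OF K(1) D K(2)] by blast
  \<comment> \<open>All limits have to take place inside one compact subset of \<open>D\<close>. The
    open collar \<open>V\<close> of \<open>K\<close> lies in the compact set \<open>K'\<close>, and
    everything below is cut off to \<open>V\<close>.\<close>
  define V where "V = (\<Union>x\<in>K. ball x e)"
  define K' where "K' = {x + y | x y. x \<in> K \<and> y \<in> cball 0 e}"
  have K': "compact K'" unfolding K'_def by (intro compact_sums K) auto
  have "K' \<subseteq> D"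
  proof
    fix z assume "z \<in> K'"
    then obtain x y where "x \<in> K" "norm y \<le> e" "z = x + y" by (auto simp: K'_def)
    then have "z \<in> cball x e" by (simp add: dist_norm)
    with e(2) \<open>x \<in> K\<close> show "z \<in> D" by blast
  qed
  have VK': "V \<subseteq> K'"
  proof
    fix z assume "z \<in> V"
    then obtain x where "x \<in> K" "dist x z < e" by (auto simp: V_def)
    then have "z = x + (z - x) \<and> x \<in> K \<and> z - x \<in> cball 0 e"
      by (auto simp: dist_norm norm_minus_commute)
    then show "z \<in> K'" unfolding K'_def by blast
  qed
  have "open V" by (auto simp: V_def)
  have KV: "K \<subseteq> V" using e by (auto simp: V_def)
  have P_open: "P (indicator U)" if U: "open U" "U \<subseteq> V" for U
  proof -
    obtain \<phi> where \<phi>: "\<And>k. \<phi> k \<in> test_functions D" "\<And>k x. 0 \<le> \<phi> k x \<and> \<phi> k x \<le> (1::real)"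
      "\<And>k x. x \<notin> K' \<Longrightarrow> \<phi> k x = 0" "\<And>x. (\<lambda>k. \<phi> k x) \<longlonglongrightarrow> indicator U x"
      using open_indicator_test_approx[OF U(1) _ K' \<open>K' \<subseteq> D\<close>] U(2) VK' by blast
    show ?thesis
    proof (rule lim[OF K' \<open>K' \<subseteq> D\<close>, of \<phi> 1])
      show "\<phi> i \<in> borel_measurable borel" for i
        using \<phi>(1)[of i] by (intro borel_measurable_continuous_onI smooth_on_imp_continuous_on) (simp add: test_functions_def)
    qed (use \<phi> test in \<open>auto simp: abs_le_iff intro: order_trans[of _ 0]\<close>)
  qed
  have P0: "P (\<lambda>x. 0)" using lin[OF P_open[of V] P_open[of V], of 0 0] \<open>open V\<close> by simp
  have P_add: "P (\<lambda>x. f x + g x)" if "P f" "P g" for f g using lin[OF that, of 1 1] by simp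
  have P_cmult: "P (\<lambda>x. c * f x)" if "P f" for c f using lin[OF that that, of c 0] by simp
  have P_diff: "P (\<lambda>x. f x - g x)" if "P f" "P g" for f g using lin[OF that, of 1 "-1"] by simp
  have P_sum: "P (\<lambda>x. \<Sum>i\<in>I. f i x)" if "finite I" "\<And>i. i \<in> I \<Longrightarrow> P (f i)" for I and f :: "nat \<Rightarrow> 'a \<Rightarrow> real"
    using that by (induction I) (auto simp: P0 intro: P_add)
  \<comment> \<open>Complements are taken relative to \<open>V\<close>, whose indicator is already
    covered; the open sets form the generator that is stable under intersection.\<close>
  have P_set: "P (indicator (A \<inter> V))" if "A \<in> sets borel" for A
  proof -
    have "Int_stable {S :: 'a set. open S}" "{S :: 'a set. open S} \<subseteq> Pow UNIV"
      by (auto simp: Int_stable_def)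
    moreover have "A \<in> sigma_sets UNIV {S. open S}"
      using that by (simp add: borel_def)
    ultimately show ?thesis
    proof (induction rule: sigma_sets_induct_disjoint)
      case (basic A)
      then show ?case using P_open[of "A \<inter> V"] \<open>open V\<close> by auto
    next
      case empty
      then show ?case using P0 by (simp add: indicator_def)
    next
      case (compl A)
      have "(indicator ((UNIV - A) \<inter> V) :: 'a \<Rightarrow> real) = (\<lambda>x. indicator V x - indicator (A \<inter> V) x)"
        by (auto simp: indicator_def)
      then show ?case using P_diff[OF P_open[of V] compl(2)] \<open>open V\<close> by simp
    next
      case (union A)
      define u where "u k x = (\<Sum>i<k. (indicator (A i \<inter> V) x :: real))" for k x
      have disj: "disjoint_family A" by fact
      have u: "u k x = indicator ((\<Union>i<k. A i) \<inter> V) x" for k x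
      proof -
        have "indicator (\<Union>i<k. A i \<inter> V) x = (\<Sum>i<k. indicator (A i \<inter> V) x :: real)"
          using disj by (intro indicator_UN_disjoint) (auto simp: disjoint_family_on_def)
        moreover have "(\<Union>i<k. A i \<inter> V) = (\<Union>i<k. A i) \<inter> V" by auto
        ultimately show ?thesis by (simp add: u_def)
      qed
      have Ab: "A i \<in> sets borel" for i
        using union(2) by (auto simp: borel_def)
      show ?case
      proof (rule lim[OF K' \<open>K' \<subseteq> D\<close>, of u 1])
        show "u i \<in> borel_measurable borel" for i
          unfolding u_def using Ab \<open>open V\<close>
          by (intro borel_measurable_sum borel_measurable_indicator) auto
        show "\<bar>u i x\<bar> \<le> 1" for i x by (simp add: u indicator_def)
        show "u i x = 0" if "x \<notin> K'" for i x using that VK' by (auto simp: u indicator_def)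
        show "P (u i)" for i unfolding u_def using union by (intro P_sum) auto
        show "(\<lambda>i. u i x) \<longlonglongrightarrow> indicator (\<Union> (range A) \<inter> V) x" for x
        proof (cases "x \<in> \<Union> (range A) \<inter> V")
          case True
          then obtain m where "x \<in> A m" "x \<in> V" by auto
          then have "\<forall>\<^sub>F i in sequentially. u i x = 1"
            by (intro eventually_mono[OF eventually_gt_at_top[of m]]) (auto simp: u indicator_def)
          then show ?thesis using True by (simp add: tendsto_eventually)
        next
          case False
          then have "u i x = 0" for i by (auto simp: u indicator_def)
          then show ?thesis using False by simp
        qed
      qed
    qed
  qed
  \<comment> \<open>Boundedness is a premise inside the claim, since the induction rule runs over
    all nonnegative Borel functions whereas the limit rule for \<open>P\<close> requires a common
    bound. Nonnegativity lets the bound descend to summands and to members of the increasing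
    sequence.\<close>
  have P_nonneg: "(\<exists>M. \<forall>x. u x \<le> M) \<longrightarrow> P (\<lambda>x. u x * indicator V x)"
    if u: "u \<in> borel_measurable borel" "\<And>x. 0 \<le> u x" for u
    using u
  proof (induct rule: borel_measurable_induct_real)
    case (set A)
    then show ?case using P_set[of A] by (simp add: indicator_inter_arith[abs_def])
  next
    case (mult u c)
    show ?case
    proof (cases "c = 0")
      case True
      then show ?thesis using P0 by simp
    next
      case False
      have "P (\<lambda>x. c * (u x * indicator V x))" if "\<forall>x. c * u x \<le> M" for M
      proof -
        have "\<forall>x. u x \<le> M / c" using that False mult(1) by (simp add: field_simps)
        then show ?thesis using mult P_cmult by blast
      qed
      then show ?thesis by (auto simp: mult.assoc)
    qed
  next
    case (add u v)
    show ?case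
    proof
      assume "\<exists>M. \<forall>x. v x + u x \<le> M"
      then obtain M where *: "\<forall>x. v x + u x \<le> M" by blast
      have "\<forall>x. v x \<le> M" "\<forall>x. u x \<le> M"
        using * add by (smt (verit))+
      then show "P (\<lambda>x. (v x + u x) * indicator V x)"
        using add P_add by (simp add: distrib_right) blast
    qed
  next
    case (seq U)
    show ?case
    proof
      assume "\<exists>M. \<forall>x. u x \<le> M"
      then obtain M where *: "\<forall>x. u x \<le> M" by blast
      have le: "U i x \<le> u x" for i x
        using seq(4,5) by (intro incseq_le[of "\<lambda>i. U i x"]) (auto simp: incseq_def le_fun_def)
      show "P (\<lambda>x. u x * indicator V x)"
      proof (rule lim[OF K' \<open>K' \<subseteq> D\<close>, of "\<lambda>i x. U i x * indicator V x" M])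
        show "(\<lambda>x. U i x * indicator V x) \<in> borel_measurable borel" for i
          using seq(1) \<open>open V\<close> by (intro borel_measurable_times borel_measurable_indicator) auto
        show "\<bar>U i x * indicator V x\<bar> \<le> M" for i x
          using le[of i x] * seq(2)[of i x] by (auto simp: indicator_def) (metis order_trans)+
        show "U i x * indicator V x = 0" if "x \<notin> K'" for i x using that VK' by (auto simp: indicator_def)
        show "P (\<lambda>x. U i x * indicator V x)" for i
          using seq(3)[of i] le * order_trans by blast
        show "(\<lambda>i. U i x * indicator V x) \<longlonglongrightarrow> u x * indicator V x" for x
          using seq(5) by (intro tendsto_mult_right) auto
      qed
    qed
  qed
  have vb: "v x \<le> M" "- v x \<le> M" "M \<ge> 0" for x using v(2)[of x] by auto
  have 1: "P (\<lambda>x. max 0 (v x) * indicator V x)"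
    using P_nonneg[of "\<lambda>x. max 0 (v x)"] v(1) vb by auto
  have 2: "P (\<lambda>x. max 0 (- v x) * indicator V x)"
    using P_nonneg[of "\<lambda>x. max 0 (- v x)"] v(1) vb by auto
  have "v = (\<lambda>x. max 0 (v x) * indicator V x - max 0 (- v x) * indicator V x)"
    using v(3) KV by (fastforce simp: indicator_def max_def)
  then show ?thesis using P_diff[OF 1 2] by simp
qed

section \<open>Square-integrable functions\<close>

lemma L2_measurable: "f \<in> L2 M \<Longrightarrow> f \<in> borel_measurable M"
  and L2_integrable: "f \<in> L2 M \<Longrightarrow> integrable M (\<lambda>x. (norm (f x))\<^sup>2)"
  by (auto simp: L2_def)

lemma L2_I: "f \<in> borel_measurable M \<Longrightarrow> integrable M (\<lambda>x. (norm (f x))\<^sup>2) \<Longrightarrow> f \<in> L2 M"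
  by (auto simp: L2_def)

lemma L2_norm_nonneg: "L2_norm M f \<ge> 0"
  by (simp add: L2_norm_def)

lemma L2_norm_power2: "(L2_norm M f)\<^sup>2 = (\<integral>x. (norm (f x))\<^sup>2 \<partial>M)"
  by (simp add: L2_norm_def)

lemma L2_bound:
  assumes "f \<in> borel_measurable M" "g \<in> L2 M" "AE x in M. norm (f x) \<le> c * norm (g x)"
  shows "f \<in> L2 M"
proof (rule L2_I[OF assms(1)])
  have "integrable M (\<lambda>x. c\<^sup>2 * (norm (g x))\<^sup>2)"
    using L2_integrable[OF assms(2)] by simp
  then show "integrable M (\<lambda>x. (norm (f x))\<^sup>2)"
  proof (rule Bochner_Integration.integrable_bound)
    show "AE x in M. norm ((norm (f x))\<^sup>2) \<le> norm (c\<^sup>2 * (norm (g x))\<^sup>2)"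
      using assms(3)
    proof eventually_elim
      case (elim x)
      then have "(norm (f x))\<^sup>2 \<le> (c * norm (g x))\<^sup>2" by (intro power_mono) auto
      then show ?case by (simp add: power_mult_distrib)
    qed
  qed (use assms(1) in measurable)
qed

lemma L2_norm_bound:
  assumes "g \<in> L2 M" "AE x in M. norm (f x) \<le> c * norm (g x)" "c \<ge> 0"
  shows "L2_norm M f \<le> c * L2_norm M g"
proof -
  have "(\<integral>x. (norm (f x))\<^sup>2 \<partial>M) \<le> (\<integral>x. c\<^sup>2 * (norm (g x))\<^sup>2 \<partial>M)"
  proof (rule integral_mono_AE')
    show "integrable M (\<lambda>x. c\<^sup>2 * (norm (g x))\<^sup>2)" using L2_integrable[OF assms(1)] by simp
    show "AE x in M. (norm (f x))\<^sup>2 \<le> c\<^sup>2 * (norm (g x))\<^sup>2"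
      using assms(2)
    proof eventually_elim
      case (elim x)
      then have "(norm (f x))\<^sup>2 \<le> (c * norm (g x))\<^sup>2" by (intro power_mono) auto
      then show ?case by (simp add: power_mult_distrib)
    qed
  qed auto
  then have "L2_norm M f \<le> sqrt (c\<^sup>2 * (\<integral>x. (norm (g x))\<^sup>2 \<partial>M))"
    unfolding L2_norm_def by (intro real_sqrt_le_mono) simp
  then show ?thesis using assms(3) by (simp add: L2_norm_def real_sqrt_mult)
qed

lemma L2_cong_AE:
  assumes "f \<in> L2 M" "g \<in> borel_measurable M" "AE x in M. f x = g x"
  shows "g \<in> L2 M"
  by (rule L2_bound[OF assms(2,1), of 1]) (use assms(3) in \<open>auto elim: eventually_mono\<close>)

lemma L2_norm_cong_AE:
  assumes "f \<in> borel_measurable M" "g \<in> borel_measurable M" "AE x in M. f x = g x"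
  shows "L2_norm M f = L2_norm M g"
  unfolding L2_norm_def
  by (intro arg_cong[where f = sqrt] integral_cong_AE) (use assms in \<open>auto elim: eventually_mono\<close>)

lemma L2_add:
  assumes "f \<in> L2 M" "g \<in> L2 M"
  shows "(\<lambda>x. f x + g x) \<in> L2 M"
proof (rule L2_I)
  have [measurable]: "f \<in> borel_measurable M" "g \<in> borel_measurable M"
    using assms L2_measurable by auto
  show "(\<lambda>x. f x + g x) \<in> borel_measurable M" by measurable
  have "integrable M (\<lambda>x. 2 * (norm (f x))\<^sup>2 + 2 * (norm (g x))\<^sup>2)"
    using assms by (auto simp: L2_integrable)
  then show "integrable M (\<lambda>x. (norm (f x + g x))\<^sup>2)"
  proof (rule Bochner_Integration.integrable_bound, goal_cases)
    case 2
    have "(norm (f x + g x))\<^sup>2 \<le> 2 * (norm (f x))\<^sup>2 + 2 * (norm (g x))\<^sup>2" for x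
    proof -
      have "(norm (f x + g x))\<^sup>2 \<le> (norm (f x) + norm (g x))\<^sup>2"
        by (intro power_mono norm_triangle_ineq) auto
      also have "\<dots> \<le> 2 * (norm (f x))\<^sup>2 + 2 * (norm (g x))\<^sup>2"
        using sum_squares_bound[of "norm (f x)" "norm (g x)"] by (simp add: power2_sum)
      finally show ?thesis .
    qed
    then show ?case by simp
  qed measurable
qed

lemma L2_scaleR: "f \<in> L2 M \<Longrightarrow> (\<lambda>x. c *\<^sub>R f x) \<in> L2 M"
  by (rule L2_bound[of _ _ f "\<bar>c\<bar>"]) (auto dest: L2_measurable)

lemma L2_cmult: "f \<in> L2 M \<Longrightarrow> (\<lambda>x. c * f x :: real) \<in> L2 M"
  using L2_scaleR[of f M c] by simp

lemma L2_diff: "f \<in> L2 M \<Longrightarrow> g \<in> L2 M \<Longrightarrow> (\<lambda>x. f x - g x) \<in> L2 M"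
  using L2_add[of f M "\<lambda>x. (-1) *\<^sub>R g x"] L2_scaleR[of g M "-1"] by simp

lemma L2_inner_left: "f \<in> L2 M \<Longrightarrow> (\<lambda>x. f x \<bullet> b) \<in> L2 M"
  by (rule L2_bound[of _ _ f "norm b"])
    (auto dest: L2_measurable simp: mult.commute[of "norm b"] Cauchy_Schwarz_ineq2)

lemma L2_components:
  fixes f :: "'a \<Rightarrow> 'b::euclidean_space"
  assumes "\<And>b. b \<in> Basis \<Longrightarrow> (\<lambda>x. f x \<bullet> b) \<in> L2 M"
  shows "f \<in> L2 M"
proof (rule L2_I)
  show "f \<in> borel_measurable M"
    using assms L2_measurable by (subst borel_measurable_euclidean_space) auto
  have "(norm (f x))\<^sup>2 = (\<Sum>b\<in>Basis. (norm (f x \<bullet> b))\<^sup>2)" for x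
    using euclidean_inner[of "f x" "f x"] by (simp add: power2_norm_eq_inner) (simp add: power2_eq_square)
  then show "integrable M (\<lambda>x. (norm (f x))\<^sup>2)"
    by (simp only:) (intro Bochner_Integration.integrable_sum L2_integrable assms)
qed

lemma L2_integrable_inner:
  assumes "f \<in> L2 M" "g \<in> L2 M"
  shows "integrable M (\<lambda>x. f x \<bullet> g x)"
proof (rule Bochner_Integration.integrable_bound)
  have [measurable]: "f \<in> borel_measurable M" "g \<in> borel_measurable M"
    using assms L2_measurable by auto
  show "integrable M (\<lambda>x. (norm (f x))\<^sup>2 + (norm (g x))\<^sup>2)"
    using assms by (auto simp: L2_integrable)
  show "(\<lambda>x. f x \<bullet> g x) \<in> borel_measurable M" by measurable
  have "\<bar>f x \<bullet> g x\<bar> \<le> (norm (f x))\<^sup>2 + (norm (g x))\<^sup>2" for x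
    using Cauchy_Schwarz_ineq2[of "f x" "g x"] sum_squares_bound[of "norm (f x)" "norm (g x)"]
      mult_nonneg_nonneg[OF norm_ge_zero[of "f x"] norm_ge_zero[of "g x"]]
    by linarith
  then show "AE x in M. norm (f x \<bullet> g x) \<le> norm ((norm (f x))\<^sup>2 + (norm (g x))\<^sup>2)"
    by simp
qed

lemma L2_integrable_mult:
  "f \<in> L2 M \<Longrightarrow> g \<in> L2 M \<Longrightarrow> integrable M (\<lambda>x. f x * g x :: real)"
  using L2_integrable_inner[of f M g] by simp

lemma L2_Cauchy_Schwarz:
  assumes "f \<in> L2 M" "g \<in> L2 M"
  shows "\<bar>\<integral>x. f x \<bullet> g x \<partial>M\<bar> \<le> L2_norm M f * L2_norm M g"
proof -
  define A where "A = (\<integral>x. (norm (f x))\<^sup>2 \<partial>M)"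
  define B where "B = (\<integral>x. f x \<bullet> g x \<partial>M)"
  define C where "C = (\<integral>x. (norm (g x))\<^sup>2 \<partial>M)"
  \<comment> \<open>The squared norm of \<open>f + t g\<close> is a nonnegative quadratic in
    \<open>t\<close>; the claim is the sign of its discriminant.\<close>
  have quad: "A + 2 * t * B + t\<^sup>2 * C \<ge> 0" for t
  proof -
    have "0 \<le> (\<integral>x. (norm (f x + t *\<^sub>R g x))\<^sup>2 \<partial>M)" by simp
    also have "(\<lambda>x. (norm (f x + t *\<^sub>R g x))\<^sup>2) =
      (\<lambda>x. (norm (f x))\<^sup>2 + 2 * t * (f x \<bullet> g x) + t\<^sup>2 * (norm (g x))\<^sup>2)"
      by (rule ext) (simp add: power2_norm_eq_inner inner_add_left inner_add_right inner_commute
          power2_eq_square[of t] algebra_simps)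
    also have "integral\<^sup>L M \<dots> = A + 2 * t * B + t\<^sup>2 * C"
      unfolding A_def B_def C_def
      using L2_integrable[OF assms(1)] L2_integrable[OF assms(2)] L2_integrable_inner[OF assms] by simp
    finally show ?thesis .
  qed
  have "A \<ge> 0" "C \<ge> 0" by (auto simp: A_def C_def)
  have "B\<^sup>2 \<le> A * C"
  proof (cases "C = 0")
    case True
    have "B = 0"
    proof (rule ccontr)
      assume "B \<noteq> 0"
      \<comment> \<open>With \<open>C = 0\<close> the quadratic is affine, and at this
        \<open>t\<close> it equals -1.\<close>
      then show False using quad[of "- (A + 1) / (2 * B)"] True by (simp add: field_simps)
    qed
    then show ?thesis using True by simp
  next
    case False
    then show ?thesis
      using quad[of "- B / C"] \<open>C \<ge> 0\<close> by (simp add: field_simps power2_eq_square)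
  qed
  then have "sqrt (B\<^sup>2) \<le> sqrt A * sqrt C"
    by (metis real_sqrt_le_mono real_sqrt_mult)
  then show ?thesis by (simp add: A_def B_def C_def L2_norm_def)
qed

lemma L2_norm_triangle:
  assumes "f \<in> L2 M" "g \<in> L2 M"
  shows "L2_norm M (\<lambda>x. f x + g x) \<le> L2_norm M f + L2_norm M g"
proof (rule power2_le_imp_le)
  have "(L2_norm M (\<lambda>x. f x + g x))\<^sup>2 = (\<integral>x. (norm (f x))\<^sup>2 + 2 * (f x \<bullet> g x) + (norm (g x))\<^sup>2 \<partial>M)"
    unfolding L2_norm_power2
    by (intro Bochner_Integration.integral_cong) (auto simp: power2_norm_eq_inner algebra_simps inner_commute)
  also have "\<dots> = (L2_norm M f)\<^sup>2 + 2 * (\<integral>x. f x \<bullet> g x \<partial>M) + (L2_norm M g)\<^sup>2"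
    unfolding L2_norm_power2
    using L2_integrable[OF assms(1)] L2_integrable[OF assms(2)] L2_integrable_inner[OF assms] by simp
  also have "\<dots> \<le> (L2_norm M f + L2_norm M g)\<^sup>2"
    using L2_Cauchy_Schwarz[OF assms] by (simp add: power2_sum)
  finally show "(L2_norm M (\<lambda>x. f x + g x))\<^sup>2 \<le> (L2_norm M f + L2_norm M g)\<^sup>2" .
qed (simp add: L2_norm_nonneg)

lemma L2_norm_scaleR: "L2_norm M (\<lambda>x. c *\<^sub>R f x) = \<bar>c\<bar> * L2_norm M f"
  by (simp add: L2_norm_def power_mult_distrib real_sqrt_mult)

lemma L2_norm_triangle_diff:
  assumes "f \<in> L2 M" "g \<in> L2 M"
  shows "L2_norm M (\<lambda>x. f x - g x) \<le> L2_norm M f + L2_norm M g"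
  using L2_norm_triangle[OF assms(1) L2_scaleR[OF assms(2), of "-1"]] L2_norm_scaleR[of M "-1" g] by simp

lemma L2_norm_component_le:
  assumes "f \<in> L2 M" "b \<in> Basis"
  shows "L2_norm M (\<lambda>x. f x \<bullet> b) \<le> L2_norm M f"
  using L2_norm_bound[OF assms(1), of "\<lambda>x. f x \<bullet> b" 1] Basis_le_norm[OF assms(2)] by simp

lemma L2_tendsto_zeroI:
  assumes "\<And>n. (\<integral>x. (norm (f n x))\<^sup>2 \<partial>M) = a n" "a \<longlonglongrightarrow> 0"
  shows "(\<lambda>n. L2_norm M (f n)) \<longlonglongrightarrow> 0"
  using tendsto_real_sqrt[OF assms(2)] assms(1) by (simp add: L2_norm_def)

text \<open>The uniform bound \<open>B\<close> on the norms of \<open>e k\<close> makes the pairing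
  with \<open>z i\<close> close to the pairing with \<open>z'\<close> uniformly in \<open>k\<close>,
  so the two limits can be interchanged.\<close>

lemma L2_weak_limit_closed:
  fixes e z :: "nat \<Rightarrow> 'a \<Rightarrow> real"
  assumes e: "\<And>k. e k \<in> L2 M" "\<And>k. L2_norm M (e k) \<le> B"
    and z: "\<And>i. z i \<in> L2 M" "z' \<in> L2 M" "(\<lambda>i. L2_norm M (\<lambda>x. z i x - z' x)) \<longlonglongrightarrow> 0"
    and lim: "\<And>i. (\<lambda>k. \<integral>x. e k x * z i x \<partial>M) \<longlonglongrightarrow> 0"
  shows "(\<lambda>k. \<integral>x. e k x * z' x \<partial>M) \<longlonglongrightarrow> 0"
proof (rule LIMSEQ_I)
  fix r :: real assume "r > 0"
  have B: "B \<ge> 0" using e(2)[of 0] L2_norm_nonneg[of M "e 0"] by linarith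
  have "\<forall>\<^sub>F i in sequentially. L2_norm M (\<lambda>x. z i x - z' x) < r / (2 * (B + 1))"
    using z(3) \<open>r > 0\<close> B by (intro order_tendstoD) auto
  then obtain i where i: "L2_norm M (\<lambda>x. z i x - z' x) < r / (2 * (B + 1))"
    by (auto simp: eventually_sequentially)
  have "\<forall>\<^sub>F k in sequentially. \<bar>\<integral>x. e k x * z i x \<partial>M\<bar> < r / 2"
    using order_tendstoD(2)[OF tendsto_rabs[OF lim[of i]], of "r / 2"] \<open>r > 0\<close> by simp
  then obtain k0 where k0: "\<And>k. k \<ge> k0 \<Longrightarrow> \<bar>\<integral>x. e k x * z i x \<partial>M\<bar> < r / 2"
    by (auto simp: eventually_sequentially)
  show "\<exists>no. \<forall>n\<ge>no. norm ((\<integral>x. e n x * z' x \<partial>M) - 0) < r"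
  proof (intro exI allI impI)
    fix k assume "k \<ge> k0"
    have "(\<integral>x. e k x * z' x \<partial>M) = (\<integral>x. e k x * z i x \<partial>M) - (\<integral>x. e k x \<bullet> (z i x - z' x) \<partial>M)"
      using e z by (subst Bochner_Integration.integral_diff[symmetric])
        (auto intro!: L2_integrable_mult L2_diff simp: algebra_simps)
    moreover have "\<bar>\<integral>x. e k x \<bullet> (z i x - z' x) \<partial>M\<bar> \<le> B * (r / (2 * (B + 1)))"
      using i e(2)[of k] B by (intro order_trans[OF L2_Cauchy_Schwarz[OF e(1) L2_diff[OF z(1,2)]]] mult_mono)
        (auto simp: L2_norm_nonneg)
    moreover have "B * (r / (2 * (B + 1))) \<le> r / 2"
      using B \<open>r > 0\<close> by (simp add: field_simps)
    ultimately show "norm ((\<integral>x. e k x * z' x \<partial>M) - 0) < r"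
      using k0[OF \<open>k \<ge> k0\<close>] unfolding real_norm_def diff_0_right by linarith
  qed
qed

section \<open>The fundamental lemma and weak convergence\<close>

lemma test_functions_continuous: "\<phi> \<in> test_functions D \<Longrightarrow> continuous_on UNIV \<phi>"
  by (simp add: test_functions_def smooth_on_imp_continuous_on)

lemma test_functions_measurable: "\<phi> \<in> test_functions D \<Longrightarrow> \<phi> \<in> borel_measurable borel"
  by (simp add: borel_measurable_continuous_onI test_functions_continuous)

lemma test_functions_differentiable: "\<phi> \<in> test_functions D \<Longrightarrow> \<phi> differentiable (at x)"
  using smooth_on_imp_differentiable by (auto simp: test_functions_def)

lemma compact_support_bounded:
  fixes p :: "'a::euclidean_space \<Rightarrow> real"
  assumes "continuous_on UNIV p" "compact K" "\<And>x. x \<notin> K \<Longrightarrow> p x = 0"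
  obtains M where "\<And>x. \<bar>p x\<bar> \<le> M"
proof -
  have "bounded (p ` K)"
    using compact_continuous_image[OF continuous_on_subset[OF assms(1)] assms(2)] compact_imp_bounded by auto
  then obtain M where M: "\<And>x. x \<in> K \<Longrightarrow> \<bar>p x\<bar> \<le> M"
    unfolding bounded_iff by auto
  have "\<bar>p x\<bar> \<le> max M 0" for x
    using M[of x] assms(3)[of x] by (cases "x \<in> K") auto
  then show ?thesis using that by blast
qed

lemma test_functions_support:
  assumes "\<phi> \<in> test_functions D"
  obtains K M where "compact K" "K \<subseteq> D" "\<And>x. x \<notin> K \<Longrightarrow> \<phi> x = 0" "\<And>x. \<bar>\<phi> x\<bar> \<le> M"
proof -
  define K where "K = closure {x. \<phi> x \<noteq> 0}"
  have K: "compact K" "K \<subseteq> D" using assms by (auto simp: K_def test_functions_def)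
  have out: "\<phi> x = 0" if "x \<notin> K" for x
    using that closure_subset[of "{x. \<phi> x \<noteq> 0}"] unfolding K_def by blast
  obtain M where "\<And>x. \<bar>\<phi> x\<bar> \<le> M"
    using compact_support_bounded[OF test_functions_continuous[OF assms] K(1) out] by blast
  with K out show ?thesis by (rule that)
qed

lemma test_functions_vanish: "\<phi> \<in> test_functions D \<Longrightarrow> x \<notin> D \<Longrightarrow> \<phi> x = 0"
  using closure_subset[of "{x. \<phi> x \<noteq> 0}"] by (auto simp: test_functions_def)

lemma pderiv_dir_zero_off_support:
  assumes "x \<notin> closure {x. \<phi> x \<noteq> 0}"
  shows "pderiv_dir b \<phi> x = 0"
proof -
  have "pderiv_dir b \<phi> x = pderiv_dir b (\<lambda>x. 0) x"
    by (rule pderiv_dir_cong_open[of "- closure {x. \<phi> x \<noteq> 0}"])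
      (use assms closure_subset[of "{x. \<phi> x \<noteq> 0}"] in auto)
  then show ?thesis using pderiv_dir_eq[OF has_derivative_const] by metis
qed

lemma test_functions_pderiv_dir:
  assumes "\<phi> \<in> test_functions D" "b \<in> Basis"
  shows "pderiv_dir b \<phi> \<in> test_functions D"
proof -
  have "{x. pderiv_dir b \<phi> x \<noteq> 0} \<subseteq> closure {x. \<phi> x \<noteq> 0}"
    using pderiv_dir_zero_off_support by blast
  then have "closure {x. pderiv_dir b \<phi> x \<noteq> 0} \<subseteq> closure {x. \<phi> x \<noteq> 0}"
    by (simp add: closure_minimal)
  then show ?thesis
    using assms smooth_on_pderiv_dir unfolding test_functions_def
    by (auto simp: compact_eq_bounded_closed intro: bounded_subset)
qed

lemma borel_measurable_lebesgue_on:
  "f \<in> borel_measurable borel \<Longrightarrow> f \<in> borel_measurable (lebesgue_on S)"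
  by (intro measurable_restrict_space1 measurable_completion) simp

lemma integrable_lebesgue_on_indicator:
  fixes f :: "'a::euclidean_space \<Rightarrow> real"
  assumes "K \<subseteq> D" "K \<in> sets lebesgue" "D \<in> sets lebesgue"
  shows "integrable (lebesgue_on D) (\<lambda>x. indicator K x * f x) \<longleftrightarrow> integrable (lebesgue_on K) f"
    and "(\<integral>x. indicator K x * f x \<partial>lebesgue_on D) = (\<integral>x. f x \<partial>lebesgue_on K)"
proof -
  have *: "(\<lambda>x. indicator D x * (indicator K x * f x)) = (\<lambda>x. indicator K x * f x)"
    using assms(1) by (auto simp: fun_eq_iff indicator_def)
  show "integrable (lebesgue_on D) (\<lambda>x. indicator K x * f x) \<longleftrightarrow> integrable (lebesgue_on K) f"
    using assms by (simp add: integrable_restrict_space *)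
  show "(\<integral>x. indicator K x * f x \<partial>lebesgue_on D) = (\<integral>x. f x \<partial>lebesgue_on K)"
    using assms by (simp add: integral_restrict_space *)
qed

lemma locally_integrable_mult_bounded:
  fixes g v :: "'a::euclidean_space \<Rightarrow> real"
  assumes "open D" "locally_integrable_on g D" "compact K" "K \<subseteq> D"
    and "v \<in> borel_measurable borel" "\<And>x. \<bar>v x\<bar> \<le> M" "\<And>x. x \<notin> K \<Longrightarrow> v x = 0"
  shows "integrable (lebesgue_on D) (\<lambda>x. g x * v x)"
proof -
  have sets: "K \<in> sets lebesgue" "D \<in> sets lebesgue"
    using assms(1,3) borel_compact[of K] by auto
  have gK: "integrable (lebesgue_on D) (\<lambda>x. indicator K x * g x)"
    using assms sets by (simp add: integrable_lebesgue_on_indicator locally_integrable_on_def)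
  have [measurable]: "v \<in> borel_measurable (lebesgue_on D)"
    using assms(5) by (rule borel_measurable_lebesgue_on)
  have [measurable]: "(\<lambda>x. indicator K x * g x) \<in> borel_measurable (lebesgue_on D)"
    using gK by auto
  have eq: "g x * v x = (indicator K x * g x) * v x" for x
    using assms(7)[of x] by (auto simp: indicator_def)
  show ?thesis
  proof (rule Bochner_Integration.integrable_bound[OF integrable_mult_right[OF gK, of M]])
    show "(\<lambda>x. g x * v x) \<in> borel_measurable (lebesgue_on D)"
      unfolding eq by measurable
    show "AE x in lebesgue_on D. norm (g x * v x) \<le> norm (M * (indicator K x * g x))"
    proof (intro AE_I2)
      fix x
      show "norm (g x * v x) \<le> norm (M * (indicator K x * g x))"
        unfolding eq using assms(6)[of x] by (auto simp: abs_mult indicator_def mult.commute[of M] intro!: mult_left_mono)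
    qed
  qed
qed

lemma locally_integrable_mult_test:
  assumes "open D" "locally_integrable_on g D" "\<phi> \<in> test_functions D"
  shows "integrable (lebesgue_on D) (\<lambda>x. g x * \<phi> x)"
  using test_functions_support[OF assms(3)] locally_integrable_mult_bounded[OF assms(1,2)]
    test_functions_measurable[OF assms(3)] by metis

text \<open>The fundamental lemma of the calculus of variations. The vanishing integrals extend from
  test functions to bounded Borel multipliers with compact support in \<open>D\<close>; the sign of
  \<open>g\<close> on a compact set is such a multiplier, and it turns the integral into that of
  \<bar>\<open>g\<close>\<bar>. A countable exhaustion of \<open>D\<close> by compact sets finishes
  the proof.\<close>

lemma locally_integrable_zero_AE:
  fixes g :: "'a::euclidean_space \<Rightarrow> real"
  assumes D: "open D" and g: "locally_integrable_on g D"
    and test: "\<And>\<phi>. \<phi> \<in> test_functions D \<Longrightarrow> (\<integral>x. g x * \<phi> x \<partial>lebesgue_on D) = 0"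
  shows "AE x in lebesgue_on D. g x = 0"
proof -
  have D_sets: "D \<in> sets lebesgue" using D by auto
  have zero: "integrable (lebesgue_on D) (\<lambda>x. g x * v x) \<and> (\<integral>x. g x * v x \<partial>lebesgue_on D) = 0"
    if v: "v \<in> borel_measurable borel" "\<And>x. \<bar>v x\<bar> \<le> M" "\<And>x. x \<notin> K \<Longrightarrow> v x = 0" "compact K" "K \<subseteq> D"
    for v M K
  proof (rule bounded_borel_test_induct[OF D _ _ _ v, where P = "\<lambda>v. integrable (lebesgue_on D) (\<lambda>x. g x * v x) \<and> (\<integral>x. g x * v x \<partial>lebesgue_on D) = 0"])
    fix \<phi> :: "'a \<Rightarrow> real" assume "\<phi> \<in> test_functions D"
    then show "integrable (lebesgue_on D) (\<lambda>x. g x * \<phi> x) \<and> (\<integral>x. g x * \<phi> x \<partial>lebesgue_on D) = 0"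
      using test locally_integrable_mult_test[OF D g] by blast
  next
    fix u v :: "'a \<Rightarrow> real" and a b :: real
    assume uv: "integrable (lebesgue_on D) (\<lambda>x. g x * u x) \<and> (\<integral>x. g x * u x \<partial>lebesgue_on D) = 0"
      "integrable (lebesgue_on D) (\<lambda>x. g x * v x) \<and> (\<integral>x. g x * v x \<partial>lebesgue_on D) = 0"
    have "(\<lambda>x. g x * (a * u x + b * v x)) = (\<lambda>x. a * (g x * u x) + b * (g x * v x))"
      by (auto simp: algebra_simps)
    then show "integrable (lebesgue_on D) (\<lambda>x. g x * (a * u x + b * v x)) \<and>
      (\<integral>x. g x * (a * u x + b * v x) \<partial>lebesgue_on D) = 0"
      using uv by simp
  next
    fix K M and u :: "nat \<Rightarrow> 'a \<Rightarrow> real" and v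
    assume K: "compact K" "K \<subseteq> D" and u: "\<And>i. u i \<in> borel_measurable borel" "\<And>i x. \<bar>u i x\<bar> \<le> M"
      "\<And>i x. x \<notin> K \<Longrightarrow> u i x = 0" "\<And>x. (\<lambda>i. u i x) \<longlonglongrightarrow> v x"
      and I: "\<And>i. integrable (lebesgue_on D) (\<lambda>x. g x * u i x) \<and> (\<integral>x. g x * u i x \<partial>lebesgue_on D) = 0"
    have v1: "v \<in> borel_measurable borel" using u(1,4) by (rule borel_measurable_LIMSEQ_real[rotated])
    have v2: "\<bar>v x\<bar> \<le> M" for x
      using u(2,4) by (intro LIMSEQ_le_const2[OF tendsto_rabs[OF u(4)]]) auto
    have v3: "v x = 0" if "x \<notin> K" for x
      using u(4)[of x] u(3)[OF that] by (simp add: LIMSEQ_const_iff)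
    have int: "integrable (lebesgue_on D) (\<lambda>x. g x * v x)"
      by (rule locally_integrable_mult_bounded[OF D g K v1 v2 v3])
    have gK: "integrable (lebesgue_on D) (\<lambda>x. M * \<bar>g x * indicator K x\<bar>)"
      using borel_compact[OF K(1)]
      by (intro integrable_mult_right integrable_abs locally_integrable_mult_bounded[OF D g K, of _ 1]
          borel_measurable_indicator) auto
    have "(\<lambda>i. \<integral>x. g x * u i x \<partial>lebesgue_on D) \<longlonglongrightarrow> (\<integral>x. g x * v x \<partial>lebesgue_on D)"
    proof (rule integral_dominated_convergence[OF _ _ gK])
      show "AE x in lebesgue_on D. norm (g x * u i x) \<le> M * \<bar>g x * indicator K x\<bar>" for i
      proof (intro AE_I2)
        fix x
        show "norm (g x * u i x) \<le> M * \<bar>g x * indicator K x\<bar>"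
          using u(2)[of i x] u(3)[of x i]
          by (cases "x \<in> K") (auto simp: abs_mult mult.commute[of M] intro!: mult_left_mono)
      qed
      show "AE x in lebesgue_on D. (\<lambda>i. g x * u i x) \<longlonglongrightarrow> g x * v x"
        by (intro AE_I2 tendsto_mult_left u(4))
    qed (use int I in auto)
    then have "(\<integral>x. g x * v x \<partial>lebesgue_on D) = 0"
      using I by (simp add: LIMSEQ_const_iff)
    with int show "integrable (lebesgue_on D) (\<lambda>x. g x * v x) \<and> (\<integral>x. g x * v x \<partial>lebesgue_on D) = 0"
      by blast
  qed
  have on_compact: "AE x in lebesgue. x \<in> K \<longrightarrow> g x = 0" if K: "compact K" "K \<subseteq> D" for K
  proof -
    have K_sets: "K \<in> sets borel" "K \<in> sets lebesgue" using borel_compact[OF K(1)] by auto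
    have gK: "integrable (lebesgue_on K) g" using g K by (simp add: locally_integrable_on_def)
    have "(\<lambda>x. indicator K x * g x) \<in> borel_measurable lebesgue"
      using borel_measurable_integrable[OF gK] K_sets
      by (simp add: borel_measurable_restrict_space_iff)
    then obtain g' where g'[measurable]: "g' \<in> borel_measurable lborel" and "AE x in lborel. indicator K x * g x = g' x"
      using completion_ex_borel_measurable_real by blast
    then have AE_g': "AE x in lebesgue. indicator K x * g x = g' x"
      by (simp add: AE_completion)
    \<comment> \<open>The multiplier has to be Borel while \<open>g\<close> is only Lebesgue
      measurable, so the sign is taken of a Borel function that agrees with \<open>g\<close> almost
      everywhere on \<open>K\<close>.\<close>
    define v where "v x = sgn (g' x) * indicator K x" for x
    have "integrable (lebesgue_on D) (\<lambda>x. g x * v x) \<and> (\<integral>x. g x * v x \<partial>lebesgue_on D) = 0"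
    proof (rule zero[of v 1 K])
      show "v \<in> borel_measurable borel" unfolding v_def
        using g' K_sets by (intro borel_measurable_times borel_measurable_indicator) auto
      show "\<bar>v x\<bar> \<le> 1" for x by (auto simp: v_def indicator_def sgn_if)
      show "v x = 0" if "x \<notin> K" for x using that by (auto simp: v_def)
    qed (use K in auto)
    moreover have "(\<lambda>x. g x * v x) = (\<lambda>x. indicator K x * (g x * v x))"
      by (auto simp: v_def indicator_def)
    ultimately have *: "integrable (lebesgue_on K) (\<lambda>x. g x * v x)" "(\<integral>x. g x * v x \<partial>lebesgue_on K) = 0"
      using integrable_lebesgue_on_indicator[OF K(2) K_sets(2) D_sets, of "\<lambda>x. g x * v x"] by metis+
    have AE1: "AE x in lebesgue_on K. g x * v x = \<bar>g x\<bar>"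
      using AE_g' K_sets by (subst AE_restrict_space_iff) (auto elim!: eventually_mono simp: v_def abs_sgn)
    have "(\<integral>x. \<bar>g x\<bar> \<partial>lebesgue_on K) = 0"
      using integral_cong_AE[OF _ _ AE1] *(2) gK *(1) by (simp add: borel_measurable_integrable)
    then have "AE x in lebesgue_on K. \<bar>g x\<bar> = 0"
      using gK by (subst (asm) integral_nonneg_eq_0_iff_AE) auto
    then show ?thesis using K_sets by (subst (asm) AE_restrict_space_iff) auto
  qed
  obtain C :: "nat \<Rightarrow> 'a set" where C: "\<And>n. compact (C n)" "\<And>n. C n \<subseteq> D" "\<Union>(range C) = D"
    using open_Union_compact_subsets[OF D] by metis
  have "AE x in lebesgue. \<forall>n. x \<in> C n \<longrightarrow> g x = 0"
    using on_compact C by (subst AE_all_countable) blast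
  then have "AE x in lebesgue. x \<in> D \<longrightarrow> g x = 0"
    using C(3) by (auto elim!: eventually_mono)
  then show ?thesis using D_sets by (subst AE_restrict_space_iff) auto
qed

lemma L2_bounded_compact_support:
  fixes v :: "'a::euclidean_space \<Rightarrow> real"
  assumes "open D" "compact K" "v \<in> borel_measurable borel" "\<And>x. \<bar>v x\<bar> \<le> M" "\<And>x. x \<notin> K \<Longrightarrow> v x = 0"
  shows "v \<in> L2 (lebesgue_on D)"
proof (rule L2_I[OF borel_measurable_lebesgue_on[OF assms(3)]])
  have [measurable]: "v \<in> borel_measurable (lebesgue_on D)"
    using assms(3) by (rule borel_measurable_lebesgue_on)
  have "integrable lebesgue (indicator K :: 'a \<Rightarrow> real)"
    using borel_compact[OF assms(2)] emeasure_compact_finite[OF assms(2)]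
    by (intro integrable_real_indicator) auto
  then have "integrable lebesgue (\<lambda>x. M\<^sup>2 * indicator K x)" by simp
  then have "integrable (lebesgue_on D) (\<lambda>x. M\<^sup>2 * indicator K x)"
    using assms(1) integrable_mult_indicator[of D lebesgue "\<lambda>x. M\<^sup>2 * indicator K x"]
    by (subst integrable_restrict_space) (auto simp del: integrable_mult_right_iff real_scaleR_def)
  then show "integrable (lebesgue_on D) (\<lambda>x. (norm (v x))\<^sup>2)"
  proof (rule Bochner_Integration.integrable_bound)
    show "AE x in lebesgue_on D. norm ((norm (v x))\<^sup>2) \<le> norm (M\<^sup>2 * indicator K x)"
    proof (intro AE_I2)
      fix x
      show "norm ((norm (v x))\<^sup>2) \<le> norm (M\<^sup>2 * indicator K x)"
        using assms(5)[of x] power_mono[OF assms(4)[of x] abs_ge_zero, of 2] by (cases "x \<in> K") auto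
    qed
  qed measurable
qed

text \<open>Convergence against test functions extends to bounded Borel functions with compact
  support, because bounded convergence on a compact set implies convergence in the square norm, and
  then by truncation to all square-integrable functions. Both extensions rest on the common bound
  \<open>B\<close>.\<close>

lemma L2_weak_convergence:
  fixes e :: "nat \<Rightarrow> 'a::euclidean_space \<Rightarrow> real"
  assumes D: "open D"
    and e: "\<And>k. e k \<in> L2 (lebesgue_on D)" "\<And>k. L2_norm (lebesgue_on D) (e k) \<le> B"
    and test: "\<And>\<phi>. \<phi> \<in> test_functions D \<Longrightarrow> (\<lambda>k. \<integral>x. e k x * \<phi> x \<partial>lebesgue_on D) \<longlonglongrightarrow> 0"
    and z: "z \<in> L2 (lebesgue_on D)"
  shows "(\<lambda>k. \<integral>x. e k x * z x \<partial>lebesgue_on D) \<longlonglongrightarrow> 0"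
proof -
  define P where "P v \<longleftrightarrow> v \<in> L2 (lebesgue_on D) \<and> (\<lambda>k. \<integral>x. e k x * v x \<partial>lebesgue_on D) \<longlonglongrightarrow> 0" for v
  have D_sets: "D \<in> sets lebesgue" using D by auto
  have bounded: "P v"
    if v: "v \<in> borel_measurable borel" "\<And>x. \<bar>v x\<bar> \<le> M" "\<And>x. x \<notin> K \<Longrightarrow> v x = 0" "compact K" "K \<subseteq> D"
    for v M K
  proof (rule bounded_borel_test_induct[OF D _ _ _ v, where P = P])
    fix \<phi> :: "'a \<Rightarrow> real" assume \<phi>: "\<phi> \<in> test_functions D"
    obtain K M where "compact K" "K \<subseteq> D" "\<And>x. x \<notin> K \<Longrightarrow> \<phi> x = 0" "\<And>x. \<bar>\<phi> x\<bar> \<le> M"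
      using test_functions_support[OF \<phi>] by blast
    then have "\<phi> \<in> L2 (lebesgue_on D)"
      using L2_bounded_compact_support[OF D] test_functions_measurable[OF \<phi>] by blast
    then show "P \<phi>" using test[OF \<phi>] by (simp add: P_def)
  next
    fix u v :: "'a \<Rightarrow> real" and a b :: real
    assume uv: "P u" "P v"
    have "(\<integral>x. e k x * (a * u x + b * v x) \<partial>lebesgue_on D) =
      a * (\<integral>x. e k x * u x \<partial>lebesgue_on D) + b * (\<integral>x. e k x * v x \<partial>lebesgue_on D)" for k
    proof -
      have "(\<lambda>x. e k x * (a * u x + b * v x)) = (\<lambda>x. a * (e k x * u x) + b * (e k x * v x))"
        by (auto simp: algebra_simps)
      moreover have "integrable (lebesgue_on D) (\<lambda>x. e k x * u x)" "integrable (lebesgue_on D) (\<lambda>x. e k x * v x)"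
        using uv e(1) by (auto simp: P_def intro: L2_integrable_mult)
      ultimately show ?thesis by simp
    qed
    moreover have "(\<lambda>k. a * (\<integral>x. e k x * u x \<partial>lebesgue_on D) + b * (\<integral>x. e k x * v x \<partial>lebesgue_on D)) \<longlonglongrightarrow> a * 0 + b * 0"
      using uv unfolding P_def by (intro tendsto_intros) auto
    ultimately show "P (\<lambda>x. a * u x + b * v x)"
      using uv by (simp add: P_def L2_add L2_cmult)
  next
    fix K M and u :: "nat \<Rightarrow> 'a \<Rightarrow> real" and v
    assume K: "compact K" "K \<subseteq> D" and u: "\<And>i. u i \<in> borel_measurable borel" "\<And>i x. \<bar>u i x\<bar> \<le> M"
      "\<And>i x. x \<notin> K \<Longrightarrow> u i x = 0" "\<And>x. (\<lambda>i. u i x) \<longlonglongrightarrow> v x" and I: "\<And>i. P (u i)"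
    have v1: "v \<in> borel_measurable borel" using u(1,4) by (rule borel_measurable_LIMSEQ_real[rotated])
    have v2: "\<bar>v x\<bar> \<le> M" for x
      using u(2,4) by (intro LIMSEQ_le_const2[OF tendsto_rabs[OF u(4)]]) auto
    have v3: "v x = 0" if "x \<notin> K" for x
      using u(4)[of x] u(3)[OF that] by (simp add: LIMSEQ_const_iff)
    have vL: "v \<in> L2 (lebesgue_on D)"
      by (rule L2_bounded_compact_support[OF D K(1) v1 v2 v3])
    have "(\<lambda>x. 2 * M * indicator K x) \<in> L2 (lebesgue_on D)"
      using borel_compact[OF K(1)]
      by (intro L2_bounded_compact_support[OF D K(1), of _ "\<bar>2 * M\<bar>"] borel_measurable_times borel_measurable_indicator)
        (auto simp: indicator_def)
    from L2_integrable[OF this] have dom: "integrable (lebesgue_on D) (\<lambda>x. (norm (2 * M * indicator K x))\<^sup>2)" .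
    have "(\<lambda>i. \<integral>x. (norm (u i x - v x))\<^sup>2 \<partial>lebesgue_on D) \<longlonglongrightarrow> (\<integral>x. 0 \<partial>lebesgue_on D)"
    proof (rule integral_dominated_convergence[OF _ _ dom])
      show "(\<lambda>x. (norm (u i x - v x))\<^sup>2) \<in> borel_measurable (lebesgue_on D)" for i
        using u(1)[of i] v1 by (intro borel_measurable_lebesgue_on) measurable
      show "AE x in lebesgue_on D. (\<lambda>i. (norm (u i x - v x))\<^sup>2) \<longlonglongrightarrow> 0"
      proof (intro AE_I2)
        fix x
        have "(\<lambda>i. (norm (u i x - v x))\<^sup>2) \<longlonglongrightarrow> (norm (v x - v x))\<^sup>2"
          by (intro tendsto_intros u)
        then show "(\<lambda>i. (norm (u i x - v x))\<^sup>2) \<longlonglongrightarrow> 0" by simp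
      qed
      show "AE x in lebesgue_on D. norm ((norm (u i x - v x))\<^sup>2) \<le> (norm (2 * M * indicator K x))\<^sup>2" for i
      proof (intro AE_I2)
        fix x
        show "norm ((norm (u i x - v x))\<^sup>2) \<le> (norm (2 * M * indicator K x))\<^sup>2"
        proof (cases "x \<in> K")
          case True
          have "norm (u i x - v x) \<le> 2 * M" using u(2)[of i x] v2[of x] by auto
          then have "(norm (u i x - v x))\<^sup>2 \<le> (2 * M)\<^sup>2" by (rule power_mono) simp
          then show ?thesis using True by simp
        qed (use u(3) v3 in auto)
      qed
    qed auto
    then have "(\<lambda>i. L2_norm (lebesgue_on D) (\<lambda>x. u i x - v x)) \<longlonglongrightarrow> 0"
      by (intro L2_tendsto_zeroI[OF refl]) simp
    then have "(\<lambda>k. \<integral>x. e k x * v x \<partial>lebesgue_on D) \<longlonglongrightarrow> 0"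
      using L2_weak_limit_closed[where e = e and z = u and z' = v, OF e] I vL unfolding P_def by blast
    then show "P v" using vL by (simp add: P_def)
  qed
  have "(\<lambda>x. indicator D x * z x) \<in> borel_measurable lebesgue"
    using L2_measurable[OF z] D_sets by (simp add: borel_measurable_restrict_space_iff)
  then obtain z' where z'[measurable]: "z' \<in> borel_measurable lborel" and "AE x in lborel. indicator D x * z x = z' x"
    using completion_ex_borel_measurable_real by blast
  then have "AE x in lebesgue. indicator D x * z x = z' x"
    by (simp add: AE_completion)
  then have AE_z': "AE x in lebesgue_on D. z x = z' x"
    using D_sets by (subst AE_restrict_space_iff) (auto elim!: eventually_mono)
  have z'm: "z' \<in> borel_measurable (lebesgue_on D)" using z' by (intro borel_measurable_lebesgue_on) simp
  have z'L: "z' \<in> L2 (lebesgue_on D)" by (rule L2_cong_AE[OF z z'm AE_z'])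
  obtain C :: "nat \<Rightarrow> 'a set" where C: "\<And>n. compact (C n)" "\<And>n. C n \<subseteq> D" "\<Union>(range C) = D"
      "\<And>K. \<lbrakk>compact K; K \<subseteq> D\<rbrakk> \<Longrightarrow> \<exists>N. \<forall>n\<ge>N. K \<subseteq> C n"
    using open_Union_compact_subsets[OF D] by metis
  \<comment> \<open>Truncation in height by \<open>m\<close> and in space by the exhausting compact
    set \<open>C m\<close>; each point of \<open>D\<close> is unaffected from some \<open>m\<close>
    on, and \<open>z'\<close> itself dominates.\<close>
  define v where "v m x = (if \<bar>z' x\<bar> \<le> real m then z' x else 0) * indicator (C m) x" for m x
  have vb: "v m \<in> borel_measurable borel" for m
    unfolding v_def using z' borel_compact[OF C(1)] by (intro borel_measurable_times borel_measurable_indicator) auto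
  have Pv: "P (v m)" for m
    by (rule bounded[OF vb _ _ C(1,2), of _ "real m"]) (auto simp: v_def indicator_def)
  have "(\<lambda>m. \<integral>x. (norm (v m x - z' x))\<^sup>2 \<partial>lebesgue_on D) \<longlonglongrightarrow> (\<integral>x. 0 \<partial>lebesgue_on D)"
  proof (rule integral_dominated_convergence[OF _ _ L2_integrable[OF z'L]])
    show "(\<lambda>x. (norm (v i x - z' x))\<^sup>2) \<in> borel_measurable (lebesgue_on D)" for i
      using vb[of i] z' by (intro borel_measurable_lebesgue_on borel_measurable_power
          borel_measurable_norm borel_measurable_diff) auto
    show "AE x in lebesgue_on D. norm ((norm (v i x - z' x))\<^sup>2) \<le> (norm (z' x))\<^sup>2" for i
      by (intro AE_I2) (auto simp: v_def indicator_def)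
    show "AE x in lebesgue_on D. (\<lambda>m. (norm (v m x - z' x))\<^sup>2) \<longlonglongrightarrow> 0"
    proof (intro AE_I2)
      fix x assume "x \<in> space (lebesgue_on D)"
      then have "x \<in> D" by simp
      then obtain N where N: "\<And>n. n \<ge> N \<Longrightarrow> x \<in> C n" using C(4)[of "{x}"] by auto
      have "\<forall>\<^sub>F m in sequentially. v m x = z' x"
      proof (rule eventually_sequentiallyI)
        fix m assume m: "m \<ge> max N (nat \<lceil>\<bar>z' x\<bar>\<rceil>)"
        then have "\<bar>z' x\<bar> \<le> real m" by linarith
        then show "v m x = z' x" using N[of m] m by (simp add: v_def)
      qed
      then show "(\<lambda>m. (norm (v m x - z' x))\<^sup>2) \<longlonglongrightarrow> 0"
        by (intro tendsto_eventually) (auto elim: eventually_mono)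
    qed
  qed auto
  then have "(\<lambda>m. L2_norm (lebesgue_on D) (\<lambda>x. v m x - z' x)) \<longlonglongrightarrow> 0"
    by (intro L2_tendsto_zeroI[OF refl]) simp
  then have "(\<lambda>k. \<integral>x. e k x * z' x \<partial>lebesgue_on D) \<longlonglongrightarrow> 0"
    using L2_weak_limit_closed[where e = e and z = v and z' = z', OF e] Pv z'L unfolding P_def by blast
  moreover have "(\<integral>x. e k x * z' x \<partial>lebesgue_on D) = (\<integral>x. e k x * z x \<partial>lebesgue_on D)" for k
    using AE_z' L2_measurable[OF z] z'm L2_measurable[OF e(1)[of k]]
    by (intro integral_cong_AE) (auto elim: eventually_mono)
  ultimately show ?thesis by simp
qed

section \<open>The divergence theorem on one side of a plane\<close>

lemma lborel_translate:
  fixes f :: "'a::euclidean_space \<Rightarrow> real"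
  assumes "f \<in> borel_measurable borel"
  shows "(\<integral>x. f (x + c) \<partial>lborel) = (\<integral>x. f x \<partial>lborel)"
    and "integrable lborel (\<lambda>x. f (x + c)) \<longleftrightarrow> integrable lborel f"
proof -
  have "(\<integral>x. f x \<partial>lborel) = (\<integral>x. f x \<partial>distr lborel borel ((+) c))"
    by (simp add: lborel_distr_plus)
  also have "\<dots> = (\<integral>x. f (c + x) \<partial>lborel)"
    using assms by (subst integral_distr) auto
  finally show "(\<integral>x. f (x + c) \<partial>lborel) = (\<integral>x. f x \<partial>lborel)" by (simp add: add.commute)
  have "integrable (distr lborel borel ((+) c)) f \<longleftrightarrow> integrable lborel (\<lambda>x. f (c + x))"
    using assms by (subst integrable_distr_eq) auto
  then show "integrable lborel (\<lambda>x. f (x + c)) \<longleftrightarrow> integrable lborel f"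
    by (simp add: lborel_distr_plus add.commute)
qed

lemma nn_integral_translate:
  fixes f :: "'a::euclidean_space \<Rightarrow> ennreal"
  assumes "f \<in> borel_measurable borel"
  shows "(\<integral>\<^sup>+x. f (x + c) \<partial>lborel) = (\<integral>\<^sup>+x. f x \<partial>lborel)"
proof -
  have "(\<integral>\<^sup>+x. f x \<partial>lborel) = (\<integral>\<^sup>+x. f x \<partial>distr lborel borel ((+) c))"
    by (simp add: lborel_distr_plus)
  also have "\<dots> = (\<integral>\<^sup>+x. f (c + x) \<partial>lborel)"
    using assms by (subst nn_integral_distr) auto
  finally show ?thesis by (simp add: add.commute)
qed

text \<open>Averaging over translates stands in for Fubini in coordinates adapted to the direction \<open>t\<close>.\<close>

lemma lborel_average_along:
  fixes k :: "'a::euclidean_space \<Rightarrow> real"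
  assumes k: "integrable lborel k"
  shows "(\<integral>x. (\<integral>s. indicator {0..1} s * k (x + s *\<^sub>R t) \<partial>lborel) \<partial>lborel) = (\<integral>x. k x \<partial>lborel)"
proof -
  have [measurable]: "k \<in> borel_measurable borel" using borel_measurable_integrable[OF k] by simp
  let ?f = "\<lambda>(s::real) x. indicator {0..1} s * k (x + s *\<^sub>R t)"
  have int: "integrable lborel (\<lambda>x. k (x + s *\<^sub>R t))" for s
    using k by (subst lborel_translate) auto
  have "integrable (lborel \<Otimes>\<^sub>M lborel) (case_prod ?f)"
  proof (rule lborel_pair.Fubini_integrable)
    show "case_prod ?f \<in> borel_measurable (lborel \<Otimes>\<^sub>M lborel)" by measurable
    have "(\<integral>y. norm (case_prod ?f (x, y)) \<partial>lborel) = indicator {0..1} x * (\<integral>x. \<bar>k x\<bar> \<partial>lborel)" for x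
    proof -
      have "(\<integral>y. norm (case_prod ?f (x, y)) \<partial>lborel) = (\<integral>y. indicator {0..1} x * \<bar>k (y + x *\<^sub>R t)\<bar> \<partial>lborel)"
        by (simp add: abs_mult)
      also have "\<dots> = indicator {0..1} x * (\<integral>y. \<bar>k (y + x *\<^sub>R t)\<bar> \<partial>lborel)" by simp
      also have "(\<integral>y. \<bar>k (y + x *\<^sub>R t)\<bar> \<partial>lborel) = (\<integral>x. \<bar>k x\<bar> \<partial>lborel)"
        by (rule lborel_translate(1)[where f = "\<lambda>x. \<bar>k x\<bar>"]) measurable
      finally show ?thesis .
    qed
    moreover have "integrable lborel (\<lambda>x. indicator {0..1::real} x * (\<integral>x. \<bar>k x\<bar> \<partial>lborel))"
      by (intro integrable_mult_left integrable_real_indicator) auto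
    ultimately show "integrable lborel (\<lambda>x. \<integral>y. norm (case_prod ?f (x, y)) \<partial>lborel)" by simp
    show "AE x in lborel. integrable lborel (\<lambda>y. case_prod ?f (x, y))"
      using int by (intro AE_I2) simp
  qed
  from lborel_pair.Fubini_integral[OF this]
  have "(\<integral>x. (\<integral>s. ?f s x \<partial>lborel) \<partial>lborel) = (\<integral>s. (\<integral>x. ?f s x \<partial>lborel) \<partial>lborel)" .
  also have "(\<lambda>s. \<integral>x. ?f s x \<partial>lborel) = (\<lambda>s. indicator {0..1} s * (\<integral>x. k x \<partial>lborel))"
    by (simp add: lborel_translate)
  also have "(\<integral>s. indicator {0..1::real} s * (\<integral>x. k x \<partial>lborel) \<partial>lborel) = (\<integral>x. k x \<partial>lborel)"
    by simp
  finally show ?thesis .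
qed

text \<open>Integrating the line identity over \<open>x\<close>, the two terms in \<open>q\<close>
  cancel by translation invariance, and averaging along \<open>t\<close> returns the integral of
  \<open>k\<close>. The function \<open>j\<close> collects the jumps of \<open>q\<close> on the
  segment from \<open>x\<close> to \<open>x + t\<close>.\<close>

lemma integral_eq_jump_integral:
  fixes q k j :: "'a::euclidean_space \<Rightarrow> real"
  assumes "integrable lborel k" "integrable lborel q" "integrable lborel j"
    and bound: "\<And>x. \<bar>k x\<bar> \<le> M"
    and FTC: "AE x in lborel. ((\<lambda>s. k (x + s *\<^sub>R t)) has_integral (q (x + t) - q x + j x)) {0..1}"
  shows "(\<integral>x. k x \<partial>lborel) = (\<integral>x. j x \<partial>lborel)"
proof -
  have [measurable]: "k \<in> borel_measurable borel" "q \<in> borel_measurable borel" "j \<in> borel_measurable borel"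
    using assms(1-3)[THEN borel_measurable_integrable] by auto
  have qt: "integrable lborel (\<lambda>x. q (x + t))" "(\<integral>x. q (x + t) \<partial>lborel) = (\<integral>x. q x \<partial>lborel)"
    using assms(2) by (simp_all add: lborel_translate)
  have "(\<integral>x. k x \<partial>lborel) = (\<integral>x. (\<integral>s. indicator {0..1} s * k (x + s *\<^sub>R t) \<partial>lborel) \<partial>lborel)"
    by (rule lborel_average_along[OF assms(1), symmetric])
  also have "\<dots> = (\<integral>x. q (x + t) - q x + j x \<partial>lborel)"
  proof (rule integral_cong_AE)
    show "AE x in lborel. (\<integral>s. indicator {0..1} s * k (x + s *\<^sub>R t) \<partial>lborel) = q (x + t) - q x + j x"
      using FTC
    proof eventually_elim
      case (elim x)
      \<comment> \<open>The fundamental theorem of calculus delivers a gauge integral; the bound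
        \<open>M\<close> makes it also a Lebesgue integral, so that the two agree.\<close>
      have "set_integrable lborel {0..1} (\<lambda>s. k (x + s *\<^sub>R t))"
        unfolding set_integrable_def
      proof (rule Bochner_Integration.integrable_bound)
        show "integrable lborel (\<lambda>s. M * indicator {0..1::real} s)"
          by (intro integrable_mult_right integrable_real_indicator) auto
        show "AE s in lborel. norm (indicat_real {0..1} s *\<^sub>R k (x + s *\<^sub>R t)) \<le> norm (M * indicator {0..1::real} s)"
          using bound by (intro AE_I2) (auto simp: indicator_def intro: order_trans[OF _ abs_ge_self])
      qed measurable
      from set_borel_integral_eq_integral(2)[OF this] integral_unique[OF elim]
      show ?case by (simp add: set_lebesgue_integral_def)
    qed
  qed measurable
  also have "\<dots> = (\<integral>x. j x \<partial>lborel)"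
    using qt assms(2,3) by simp
  finally show ?thesis .
qed

lemma integrable_lborel_bounded_compact_support:
  fixes v :: "'a::euclidean_space \<Rightarrow> real"
  assumes "compact K" "v \<in> borel_measurable borel" "\<And>x. \<bar>v x\<bar> \<le> M" "\<And>x. x \<notin> K \<Longrightarrow> v x = 0"
  shows "integrable lborel v"
proof (rule Bochner_Integration.integrable_bound)
  show "integrable lborel (\<lambda>x. M * indicator K x)"
    using borel_compact[OF assms(1)] emeasure_compact_finite[OF assms(1)]
    by (intro integrable_mult_right integrable_real_indicator) auto
  show "AE x in lborel. norm (v x) \<le> norm (M * indicator K x)"
    using assms(3,4) by (intro AE_I2) (auto simp: indicator_def intro: order_trans[OF _ abs_ge_self])
qed (use assms(2) in simp)

lemma AE_lborel_not_hyperplane: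
  fixes n :: "'a::euclidean_space"
  assumes "n \<noteq> 0"
  shows "AE x in lborel. n \<bullet> x \<noteq> c"
proof -
  have "{x. n \<bullet> x = c} \<in> null_sets lborel"
    using negligible_hyperplane[of n c] assms
    by (auto simp: negligible_iff_null_sets null_sets_completion_iff closed_hyperplane borel_closed)
  then show ?thesis by (rule AE_I'[of "{x. n \<bullet> x = c}"]) auto
qed

section \<open>The jump of a cut-off function across a planar piece of boundary\<close>

context
  fixes A W F :: "'a::euclidean_space set" and n p0 :: 'a and p :: "'a \<Rightarrow> real"
  assumes A: "open A" and W: "open W" and F: "frontier A \<inter> W = F"
    and n: "norm n = 1" and plane: "\<And>x. x \<in> F \<Longrightarrow> (x - p0) \<bullet> n = 0"
    and ext: "exterior_normal A F n"
    and p: "Ck_on 1 UNIV p" "compact (closure {x. p x \<noteq> 0})" "closure {x. p x \<noteq> 0} \<subseteq> W"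
begin

private definition "Dp x = frechet_derivative p (at x)"
private definition "q x = indicator A x * p x"
private definition "tau x = (x - p0) \<bullet> n"
private definition "prj x = x - tau x *\<^sub>R n"

private lemma Dp: "(p has_derivative Dp x) (at x)"
  unfolding Dp_def using p(1) by (simp add: frechet_derivative_works[symmetric])

private lemma Dp_expand: "Dp x t = (\<Sum>b\<in>Basis. (t \<bullet> b) * pderiv_dir b p x)"
proof -
  have "linear (Dp x)" using Dp has_derivative_linear by blast
  then have "Dp x (\<Sum>b\<in>Basis. (t \<bullet> b) *\<^sub>R b) = (\<Sum>b\<in>Basis. (t \<bullet> b) *\<^sub>R Dp x b)"
    by (simp add: linear_sum linear_scale)
  then show ?thesis by (simp add: euclidean_representation Dp_def pderiv_dir_def)
qed

private lemma p_cont: "continuous_on UNIV p"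
  using Ck_on_Suc_lower[of 0 UNIV p] p(1) by simp

private lemma Dp_cont: "continuous_on UNIV (\<lambda>x. Dp x t)"
  unfolding Dp_expand using p(1) by (auto intro!: continuous_intros)

private lemma Dp_zero: "x \<notin> closure {x. p x \<noteq> 0} \<Longrightarrow> Dp x t = 0"
  by (simp add: Dp_expand pderiv_dir_zero_off_support)

private lemma p_zero: "x \<notin> closure {x. p x \<noteq> 0} \<Longrightarrow> p x = 0"
  using closure_subset[of "{x. p x \<noteq> 0}"] by blast

text \<open>A point off \<open>F\<close> lies in \<open>A\<close>, or outside the closure of
  \<open>A\<close>, or outside \<open>W\<close>. Near it \<open>q\<close> equals \<open>p\<close> in
  the first case and zero in the other two, the last because the support of \<open>p\<close> is
  closed and contained in \<open>W\<close>.\<close>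

private lemma q_deriv:
  assumes "y \<notin> F"
  shows "(q has_derivative (\<lambda>h. indicator A y * Dp y h)) (at y)"
proof -
  consider "y \<in> A" | "y \<notin> closure A" | "y \<notin> W"
    using assms F A by (auto simp: frontier_def interior_open)
  then show ?thesis
  proof cases
    case 1
    have "(p has_derivative (\<lambda>h. indicator A y * Dp y h)) (at y)" using Dp[of y] 1 by simp
    then show ?thesis
      by (rule has_derivative_transform_within_open[OF _ A 1]) (simp add: q_def)
  next
    case 2
    then have "y \<notin> A" using closure_subset by blast
    then have "((\<lambda>x. 0) has_derivative (\<lambda>h. indicator A y * Dp y h)) (at y)" by simp
    then show ?thesis
      by (rule has_derivative_transform_within_open[of _ _ _ _ "- closure A"])
        (use 2 closure_subset[of A] in \<open>auto simp: q_def indicator_def\<close>)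
  next
    case 3
    then have y: "y \<notin> closure {x. p x \<noteq> 0}" using p(3) by blast
    then have "((\<lambda>x. 0) has_derivative (\<lambda>h. indicator A y * Dp y h)) (at y)" by (simp add: Dp_zero)
    then show ?thesis
      by (rule has_derivative_transform_within_open[of _ _ _ _ "- closure {x. p x \<noteq> 0}"])
        (use y in \<open>auto simp: q_def dest: p_zero\<close>)
  qed
qed

private lemma q_line_deriv:
  assumes "x + s *\<^sub>R t \<notin> F"
  shows "((\<lambda>s. q (x + s *\<^sub>R t)) has_vector_derivative (indicator A (x + s *\<^sub>R t) * Dp (x + s *\<^sub>R t) t)) (at s)"
proof -
  have "((\<lambda>s. x + s *\<^sub>R t) has_derivative (\<lambda>h. h *\<^sub>R t)) (at s)"
    by (auto intro!: derivative_eq_intros)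
  from has_derivative_compose[OF this q_deriv[OF assms]]
  have "((\<lambda>s. q (x + s *\<^sub>R t)) has_derivative (\<lambda>h. indicator A (x + s *\<^sub>R t) * Dp (x + s *\<^sub>R t) (h *\<^sub>R t))) (at s)" .
  moreover have "Dp y (h *\<^sub>R t) = h * Dp y t" for y h
    using Dp[THEN has_derivative_linear] by (simp add: linear_scale)
  ultimately show ?thesis
    by (simp add: has_vector_derivative_def mult.left_commute)
qed

private lemma q_line_integral:
  assumes "\<And>s. s \<in> {0..1} \<Longrightarrow> x + s *\<^sub>R t \<notin> F"
  shows "((\<lambda>s. indicator A (x + s *\<^sub>R t) * Dp (x + s *\<^sub>R t) t) has_integral (q (x + t) - q x)) {0..1}"
proof -
  have "((\<lambda>s. indicator A (x + s *\<^sub>R t) * Dp (x + s *\<^sub>R t) t) has_integral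
      ((\<lambda>s. q (x + s *\<^sub>R t)) 1 - (\<lambda>s. q (x + s *\<^sub>R t)) 0)) {0..1}"
    by (rule fundamental_theorem_of_calculus)
      (auto intro!: has_vector_derivative_at_within q_line_deriv assms)
  then show ?thesis by simp
qed

private lemma tau_line: "tau (x + s *\<^sub>R n) = tau x + s"
  using n by (simp add: tau_def algebra_simps inner_add_left norm_eq_1)

text \<open>A line in direction \<open>n\<close> meets the plane exactly once, at the parameter
  \<open>- tau x\<close>. If the crossing point is in \<open>F\<close>, then \<open>q\<close> drops
  there from \<open>p (prj x)\<close> to 0 since \<open>n\<close> points out of \<open>A\<close>,
  and this drop is the extra term. The two excluded heights keep the crossing away from the ends of
  the parameter interval.\<close>

private lemma q_normal_integral:
  assumes x: "tau x \<noteq> 0" "tau x \<noteq> -1"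
  shows "((\<lambda>s. indicator A (x + s *\<^sub>R n) * Dp (x + s *\<^sub>R n) n) has_integral
    (q (x + n) - q x + indicator {-1..0} (tau x) * (indicator F (prj x) * p (prj x)))) {0..1}"
proof (cases "tau x \<in> {-1..0} \<and> prj x \<in> F")
  case False
  have "x + s *\<^sub>R n \<notin> F" if s: "s \<in> {0..1}" for s
  proof
    assume *: "x + s *\<^sub>R n \<in> F"
    then have "tau (x + s *\<^sub>R n) = 0" using plane by (simp add: tau_def)
    then have "s = - tau x" by (simp add: tau_line)
    then have "prj x \<in> F" "tau x \<in> {-1..0}" using * s by (auto simp: prj_def)
    with False show False by blast
  qed
  then have "((\<lambda>s. indicator A (x + s *\<^sub>R n) * Dp (x + s *\<^sub>R n) n) has_integral (q (x + n) - q x)) {0..1}"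
    by (rule q_line_integral)
  moreover have "indicator {-1..0} (tau x) * (indicator F (prj x) * p (prj x)) = 0"
    using False by (auto simp: indicator_def)
  ultimately show ?thesis by (simp only: add_0_right)
next
  case True
  define s0 where "s0 = - tau x"
  have s0: "0 < s0" "s0 < 1" using True x by (auto simp: s0_def)
  define y0 where "y0 = x + s0 *\<^sub>R n"
  have y0: "y0 = prj x" "y0 \<in> F" using True by (auto simp: y0_def prj_def s0_def)
  have "y0 \<notin> A" using y0(2) F A by (auto simp: frontier_def interior_open)
  obtain \<epsilon> where \<epsilon>: "\<epsilon> > 0" "\<And>t. 0 < t \<Longrightarrow> t < \<epsilon> \<Longrightarrow> y0 - t *\<^sub>R n \<in> A \<and> y0 + t *\<^sub>R n \<notin> A"
    using ext y0(2) unfolding exterior_normal_def by blast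
  have off: "x + s *\<^sub>R n \<notin> F" if "s \<noteq> s0" for s
  proof
    assume "x + s *\<^sub>R n \<in> F"
    then have "tau (x + s *\<^sub>R n) = 0" using plane by (simp add: tau_def)
    then show False using that by (simp add: tau_line s0_def)
  qed
  let ?k = "\<lambda>s. indicator A (x + s *\<^sub>R n) * Dp (x + s *\<^sub>R n) n"
  \<comment> \<open>At the crossing \<open>q\<close> is 0, its limit from the right; replacing this
    value by the limit \<open>p y0\<close> from the left gives a function continuous on the left
    closed piece. On the right piece \<open>q\<close> itself is continuous.\<close>
  let ?r = "\<lambda>s. if s = s0 then p y0 else q (x + s *\<^sub>R n)"
  have pline: "continuous_on UNIV (\<lambda>s. p (x + s *\<^sub>R n))"
    by (rule continuous_on_compose2[OF p_cont]) (auto intro!: continuous_intros)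
  have cont_off: "continuous (at s) (\<lambda>s. q (x + s *\<^sub>R n))" if "s \<noteq> s0" for s
    using q_line_deriv[OF off[OF that]] has_vector_derivative_continuous by blast
  have left: "(?k has_integral (?r s0 - ?r 0)) {0..s0}"
  proof (rule fundamental_theorem_of_calculus_interior)
    have rd: "(?r has_vector_derivative ?k s) (at s)" if "s < s0" for s
      by (rule has_vector_derivative_transform_within_open[of "\<lambda>s. q (x + s *\<^sub>R n)" _ _ "{..<s0}"])
        (use that q_line_deriv[OF off] in auto)
    show "(?r has_vector_derivative ?k s) (at s)" if "s \<in> {0<..<s0}" for s
      using rd that by simp
    show "continuous_on {0..s0} ?r"
      unfolding continuous_on_eq_continuous_within
    proof
      fix s assume s: "s \<in> {0..s0}"
      show "continuous (at s within {0..s0}) ?r"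
      proof (cases "s = s0")
        case False
        then have "s < s0" using s by auto
        then show ?thesis
          by (rule continuous_at_imp_continuous_at_within[OF has_vector_derivative_continuous[OF rd]])
      next
        case True
        have "continuous (at s0 within {0..s0}) (\<lambda>s. p (x + s *\<^sub>R n))"
          using pline by (simp add: continuous_on_eq_continuous_at continuous_at_imp_continuous_at_within)
        then have "continuous (at s0 within {0..s0}) ?r"
        proof (rule continuous_transform_within[OF _ \<epsilon>(1)])
          fix s' assume s': "s' \<in> {0..s0}" "dist s' s0 < \<epsilon>"
          show "p (x + s' *\<^sub>R n) = ?r s'"
          proof (cases "s' = s0")
            case False
            then have "y0 - (s0 - s') *\<^sub>R n \<in> A" using \<epsilon>(2)[of "s0 - s'"] s' by (auto simp: dist_real_def)
            then have "x + s' *\<^sub>R n \<in> A" by (simp add: y0_def algebra_simps)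
            then show ?thesis using False by (simp add: q_def)
          qed (simp add: y0_def)
        qed (use s0 in simp)
        with True show ?thesis by simp
      qed
    qed
  qed (use s0 in simp)
  have right: "(?k has_integral (q (x + 1 *\<^sub>R n) - q (x + s0 *\<^sub>R n))) {s0..1}"
  proof (rule fundamental_theorem_of_calculus_interior)
    show "((\<lambda>s. q (x + s *\<^sub>R n)) has_vector_derivative ?k s) (at s)" if "s \<in> {s0<..<1}" for s
      using that q_line_deriv[OF off] by simp
    show "continuous_on {s0..1} (\<lambda>s. q (x + s *\<^sub>R n))"
      unfolding continuous_on_eq_continuous_within
    proof
      fix s assume s: "s \<in> {s0..1}"
      show "continuous (at s within {s0..1}) (\<lambda>s. q (x + s *\<^sub>R n))"
      proof (cases "s = s0")
        case False
        then show ?thesis using cont_off continuous_at_imp_continuous_at_within by blast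
      next
        case True
        have "continuous (at s0 within {s0..1}) (\<lambda>s. 0 :: real)" by simp
        then have "continuous (at s0 within {s0..1}) (\<lambda>s. q (x + s *\<^sub>R n))"
        proof (rule continuous_transform_within[OF _ \<epsilon>(1)])
          fix s' assume s': "s' \<in> {s0..1}" "dist s' s0 < \<epsilon>"
          show "0 = q (x + s' *\<^sub>R n)"
          proof (cases "s' = s0")
            case False
            then have "y0 + (s' - s0) *\<^sub>R n \<notin> A" using \<epsilon>(2)[of "s' - s0"] s' by (auto simp: dist_real_def)
            then have "x + s' *\<^sub>R n \<notin> A" by (simp add: y0_def algebra_simps)
            then show ?thesis by (simp add: q_def)
          next
            case True
            then show ?thesis using \<open>y0 \<notin> A\<close> by (simp add: q_def y0_def)
          qed
        qed (use s0 in simp)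
        with True show ?thesis by simp
      qed
    qed
  qed (use s0 in simp)
  have "q (x + s0 *\<^sub>R n) = 0" using \<open>y0 \<notin> A\<close> by (simp add: q_def y0_def)
  with has_integral_combine[OF _ _ left right] s0 y0 True show ?thesis
    by (simp add: algebra_simps)
qed

text \<open>The direction \<open>b\<close> splits into its normal part and a vector \<open>t\<close>
  tangent to the plane. Almost every line parallel to the plane misses \<open>F\<close>, so the
  tangential part contributes nothing; the normal part contributes the jump. The right-hand side is
  a surface integral over \<open>F\<close> written over a cylinder of height 1, in accordance with
  \<open>face_measure\<close>.\<close>

lemma integral_pderiv_over_part:
  "integrable lborel (\<lambda>x. indicator A x * pderiv_dir b p x) \<and>
   (\<integral>x. indicator A x * pderiv_dir b p x \<partial>lborel) = (b \<bullet> n) *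
     (\<integral>x. indicator {0..1} ((x - p0) \<bullet> n) *
        (indicator F (x - ((x - p0) \<bullet> n) *\<^sub>R n) * p (x - ((x - p0) \<bullet> n) *\<^sub>R n)) \<partial>lborel)"
proof -
  have AF[measurable]: "A \<in> sets borel" "F \<in> sets borel"
    using A W F by (auto intro: borel_closed)
  have [measurable]: "p \<in> borel_measurable borel" "(\<lambda>x. Dp x t) \<in> borel_measurable borel" for t
    using p_cont Dp_cont by (auto intro: borel_measurable_continuous_onI)
  have [measurable]: "tau \<in> borel_measurable borel" "prj \<in> borel_measurable borel"
    unfolding tau_def[abs_def] prj_def[abs_def] by (auto intro!: borel_measurable_continuous_onI continuous_intros)
  obtain M where M: "\<And>x. \<bar>p x\<bar> \<le> M"
    using compact_support_bounded[OF p_cont p(2) p_zero] by blast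
  have M0: "M \<ge> 0" using M[of 0] by auto
  define k where "k t x = indicator A x * Dp x t" for t x
  have k_bound: "\<exists>M. \<forall>x. \<bar>k t x\<bar> \<le> M" for t
  proof -
    obtain M where "\<And>x. \<bar>Dp x t\<bar> \<le> M"
      using compact_support_bounded[OF Dp_cont p(2) Dp_zero, of t] by blast
    then have "\<bar>k t x\<bar> \<le> max M 0" for x
      unfolding k_def by (cases "x \<in> A") (auto simp: le_max_iff_disj)
    then show ?thesis by blast
  qed
  have k_int: "integrable lborel (k t)" for t
  proof -
    obtain M where "\<And>x. \<bar>k t x\<bar> \<le> M" using k_bound by blast
    moreover have "k t \<in> borel_measurable borel" unfolding k_def[abs_def] by measurable
    ultimately show ?thesis
      using p(2) Dp_zero by (intro integrable_lborel_bounded_compact_support[OF p(2)]) (auto simp: k_def)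
  qed
  have q_int: "integrable lborel q"
  proof (rule integrable_lborel_bounded_compact_support[OF p(2)])
    show "q \<in> borel_measurable borel" unfolding q_def[abs_def] by measurable
    show "\<bar>q x\<bar> \<le> M" for x unfolding q_def using M[of x] M0 by (cases "x \<in> A") auto
    show "q x = 0" if "x \<notin> closure {x. p x \<noteq> 0}" for x using p_zero[OF that] by (simp add: q_def)
  qed
  have n0: "n \<noteq> 0" using n by auto
  have tau_AE: "AE x in lborel. tau x \<noteq> c" for c
    using AE_lborel_not_hyperplane[OF n0, of "c + n \<bullet> p0"]
    by eventually_elim (auto simp: tau_def inner_diff_left inner_commute[of n])
  have tangential: "(\<integral>x. k t x \<partial>lborel) = 0" if t: "t \<bullet> n = 0" for t
  proof -
    obtain M where M: "\<And>x. \<bar>k t x\<bar> \<le> M" using k_bound by blast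
    have "(\<integral>x. k t x \<partial>lborel) = (\<integral>x. 0 \<partial>(lborel :: 'a measure))"
    proof (rule integral_eq_jump_integral[OF k_int q_int _ M])
      show "AE x in lborel. ((\<lambda>s. k t (x + s *\<^sub>R t)) has_integral (q (x + t) - q x + 0)) {0..1}"
        using tau_AE[of 0]
      proof eventually_elim
        case (elim x)
        have "x + s *\<^sub>R t \<notin> F" for s
        proof
          assume "x + s *\<^sub>R t \<in> F"
          then have "(x + s *\<^sub>R t - p0) \<bullet> n = 0" using plane by blast
          then show False using elim t by (simp add: tau_def inner_diff_left inner_add_left)
        qed
        then show ?case using q_line_integral[of x t] by (simp add: k_def)
      qed
    qed simp
    then show ?thesis by simp
  qed
  \<comment> \<open>The crossing parameter \<open>- tau x\<close> lies in the unit interval exactly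
    for heights between -1 and 0. A translation by \<open>n\<close> below moves this slab to heights
    between 0 and 1.\<close>
  define J where "J x = indicator {-1..0} (tau x) * (indicator F (prj x) * p (prj x))" for x
  have J_meas[measurable]: "J \<in> borel_measurable borel" unfolding J_def[abs_def] by measurable
  have J_int: "integrable lborel J"
  proof (rule integrable_lborel_bounded_compact_support)
    let ?K = "{x + y |x y. x \<in> closure {x. p x \<noteq> 0} \<and> y \<in> cball 0 1}"
    show "compact ?K" by (intro compact_sums p(2)) auto
    show "J \<in> borel_measurable borel" by fact
    show "\<bar>J x\<bar> \<le> M" for x unfolding J_def using M[of "prj x"] M0 by (auto simp: indicator_def)
    show "J x = 0" if "x \<notin> ?K" for x
    proof (rule ccontr)
      assume "J x \<noteq> 0"
      then have "prj x \<in> closure {x. p x \<noteq> 0}" "tau x \<in> {-1..0}"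
        using p_zero[of "prj x"] by (auto simp: J_def indicator_def split: if_splits)
      moreover have "x = prj x + tau x *\<^sub>R n" by (simp add: prj_def)
      moreover have "tau x *\<^sub>R n \<in> cball 0 1" using calculation(2) n by auto
      ultimately show False using that by blast
    qed
  qed
  have normal: "(\<integral>x. k n x \<partial>lborel) = (\<integral>x. J x \<partial>lborel)"
  proof -
    obtain M where M: "\<And>x. \<bar>k n x\<bar> \<le> M" using k_bound by blast
    show ?thesis
    proof (rule integral_eq_jump_integral[OF k_int q_int J_int M])
      show "AE x in lborel. ((\<lambda>s. k n (x + s *\<^sub>R n)) has_integral (q (x + n) - q x + J x)) {0..1}"
        using tau_AE[of 0] tau_AE[of "-1"]
      proof eventually_elim
        case (elim x)
        then show ?case using q_normal_integral[of x] by (simp add: k_def J_def)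
      qed
    qed
  qed
  have "(\<integral>x. J x \<partial>lborel) = (\<integral>x. J (x + (- n)) \<partial>lborel)"
    by (rule lborel_translate(1)[symmetric]) measurable
  also have "(\<lambda>x. J (x + (- n))) = (\<lambda>x. indicator {0..1} (tau x) * (indicator F (prj x) * p (prj x)))"
  proof
    fix x
    have t: "tau (x - n) = tau x - 1" using tau_line[of x "-1"] by simp
    then have "prj (x - n) = prj x" by (simp add: prj_def scaleR_left_diff_distrib)
    with t show "J (x + (- n)) = indicator {0..1} (tau x) * (indicator F (prj x) * p (prj x))"
      by (simp add: J_def indicator_def)
  qed
  finally have J_eq: "(\<integral>x. J x \<partial>lborel) = (\<integral>x. indicator {0..1} (tau x) * (indicator F (prj x) * p (prj x)) \<partial>lborel)" .
  \<comment> \<open>The tangential component of \<open>b\<close>, for which the integral was shown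
    to vanish.\<close>
  define t where "t = b - (b \<bullet> n) *\<^sub>R n"
  have "t \<bullet> n = 0" using n by (simp add: t_def inner_diff_left norm_eq_1)
  have kb: "k b x = (b \<bullet> n) * k n x + k t x" for x
  proof -
    have "Dp x b = Dp x ((b \<bullet> n) *\<^sub>R n + t)" by (simp add: t_def)
    also have "\<dots> = (b \<bullet> n) * Dp x n + Dp x t"
      using Dp[THEN has_derivative_linear] by (simp add: linear_add linear_scale)
    finally show ?thesis by (simp add: k_def algebra_simps)
  qed
  have "(\<integral>x. k b x \<partial>lborel) = (b \<bullet> n) * (\<integral>x. k n x \<partial>lborel) + (\<integral>x. k t x \<partial>lborel)"
    unfolding kb using k_int by simp
  then have "(\<integral>x. k b x \<partial>lborel) = (b \<bullet> n) * (\<integral>x. J x \<partial>lborel)"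
    using tangential[OF \<open>t \<bullet> n = 0\<close>] normal by simp
  then show ?thesis using J_eq k_int[of b]
    by (simp add: k_def[abs_def] Dp_def pderiv_dir_def tau_def prj_def)
qed

end

text \<open>The formula without a face: for \<open>A = W = UNIV\<close> the frontier is empty and
  the surface term vanishes.\<close>

lemma integral_pderiv_zero:
  fixes p :: "'a::euclidean_space \<Rightarrow> real"
  assumes "Ck_on 1 UNIV p" "compact (closure {x. p x \<noteq> 0})"
  shows "integrable lborel (pderiv_dir b p)" "(\<integral>x. pderiv_dir b p x \<partial>lborel) = 0"
proof -
  obtain n :: 'a where "norm n = 1" using vector_choose_size[of 1] by auto
  from integral_pderiv_over_part[of UNIV UNIV "{}" n 0 p b] this assms
  show "integrable lborel (pderiv_dir b p)" "(\<integral>x. pderiv_dir b p x \<partial>lborel) = 0"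
    by (auto simp: exterior_normal_def)
qed

section \<open>Weak gradients\<close>

lemma L2_restrict:
  assumes "f \<in> L2 (lebesgue_on D)" "E \<subseteq> D" "E \<in> sets lebesgue" "D \<in> sets lebesgue"
  shows "f \<in> L2 (lebesgue_on E)"
proof (rule L2_I)
  have m: "f \<in> borel_measurable (lebesgue_on D)" using L2_measurable assms by blast
  have eq: "lebesgue_on E = restrict_space (lebesgue_on D) E"
    using assms(2,3,4) by (simp add: restrict_restrict_space inf.absorb2)
  show "f \<in> borel_measurable (lebesgue_on E)"
    unfolding eq using m by (rule measurable_restrict_space1)
  have "integrable lebesgue (\<lambda>x. indicator D x *\<^sub>R (norm (f x))\<^sup>2)"
    using L2_integrable[OF assms(1)] assms(4) by (simp add: integrable_restrict_space)
  from integrable_mult_indicator[OF assms(3) this]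
  have "integrable lebesgue (\<lambda>x. indicator E x *\<^sub>R (norm (f x))\<^sup>2)"
    by (rule back_subst[of "integrable lebesgue"]) (use assms(2) in \<open>auto simp: fun_eq_iff indicator_def\<close>)
  then show "integrable (lebesgue_on E) (\<lambda>x. (norm (f x))\<^sup>2)"
    using assms(3) by (simp add: integrable_restrict_space)
qed

lemma L2_norm_restrict_le:
  assumes "f \<in> L2 (lebesgue_on D)" "E \<subseteq> D" "E \<in> sets lebesgue" "D \<in> sets lebesgue"
  shows "L2_norm (lebesgue_on E) f \<le> L2_norm (lebesgue_on D) f"
proof -
  have "(\<integral>x. (norm (f x))\<^sup>2 \<partial>lebesgue_on E) = (\<integral>x. indicator E x * (norm (f x))\<^sup>2 \<partial>lebesgue_on D)"
    using integrable_lebesgue_on_indicator(2)[OF assms(2-4), of "\<lambda>x. (norm (f x))\<^sup>2"] by simp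
  also have "\<dots> \<le> (\<integral>x. (norm (f x))\<^sup>2 \<partial>lebesgue_on D)"
    using L2_integrable[OF assms(1)] by (intro integral_mono_AE') (auto simp: indicator_def)
  finally show ?thesis by (simp add: L2_norm_def)
qed

lemma integral_lebesgue_on_vanish:
  fixes g :: "'a::euclidean_space \<Rightarrow> real"
  assumes "E \<subseteq> D" "E \<in> sets lebesgue" "D \<in> sets lebesgue" "\<And>x. x \<in> D \<Longrightarrow> x \<notin> E \<Longrightarrow> g x = 0"
  shows "(\<integral>x. g x \<partial>lebesgue_on D) = (\<integral>x. g x \<partial>lebesgue_on E)"
proof -
  have "(\<integral>x. g x \<partial>lebesgue_on D) = (\<integral>x. indicator E x * g x \<partial>lebesgue_on D)"
    using assms(4) by (intro Bochner_Integration.integral_cong) (auto simp: indicator_def)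
  then show ?thesis using integrable_lebesgue_on_indicator(2)[OF assms(1-3)] by metis
qed

text \<open>Connects the two kinds of integrals: Sobolev notions are stated over
  \<open>lebesgue_on D\<close>, whereas translations and Fubini are carried out over
  \<open>lborel\<close>.\<close>

lemma integral_lebesgue_on_borel:
  fixes g :: "'a::euclidean_space \<Rightarrow> real"
  assumes "g \<in> borel_measurable borel" "\<And>x. x \<notin> D \<Longrightarrow> g x = 0" "D \<in> sets lebesgue"
  shows "(\<integral>x. g x \<partial>lebesgue_on D) = (\<integral>x. g x \<partial>lborel)"
proof -
  have "(\<integral>x. g x \<partial>lebesgue_on D) = (\<integral>x. g x \<partial>lebesgue_on UNIV)"
    using assms(2,3) by (intro integral_lebesgue_on_vanish[symmetric]) auto
  also have "\<dots> = (\<integral>x. g x \<partial>lborel)"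
    using assms(1) by (simp add: lebesgue_on_UNIV_eq integral_completion)
  finally show ?thesis .
qed

text \<open>On each member of a compact exhaustion \<open>g\<close> is integrable and hence
  measurable; the cut-off functions converge pointwise to \<open>g\<close> on
  \<open>D\<close>.\<close>

lemma locally_integrable_measurable:
  fixes g :: "'a::euclidean_space \<Rightarrow> real"
  assumes D: "open D" and g: "locally_integrable_on g D"
  shows "g \<in> borel_measurable (lebesgue_on D)"
proof -
  obtain C :: "nat \<Rightarrow> 'a set" where C: "\<And>n. compact (C n)" "\<And>n. C n \<subseteq> D"
      "\<And>K. \<lbrakk>compact K; K \<subseteq> D\<rbrakk> \<Longrightarrow> \<exists>N. \<forall>n\<ge>N. K \<subseteq> C n"
    using open_Union_compact_subsets[OF D] by metis
  show ?thesis
  proof (rule borel_measurable_LIMSEQ_real)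
    show "(\<lambda>x. indicator (C n) x * g x) \<in> borel_measurable (lebesgue_on D)" for n
      using g C(1,2)[of n] D borel_compact[OF C(1)[of n]]
        integrable_lebesgue_on_indicator(1)[OF C(2)[of n], of g]
      by (auto simp: locally_integrable_on_def intro: borel_measurable_integrable)
    fix x assume "x \<in> space (lebesgue_on D)"
    then obtain N where N: "\<And>n. n \<ge> N \<Longrightarrow> x \<in> C n" using C(3)[of "{x}"] by auto
    show "(\<lambda>n. indicator (C n) x * g x) \<longlonglongrightarrow> g x"
      by (rule tendsto_eventually, rule eventually_sequentiallyI[of N]) (use N in auto)
  qed
qed

lemma locally_integrable_diff:
  "locally_integrable_on f D \<Longrightarrow> locally_integrable_on g D \<Longrightarrow> locally_integrable_on (\<lambda>x. f x - g x) D"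
  by (auto simp: locally_integrable_on_def)

lemma L2_imp_locally_integrable:
  fixes g :: "'a::euclidean_space \<Rightarrow> real"
  assumes D: "open D" and g: "g \<in> L2 (lebesgue_on D)"
  shows "locally_integrable_on g D"
  unfolding locally_integrable_on_def
proof (intro allI impI)
  fix K assume "compact K \<and> K \<subseteq> D"
  then have K: "compact K" "K \<subseteq> D" by auto
  have sets: "K \<in> sets lebesgue" "D \<in> sets lebesgue" using borel_compact[OF K(1)] D by auto
  have "(indicator K :: 'a \<Rightarrow> real) \<in> L2 (lebesgue_on D)"
    using borel_compact[OF K(1)]
    by (intro L2_bounded_compact_support[OF D K(1), of _ 1] borel_measurable_indicator) auto
  from L2_integrable_mult[OF this g] show "integrable (lebesgue_on K) g"
    using integrable_lebesgue_on_indicator(1)[OF K(2) sets] by simp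
qed

lemma weak_pderiv_unique:
  assumes D: "open D" and g: "has_weak_pderiv D b v g" and h: "has_weak_pderiv D b v h"
  shows "AE x in lebesgue_on D. g x = h x"
proof -
  have li: "locally_integrable_on g D" "locally_integrable_on h D"
    using g h by (auto simp: has_weak_pderiv_def)
  have "AE x in lebesgue_on D. g x - h x = 0"
  proof (rule locally_integrable_zero_AE[OF D locally_integrable_diff[OF li]])
    fix \<phi> :: "'a \<Rightarrow> real" assume \<phi>: "\<phi> \<in> test_functions D"
    have "(\<integral>x. (g x - h x) * \<phi> x \<partial>lebesgue_on D) = (\<integral>x. g x * \<phi> x \<partial>lebesgue_on D) - (\<integral>x. h x * \<phi> x \<partial>lebesgue_on D)"
      using locally_integrable_mult_test[OF D li(1) \<phi>] locally_integrable_mult_test[OF D li(2) \<phi>]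
      by (simp add: left_diff_distrib)
    moreover have "(\<integral>x. v x * pderiv_dir b \<phi> x \<partial>lebesgue_on D) = - (\<integral>x. g x * \<phi> x \<partial>lebesgue_on D)"
      "(\<integral>x. v x * pderiv_dir b \<phi> x \<partial>lebesgue_on D) = - (\<integral>x. h x * \<phi> x \<partial>lebesgue_on D)"
      using g h \<phi> unfolding has_weak_pderiv_def by blast+
    ultimately show "(\<integral>x. (g x - h x) * \<phi> x \<partial>lebesgue_on D) = 0" by linarith
  qed
  then show ?thesis by (auto elim: eventually_mono)
qed

lemma weak_gradient_unique:
  assumes D: "open D" and "has_weak_gradient D v G" "has_weak_gradient D v H"
  shows "AE x in lebesgue_on D. G x = H x"
proof -
  have "AE x in lebesgue_on D. \<forall>b\<in>Basis. G x \<bullet> b = H x \<bullet> b"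
    using assms weak_pderiv_unique[OF D] unfolding has_weak_gradient_def
    by (subst AE_ball_countable) (auto simp: countable_finite)
  then show ?thesis by eventually_elim (rule euclidean_eqI, blast)
qed

lemma has_weak_gradient_weak_gradient:
  assumes "has_weak_gradient D v G"
  shows "has_weak_gradient D v (weak_gradient D v)"
  unfolding weak_gradient_def using assms by (rule someI[of "has_weak_gradient D v"])

lemma has_weak_gradient_measurable:
  assumes "open D" "has_weak_gradient D v G"
  shows "G \<in> borel_measurable (lebesgue_on D)"
  using assms by (subst borel_measurable_euclidean_space)
    (auto simp: has_weak_gradient_def has_weak_pderiv_def intro: locally_integrable_measurable)

lemma weak_gradient_AE_eq:
  assumes "open D" "has_weak_gradient D v G"
  shows "AE x in lebesgue_on D. weak_gradient D v x = G x"
  using weak_gradient_unique[OF assms(1) has_weak_gradient_weak_gradient[OF assms(2)] assms(2)] .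

text \<open>The recursive definition supplies one weak derivative per basis vector; these are
  assembled into a single vector field, the form in which gradients are used below.\<close>

lemma sobolev_1_iff: "v \<in> sobolev 1 D \<longleftrightarrow> v \<in> L2 (lebesgue_on D) \<and> (\<exists>G\<in>L2 (lebesgue_on D). has_weak_gradient D v G)"
proof
  assume v: "v \<in> sobolev 1 D"
  then have "\<forall>b\<in>Basis. \<exists>g. g \<in> L2 (lebesgue_on D) \<and> has_weak_pderiv D b v g" by auto
  from bchoice[OF this] obtain g where
    g: "\<And>b. b \<in> Basis \<Longrightarrow> g b \<in> L2 (lebesgue_on D) \<and> has_weak_pderiv D b v (g b)"
    by blast
  define G where "G x = (\<Sum>b\<in>Basis. g b x *\<^sub>R b)" for x
  have Gb: "(\<lambda>x. G x \<bullet> b) = g b" if "b \<in> Basis" for b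
    using that by (simp add: G_def)
  have "G \<in> L2 (lebesgue_on D)" by (rule L2_components) (use g in \<open>simp add: Gb\<close>)
  moreover have "has_weak_gradient D v G" unfolding has_weak_gradient_def using g by (simp add: Gb)
  ultimately show "v \<in> L2 (lebesgue_on D) \<and> (\<exists>G\<in>L2 (lebesgue_on D). has_weak_gradient D v G)"
    using v by auto
next
  assume "v \<in> L2 (lebesgue_on D) \<and> (\<exists>G\<in>L2 (lebesgue_on D). has_weak_gradient D v G)"
  then show "v \<in> sobolev 1 D"
    by (auto simp: has_weak_gradient_def intro: L2_inner_left)
qed

text \<open>The representative behind \<open>weak_gradient\<close> is an arbitrary choice and
  carries no integrability of its own. It is square integrable because it agrees almost everywhere
  with a square-integrable weak gradient.\<close>

lemma sobolev_1_weak_gradient: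
  assumes "open D" "v \<in> sobolev 1 D"
  shows "v \<in> L2 (lebesgue_on D)" "has_weak_gradient D v (weak_gradient D v)"
    "weak_gradient D v \<in> L2 (lebesgue_on D)"
proof -
  obtain G where G: "v \<in> L2 (lebesgue_on D)" "G \<in> L2 (lebesgue_on D)" "has_weak_gradient D v G"
    using assms(2) sobolev_1_iff by blast
  show "v \<in> L2 (lebesgue_on D)" by fact
  show wg: "has_weak_gradient D v (weak_gradient D v)"
    by (rule has_weak_gradient_weak_gradient[OF G(3)])
  show "weak_gradient D v \<in> L2 (lebesgue_on D)"
    by (rule L2_cong_AE[OF G(2) has_weak_gradient_measurable[OF assms(1) wg]])
      (rule weak_gradient_unique[OF assms(1) G(3) wg])
qed

lemma has_weak_gradient_diff:
  assumes D: "open D" and "has_weak_gradient D u G" "has_weak_gradient D v H"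
  shows "has_weak_gradient D (\<lambda>x. u x - v x) (\<lambda>x. G x - H x)"
  unfolding has_weak_gradient_def
proof
  fix b :: 'a assume b: "b \<in> Basis"
  have u: "has_weak_pderiv D b u (\<lambda>x. G x \<bullet> b)" and v: "has_weak_pderiv D b v (\<lambda>x. H x \<bullet> b)"
    using assms b by (auto simp: has_weak_gradient_def)
  then have li: "locally_integrable_on u D" "locally_integrable_on v D"
    "locally_integrable_on (\<lambda>x. G x \<bullet> b) D" "locally_integrable_on (\<lambda>x. H x \<bullet> b) D"
    by (auto simp: has_weak_pderiv_def)
  show "has_weak_pderiv D b (\<lambda>x. u x - v x) (\<lambda>x. (G x - H x) \<bullet> b)"
    unfolding has_weak_pderiv_def inner_diff_left
  proof (intro conjI ballI locally_integrable_diff li)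
    fix \<phi> :: "'a \<Rightarrow> real" assume \<phi>: "\<phi> \<in> test_functions D"
    note I = locally_integrable_mult_test[OF D _ test_functions_pderiv_dir[OF \<phi> b]]
      and J = locally_integrable_mult_test[OF D _ \<phi>]
    have "(\<integral>x. (u x - v x) * pderiv_dir b \<phi> x \<partial>lebesgue_on D) =
        (\<integral>x. u x * pderiv_dir b \<phi> x \<partial>lebesgue_on D) - (\<integral>x. v x * pderiv_dir b \<phi> x \<partial>lebesgue_on D)"
      using I[OF li(1)] I[OF li(2)] by (simp add: left_diff_distrib)
    moreover have "(\<integral>x. (G x \<bullet> b - H x \<bullet> b) * \<phi> x \<partial>lebesgue_on D) =
        (\<integral>x. (G x \<bullet> b) * \<phi> x \<partial>lebesgue_on D) - (\<integral>x. (H x \<bullet> b) * \<phi> x \<partial>lebesgue_on D)"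
      using J[OF li(3)] J[OF li(4)] by (simp add: left_diff_distrib)
    ultimately show "(\<integral>x. (u x - v x) * pderiv_dir b \<phi> x \<partial>lebesgue_on D) =
        - (\<integral>x. (G x \<bullet> b - H x \<bullet> b) * \<phi> x \<partial>lebesgue_on D)"
      using u v \<phi> unfolding has_weak_pderiv_def by simp
  qed
qed

text \<open>Every test function of \<open>E\<close> is one of \<open>D\<close>, and all integrands
  vanish off \<open>E\<close>.\<close>

lemma has_weak_gradient_subset:
  assumes "open D" "open E" "E \<subseteq> D" "has_weak_gradient D v G"
  shows "has_weak_gradient E v G"
  unfolding has_weak_gradient_def
proof
  fix b :: 'a assume b: "b \<in> Basis"
  have w: "has_weak_pderiv D b v (\<lambda>x. G x \<bullet> b)"
    using assms b by (auto simp: has_weak_gradient_def)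
  show "has_weak_pderiv E b v (\<lambda>x. G x \<bullet> b)"
    unfolding has_weak_pderiv_def
  proof (intro conjI ballI)
    show "locally_integrable_on v E" "locally_integrable_on (\<lambda>x. G x \<bullet> b) E"
      using w assms(3) unfolding has_weak_pderiv_def locally_integrable_on_def by blast+
    fix \<phi> :: "'a \<Rightarrow> real" assume \<phi>: "\<phi> \<in> test_functions E"
    then have "\<phi> \<in> test_functions D" using test_functions_mono[OF assms(3)] by blast
    then have "(\<integral>x. v x * pderiv_dir b \<phi> x \<partial>lebesgue_on D) = - (\<integral>x. (G x \<bullet> b) * \<phi> x \<partial>lebesgue_on D)"
      using w by (simp add: has_weak_pderiv_def)
    moreover have "(\<integral>x. v x * pderiv_dir b \<phi> x \<partial>lebesgue_on D) = (\<integral>x. v x * pderiv_dir b \<phi> x \<partial>lebesgue_on E)"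
      using assms test_functions_vanish[OF test_functions_pderiv_dir[OF \<phi> b]]
      by (intro integral_lebesgue_on_vanish) auto
    moreover have "(\<integral>x. (G x \<bullet> b) * \<phi> x \<partial>lebesgue_on D) = (\<integral>x. (G x \<bullet> b) * \<phi> x \<partial>lebesgue_on E)"
      using assms test_functions_vanish[OF \<phi>] by (intro integral_lebesgue_on_vanish) auto
    ultimately show "(\<integral>x. v x * pderiv_dir b \<phi> x \<partial>lebesgue_on E) = - (\<integral>x. (G x \<bullet> b) * \<phi> x \<partial>lebesgue_on E)"
      by simp
  qed
qed

section \<open>Classical gradients of smooth functions as weak gradients\<close>

definition grad :: "('a::euclidean_space \<Rightarrow> real) \<Rightarrow> 'a \<Rightarrow> 'a" where
  "grad f x = (\<Sum>b\<in>Basis. pderiv_dir b f x *\<^sub>R b)"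

lemma grad_inner_Basis: "b \<in> Basis \<Longrightarrow> grad f x \<bullet> b = pderiv_dir b f x"
  by (simp add: grad_def)

lemma grad_inner:
  assumes "f differentiable (at x)"
  shows "grad f x \<bullet> t = pderiv_dir t f x"
proof -
  have "linear (frechet_derivative f (at x))"
    using assms linear_frechet_derivative by blast
  then have "frechet_derivative f (at x) (\<Sum>b\<in>Basis. (t \<bullet> b) *\<^sub>R b) = (\<Sum>b\<in>Basis. (t \<bullet> b) *\<^sub>R frechet_derivative f (at x) b)"
    by (simp add: linear_sum linear_scale)
  then have "frechet_derivative f (at x) t = (\<Sum>b\<in>Basis. (t \<bullet> b) * frechet_derivative f (at x) b)"
    by (simp add: euclidean_representation)
  then show ?thesis
    by (simp add: pderiv_dir_def grad_def inner_sum_left inner_commute[of t] mult.commute)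
qed

text \<open>Outside \<open>D\<close> nothing is known about \<psi>, hence the extension by zero. It
  is smooth on \<open>D\<close> as a product and zero on the complement of the support of \<phi>;
  these two open sets cover the space.\<close>

lemma smooth_mult_test:
  assumes D: "open D" and \<psi>: "smooth_on D \<psi>" and \<phi>: "\<phi> \<in> test_functions D"
  defines "p \<equiv> \<lambda>x. if x \<in> D then \<psi> x * \<phi> x else 0"
  shows "p \<in> test_functions D"
    and "x \<in> D \<Longrightarrow> pderiv_dir b p x = \<psi> x * pderiv_dir b \<phi> x + pderiv_dir b \<psi> x * \<phi> x"
proof -
  define K where "K = closure {x. \<phi> x \<noteq> 0}"
  have K: "compact K" "K \<subseteq> D" using \<phi> by (auto simp: test_functions_def K_def)
  have pK: "p x = 0" if "x \<notin> K" for x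
    using that closure_subset[of "{x. \<phi> x \<noteq> 0}"] by (auto simp: p_def K_def)
  have "smooth_on UNIV p"
  proof (rule smooth_on_local)
    fix x
    have "smooth_on D (\<lambda>x. \<psi> x * \<phi> x)"
      using \<psi> \<phi> smooth_on_subset[of UNIV \<phi> D] by (intro smooth_on_mult[OF D]) (auto simp: test_functions_def)
    then have 1: "smooth_on D p" by (rule smooth_on_cong[OF D, rotated]) (simp add: p_def)
    have o: "open (- K)" using K(1) by (simp add: compact_imp_closed open_Compl)
    have 2: "smooth_on (- K) p"
      by (rule smooth_on_cong[OF o _ smooth_on_const[of _ 0]]) (use pK in auto)
    show "\<exists>T. open T \<and> x \<in> T \<and> smooth_on T p"
      using 1 2 o D K(2) by (cases "x \<in> D") blast+
  qed
  moreover have "closure {x. p x \<noteq> 0} \<subseteq> K"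
    using pK K(1) by (intro closure_minimal compact_imp_closed) auto
  ultimately show "p \<in> test_functions D"
    using K by (auto simp: test_functions_def compact_eq_bounded_closed intro: bounded_subset)
  show "pderiv_dir b p x = \<psi> x * pderiv_dir b \<phi> x + pderiv_dir b \<psi> x * \<phi> x" if "x \<in> D"
  proof -
    have "pderiv_dir b p x = pderiv_dir b (\<lambda>x. \<psi> x * \<phi> x) x"
      by (rule pderiv_dir_cong_open[OF D that]) (simp add: p_def)
    also have "\<dots> = \<psi> x * pderiv_dir b \<phi> x + pderiv_dir b \<psi> x * \<phi> x"
      using smooth_on_imp_differentiable[OF \<psi> that] test_functions_differentiable[OF \<phi>]
      by (rule pderiv_dir_mult)
    finally show ?thesis .
  qed
qed

lemma test_functions_Ck1: "\<phi> \<in> test_functions D \<Longrightarrow> Ck_on 1 UNIV \<phi>"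
  unfolding test_functions_def smooth_on_def by blast

lemma continuous_on_imp_locally_integrable:
  fixes f :: "'a::euclidean_space \<Rightarrow> real"
  assumes "continuous_on D f"
  shows "locally_integrable_on f D"
  unfolding locally_integrable_on_def
proof (intro allI impI)
  fix K assume K: "compact K \<and> K \<subseteq> D"
  then have "integrable lborel (\<lambda>x. indicator K x *\<^sub>R f x)"
    using assms continuous_on_subset by (intro borel_integrable_compact) auto
  then have "integrable lebesgue (\<lambda>x. indicator K x *\<^sub>R f x)"
    using integrable_completion borel_measurable_integrable by blast
  then show "integrable (lebesgue_on K) f"
    using borel_compact[of K] K by (subst integrable_restrict_space) auto
qed

text \<open>Integration by parts: the product of \<psi> with a test function, extended by zero, is
  again a test function, so its derivative has integral zero.\<close>

lemma smooth_has_weak_gradient: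
  assumes D: "open D" and \<psi>: "smooth_on D \<psi>"
  shows "has_weak_gradient D \<psi> (grad \<psi>)"
  unfolding has_weak_gradient_def
proof
  fix b :: 'a assume b: "b \<in> Basis"
  show "has_weak_pderiv D b \<psi> (\<lambda>x. grad \<psi> x \<bullet> b)"
    unfolding has_weak_pderiv_def grad_inner_Basis[OF b]
  proof (intro conjI ballI continuous_on_imp_locally_integrable smooth_on_imp_continuous_on \<psi> smooth_on_pderiv_dir b)
    fix \<phi> :: "'a \<Rightarrow> real" assume \<phi>: "\<phi> \<in> test_functions D"
    define p where "p x = (if x \<in> D then \<psi> x * \<phi> x else 0)" for x
    have p: "p \<in> test_functions D" "\<And>x. x \<in> D \<Longrightarrow> pderiv_dir b p x = \<psi> x * pderiv_dir b \<phi> x + pderiv_dir b \<psi> x * \<phi> x"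
      using smooth_mult_test[OF D \<psi> \<phi>] unfolding p_def by auto
    have "(\<integral>x. pderiv_dir b p x \<partial>lborel) = 0"
      using integral_pderiv_zero(2)[OF test_functions_Ck1[OF p(1)]] p(1) by (simp add: test_functions_def)
    moreover have "(\<integral>x. pderiv_dir b p x \<partial>lebesgue_on D) = (\<integral>x. pderiv_dir b p x \<partial>lborel)"
      using test_functions_pderiv_dir[OF p(1) b] D
      by (intro integral_lebesgue_on_borel) (auto intro: test_functions_measurable test_functions_vanish)
    moreover have "(\<integral>x. pderiv_dir b p x \<partial>lebesgue_on D) = (\<integral>x. \<psi> x * pderiv_dir b \<phi> x + pderiv_dir b \<psi> x * \<phi> x \<partial>lebesgue_on D)"
      using p(2) by (intro Bochner_Integration.integral_cong) auto
    moreover have "integrable (lebesgue_on D) (\<lambda>x. \<psi> x * pderiv_dir b \<phi> x)"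
      "integrable (lebesgue_on D) (\<lambda>x. pderiv_dir b \<psi> x * \<phi> x)"
      using \<psi> b \<phi> test_functions_pderiv_dir[OF \<phi> b]
      by (auto intro!: locally_integrable_mult_test[OF D] continuous_on_imp_locally_integrable
          smooth_on_imp_continuous_on smooth_on_pderiv_dir)
    ultimately show "(\<integral>x. \<psi> x * pderiv_dir b \<phi> x \<partial>lebesgue_on D) = - (\<integral>x. pderiv_dir b \<psi> x * \<phi> x \<partial>lebesgue_on D)"
      by simp
  qed
qed

lemma test_functions_L2:
  assumes "open D" "\<phi> \<in> test_functions E"
  shows "\<phi> \<in> L2 (lebesgue_on D)"
proof -
  obtain K M where "compact K" "K \<subseteq> E" "\<And>x. x \<notin> K \<Longrightarrow> \<phi> x = 0" "\<And>x. \<bar>\<phi> x\<bar> \<le> M"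
    using test_functions_support[OF assms(2)] by blast
  then show ?thesis
    using L2_bounded_compact_support[OF assms(1)] test_functions_measurable[OF assms(2)] by blast
qed

lemma grad_test_functions_L2:
  assumes "open D" "\<phi> \<in> test_functions E"
  shows "grad \<phi> \<in> L2 (lebesgue_on D)"
proof (rule L2_components)
  fix b :: 'a assume b: "b \<in> Basis"
  show "(\<lambda>x. grad \<phi> x \<bullet> b) \<in> L2 (lebesgue_on D)"
    unfolding grad_inner_Basis[OF b]
    using test_functions_L2[OF assms(1) test_functions_pderiv_dir[OF assms(2) b]] by simp
qed

lemma has_weak_gradient_zero:
  assumes "open D"
  shows "has_weak_gradient D (\<lambda>x. 0) (\<lambda>x. 0)"
  using assms by (auto simp: has_weak_gradient_def has_weak_pderiv_def locally_integrable_on_def)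

lemma H1_norm_bounds:
  "L2_norm (lebesgue_on D) v \<le> H1_norm D v"
  "L2_norm (lebesgue_on D) (weak_gradient D v) \<le> H1_norm D v"
  by (auto simp: H1_norm_def intro!: real_le_rsqrt)

text \<open>The constant sequence approximates \<phi>. That its error has norm zero rests on
  uniqueness: the chosen weak gradient of the zero function vanishes almost everywhere.\<close>

lemma test_functions_H10:
  assumes D: "open D" and \<phi>: "\<phi> \<in> test_functions D"
  shows "\<phi> \<in> H10 D"
proof -
  have sm: "smooth_on D \<phi>" using \<phi> smooth_on_subset by (auto simp: test_functions_def)
  have "\<phi> \<in> sobolev 1 D"
    using sobolev_1_iff test_functions_L2[OF D \<phi>] grad_test_functions_L2[OF D \<phi>] smooth_has_weak_gradient[OF D sm]
    by blast
  moreover have "H1_norm D (\<lambda>x. \<phi> x - \<phi> x) = 0"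
  proof -
    have wg: "has_weak_gradient D (\<lambda>x. 0) (weak_gradient D (\<lambda>x. 0))"
      using has_weak_gradient_weak_gradient has_weak_gradient_zero[OF D] by blast
    have "L2_norm (lebesgue_on D) (weak_gradient D (\<lambda>x. 0)) = L2_norm (lebesgue_on D) (\<lambda>x. 0 :: 'a)"
      by (rule L2_norm_cong_AE[OF has_weak_gradient_measurable[OF D wg] _ weak_gradient_AE_eq[OF D has_weak_gradient_zero[OF D]]]) simp
    then show ?thesis by (simp add: H1_norm_def L2_norm_def)
  qed
  ultimately show ?thesis using \<phi> by (auto simp: H10_def intro!: exI[of _ "\<lambda>k. \<phi>"])
qed

text \<open>\<open>H1_norm\<close> contains the chosen weak gradient of a difference. Almost
  everywhere this is the classical gradient of \<psi> minus the weak gradient of \<open>v\<close>,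
  so the convergence can be stated for classical gradients.\<close>

lemma H1_tendsto:
  assumes D: "open D" and v: "v \<in> sobolev 1 D" and \<psi>: "\<And>k. \<psi> k \<in> sobolev 1 D" "\<And>k. smooth_on D (\<psi> k)"
    and lim: "(\<lambda>k::nat. H1_norm D (\<lambda>x. \<psi> k x - v x)) \<longlonglongrightarrow> 0"
  shows "\<And>k. grad (\<psi> k) \<in> L2 (lebesgue_on D)"
    "(\<lambda>k. L2_norm (lebesgue_on D) (\<lambda>x. \<psi> k x - v x)) \<longlonglongrightarrow> 0"
    "(\<lambda>k. L2_norm (lebesgue_on D) (\<lambda>x. grad (\<psi> k) x - weak_gradient D v x)) \<longlonglongrightarrow> 0"
proof -
  note sv = sobolev_1_weak_gradient[OF D v]
  have sg: "has_weak_gradient D (\<psi> k) (grad (\<psi> k))" for k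
    by (rule smooth_has_weak_gradient[OF D \<psi>(2)])
  show g: "grad (\<psi> k) \<in> L2 (lebesgue_on D)" for k
    by (rule L2_cong_AE[OF sobolev_1_weak_gradient(3)[OF D \<psi>(1)] has_weak_gradient_measurable[OF D sg] weak_gradient_AE_eq[OF D sg]])
  show "(\<lambda>k. L2_norm (lebesgue_on D) (\<lambda>x. \<psi> k x - v x)) \<longlonglongrightarrow> 0"
    by (rule tendsto_sandwich[OF _ _ tendsto_const lim]) (auto simp: L2_norm_nonneg H1_norm_bounds)
  have d: "has_weak_gradient D (\<lambda>x. \<psi> k x - v x) (\<lambda>x. grad (\<psi> k) x - weak_gradient D v x)" for k
    by (rule has_weak_gradient_diff[OF D sg sv(2)])
  have eq: "L2_norm (lebesgue_on D) (weak_gradient D (\<lambda>x. \<psi> k x - v x)) =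
      L2_norm (lebesgue_on D) (\<lambda>x. grad (\<psi> k) x - weak_gradient D v x)" for k
    by (rule L2_norm_cong_AE[OF has_weak_gradient_measurable[OF D has_weak_gradient_weak_gradient[OF d]]
          has_weak_gradient_measurable[OF D d] weak_gradient_AE_eq[OF D d]])
  have "L2_norm (lebesgue_on D) (\<lambda>x. grad (\<psi> k) x - weak_gradient D v x) \<le> H1_norm D (\<lambda>x. \<psi> k x - v x)" for k
    using H1_norm_bounds(2)[of D "\<lambda>x. \<psi> k x - v x"] eq by simp
  then show "(\<lambda>k. L2_norm (lebesgue_on D) (\<lambda>x. grad (\<psi> k) x - weak_gradient D v x)) \<longlonglongrightarrow> 0"
    by (intro tendsto_sandwich[OF _ _ tendsto_const lim]) (auto simp: L2_norm_nonneg)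
qed

section \<open>The surface measure of a face and segments\<close>

text \<open>The definition picks some point of \<open>F\<close> as origin of the height. Any point
  \<open>p0\<close> of the plane gives the same height, since it differs from the chosen one by a
  vector orthogonal to \<open>n\<close>.\<close>

lemma face_measure_eq:
  fixes n p0 :: "'a::euclidean_space"
  assumes "F \<noteq> {}" "\<And>x. x \<in> F \<Longrightarrow> (x - p0) \<bullet> n = 0"
  shows "face_measure n F = restrict_space
    (distr (lebesgue_on {x. (x - p0) \<bullet> n \<in> {0..1}}) borel (\<lambda>x. x - ((x - p0) \<bullet> n) *\<^sub>R n)) F"
proof -
  define p where "p = (SOME p. p \<in> F)"
  have "p \<in> F" unfolding p_def using assms(1) some_in_eq by blast
  then have "(x - p) \<bullet> n = (x - p0) \<bullet> n" for x
    using assms(2) by (simp add: inner_diff_left)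
  then show ?thesis by (simp add: face_measure_def Let_def p_def[symmetric])
qed

context
  fixes n p0 :: "'a::euclidean_space" and F :: "'a set"
  assumes F: "F \<in> sets borel" "F \<noteq> {}" "\<And>x. x \<in> F \<Longrightarrow> (x - p0) \<bullet> n = 0"
begin

lemma face_measure_unfold:
  "face_measure n F = restrict_space
    (distr (lebesgue_on {x. (x - p0) \<bullet> n \<in> {0..1}}) borel (\<lambda>x. x - ((x - p0) \<bullet> n) *\<^sub>R n)) F"
  by (rule face_measure_eq) (use F in auto)

lemma slab_projection_measurable:
  "{x. (x - p0) \<bullet> n \<in> {0..1}} \<in> sets lebesgue"
  "(\<lambda>x. x - ((x - p0) \<bullet> n) *\<^sub>R n) \<in> borel_measurable (lebesgue_on S)"
  "(\<lambda>x. x - ((x - p0) \<bullet> n) *\<^sub>R n) \<in> borel_measurable borel"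
proof -
  have "closed ((\<lambda>x. (x - p0) \<bullet> n) -` {0..1})"
    by (intro closed_vimage continuous_intros)
  then show "{x. (x - p0) \<bullet> n \<in> {0..1}} \<in> sets lebesgue"
    using borel_closed by (auto simp: vimage_def)
  show "(\<lambda>x. x - ((x - p0) \<bullet> n) *\<^sub>R n) \<in> borel_measurable borel"
    by (intro borel_measurable_continuous_onI continuous_intros)
  then show "(\<lambda>x. x - ((x - p0) \<bullet> n) *\<^sub>R n) \<in> borel_measurable (lebesgue_on S)"
    by (rule borel_measurable_lebesgue_on)
qed

lemma face_measure_measurable:
  "g \<in> borel_measurable borel \<Longrightarrow> g \<in> borel_measurable (face_measure n F)"
  unfolding face_measure_unfold by (intro measurable_restrict_space1) simp

lemma face_measure_nn_integral:
  fixes g :: "'a \<Rightarrow> ennreal"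
  assumes g: "g \<in> borel_measurable borel"
  shows "(\<integral>\<^sup>+x. g x \<partial>face_measure n F) = (\<integral>\<^sup>+x. indicator {0..1} ((x - p0) \<bullet> n) *
    (indicator F (x - ((x - p0) \<bullet> n) *\<^sub>R n) * g (x - ((x - p0) \<bullet> n) *\<^sub>R n)) \<partial>lborel)"
proof -
  note m = slab_projection_measurable
  have gF: "(\<lambda>x. g x * indicator F x) \<in> borel_measurable borel"
    using g F(1) by measurable
  have [measurable]: "(\<lambda>x. g (x - ((x - p0) \<bullet> n) *\<^sub>R n) * indicator F (x - ((x - p0) \<bullet> n) *\<^sub>R n)) \<in> borel_measurable borel"
    using measurable_compose[OF m(3) gF] .
  show ?thesis
    unfolding face_measure_unfold
    using F(1) m gF
    by (simp add: nn_integral_restrict_space nn_integral_distr)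
      (subst nn_integral_completion, measurable, auto intro!: nn_integral_cong simp: indicator_def)
qed

lemma face_measure_integral:
  fixes g :: "'a \<Rightarrow> real"
  assumes g: "g \<in> borel_measurable borel"
  shows "(\<integral>x. g x \<partial>face_measure n F) = (\<integral>x. indicator {0..1} ((x - p0) \<bullet> n) *
    (indicator F (x - ((x - p0) \<bullet> n) *\<^sub>R n) * g (x - ((x - p0) \<bullet> n) *\<^sub>R n)) \<partial>lborel)"
proof -
  note m = slab_projection_measurable
  have gF: "(\<lambda>x. indicator F x * g x) \<in> borel_measurable borel"
    using g F(1) by (intro borel_measurable_times borel_measurable_indicator)
  have [measurable]: "(\<lambda>x. indicator F (x - ((x - p0) \<bullet> n) *\<^sub>R n) * g (x - ((x - p0) \<bullet> n) *\<^sub>R n)) \<in> borel_measurable borel"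
    using measurable_compose[OF m(3) gF] .
  show ?thesis
    unfolding face_measure_unfold
    using F(1) m gF
    by (simp add: integral_restrict_space integral_distr)
      (subst integral_completion, measurable, auto intro!: Bochner_Integration.integral_cong simp: indicator_def)
qed

end

section \<open>Estimates along a single segment\<close>

lemma power2_integral_le:
  fixes f :: "real \<Rightarrow> real"
  assumes L: "L > 0" and f: "continuous_on {0..L} f"
  shows "(integral {0..L} f)\<^sup>2 \<le> L * integral {0..L} (\<lambda>t. (f t)\<^sup>2)"
proof -
  \<comment> \<open>The mean value of \<open>f\<close>; the claim is the nonnegativity of the
    integral of the square of \<open>f - c\<close>.\<close>
  define c where "c = integral {0..L} f / L"
  have i: "f integrable_on {0..L}" "(\<lambda>t. (f t)\<^sup>2) integrable_on {0..L}"
    using f by (auto intro!: integrable_continuous_real continuous_intros)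
  have hi: "((\<lambda>t. (f t)\<^sup>2 - (2 * c) * f t + c\<^sup>2) has_integral
      (integral {0..L} (\<lambda>t. (f t)\<^sup>2) - (2 * c) * integral {0..L} f + measure lborel {0..L} *\<^sub>R c\<^sup>2)) {0..L}"
    using i by (intro has_integral_add has_integral_diff has_integral_mult_right has_integral_const_real integrable_integral)
  have "0 \<le> integral {0..L} (\<lambda>t. (f t)\<^sup>2) - (2 * c) * integral {0..L} f + measure lborel {0..L} *\<^sub>R c\<^sup>2"
  proof (rule has_integral_nonneg[OF hi])
    fix t
    have "(f t)\<^sup>2 - (2 * c) * f t + c\<^sup>2 = (f t - c)\<^sup>2" by (simp add: power2_diff)
    then show "0 \<le> (f t)\<^sup>2 - (2 * c) * f t + c\<^sup>2" by (simp only: zero_le_power2)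
  qed
  moreover have "measure lborel {0..L} = L" using L by simp
  ultimately have ge: "0 \<le> integral {0..L} (\<lambda>t. (f t)\<^sup>2) - 2 * c * integral {0..L} f + L * c\<^sup>2"
    by (simp only: real_scaleR_def)
  have "2 * c * integral {0..L} f - L * c\<^sup>2 = (integral {0..L} f)\<^sup>2 / L"
    using L by (simp add: c_def power2_eq_square)
  with ge have "(integral {0..L} f)\<^sup>2 / L \<le> integral {0..L} (\<lambda>t. (f t)\<^sup>2)" by linarith
  then show ?thesis using L by (simp add: divide_le_eq mult.commute)
qed

text \<open>As \<phi> vanishes at the far end, its value at \<open>y\<close> is minus the integral
  of its derivative along the segment, and the Cauchy-Schwarz inequality applies. The indicator of
  \<open>O'\<close> records that the open segment stays in \<open>O'\<close>, so that a later
  integration over all \<open>y\<close> sees only that set.\<close>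

lemma segment_poincare:
  fixes \<phi> :: "'a::euclidean_space \<Rightarrow> real"
  assumes \<phi>: "Ck_on 1 UNIV \<phi>" and L: "L > 0" and zero: "\<phi> (y + L *\<^sub>R v) = 0"
    and seg: "\<And>t. 0 < t \<Longrightarrow> t < L \<Longrightarrow> y + t *\<^sub>R v \<in> O'"
    and cont: "continuous_on UNIV (pderiv_dir v \<phi>)"
  shows "ennreal ((\<phi> y)\<^sup>2) \<le> ennreal L * (\<integral>\<^sup>+t. indicator {0<..<L} t * (indicator O' (y + t *\<^sub>R v) * ennreal ((pderiv_dir v \<phi> (y + t *\<^sub>R v))\<^sup>2)) \<partial>lborel)"
proof -
  define f where "f t = pderiv_dir v \<phi> (y + t *\<^sub>R v)" for t
  have f: "continuous_on S f" for S
    unfolding f_def by (rule continuous_on_compose2[OF cont]) (auto intro!: continuous_intros)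
  have der: "((\<lambda>t. \<phi> (y + t *\<^sub>R v)) has_vector_derivative f t) (at t)" for t
  proof -
    have d: "(\<phi> has_derivative frechet_derivative \<phi> (at z)) (at z)" for z
      using \<phi> by (simp add: frechet_derivative_works[symmetric])
    have "((\<lambda>s. y + s *\<^sub>R v) has_derivative (\<lambda>h. h *\<^sub>R v)) (at t)"
      by (auto intro!: derivative_eq_intros)
    from has_derivative_compose[OF this d]
    show ?thesis using d[THEN has_derivative_linear]
      by (simp add: has_vector_derivative_def linear_scale f_def pderiv_dir_def)
  qed
  have "(f has_integral (\<phi> (y + L *\<^sub>R v) - \<phi> (y + 0 *\<^sub>R v))) {0..L}"
    using L der by (intro fundamental_theorem_of_calculus) (auto intro: has_vector_derivative_at_within)
  then have "integral {0..L} f = - \<phi> y" using zero by (simp add: integral_unique)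
  then have sq: "(\<phi> y)\<^sup>2 \<le> L * integral {0..L} (\<lambda>t. (f t)\<^sup>2)"
    using power2_integral_le[OF L f] by simp
  have "((\<lambda>t. (f t)\<^sup>2) has_integral (integral {0..L} (\<lambda>t. (f t)\<^sup>2))) {0..L}"
    using f by (intro integrable_integral integrable_continuous_real continuous_intros)
  \<comment> \<open>The endpoints are dropped since only the interior of the segment is known to lie
    in \<open>O'\<close>.\<close>
  then have hi: "((\<lambda>t. (f t)\<^sup>2) has_integral (integral {0..L} (\<lambda>t. (f t)\<^sup>2))) {0<..<L}"
    by (simp add: has_integral_Icc_iff_Ioo)
  have "(\<integral>\<^sup>+t. indicator {0<..<L} t * ennreal ((f t)\<^sup>2) \<partial>lborel) = ennreal (integral {0..L} (\<lambda>t. (f t)\<^sup>2))"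
  proof -
    have "(\<integral>\<^sup>+t. ennreal (indicator {0<..<L} t * (f t)\<^sup>2) \<partial>lborel) = ennreal (integral {0..L} (\<lambda>t. (f t)\<^sup>2))"
      by (rule nn_integral_has_integral_lebesgue[OF _ hi]) simp
    then show ?thesis by (simp add: ennreal_mult ennreal_indicator)
  qed
  moreover have "(\<integral>\<^sup>+t. indicator {0<..<L} t * (indicator O' (y + t *\<^sub>R v) * ennreal ((pderiv_dir v \<phi> (y + t *\<^sub>R v))\<^sup>2)) \<partial>lborel)
      = (\<integral>\<^sup>+t. indicator {0<..<L} t * ennreal ((f t)\<^sup>2) \<partial>lborel)"
    using seg by (intro nn_integral_cong) (auto simp: f_def indicator_def)
  moreover have "integral {0..L} (\<lambda>t. (f t)\<^sup>2) \<ge> 0"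
    using f by (intro integral_nonneg integrable_continuous_real continuous_intros) auto
  ultimately show ?thesis using sq L by (simp add: ennreal_mult[symmetric])
qed

text \<open>The exit time \<open>s\<close> is the infimum of the closed set \<open>S\<close> of
  nonnegative times at which the ray is outside \<open>O'\<close>; this set is nonempty because
  \<open>O'\<close> is bounded.\<close>

lemma ray_exit:
  fixes v :: "'a::euclidean_space"
  assumes "open O'" "bounded O'" "y \<in> O'" "v \<noteq> 0"
  obtains s where "s > 0" "y + s *\<^sub>R v \<in> frontier O'" "\<And>t. 0 \<le> t \<Longrightarrow> t < s \<Longrightarrow> y + t *\<^sub>R v \<in> O'"
proof -
  define S where "S = {t. 0 \<le> t \<and> y + t *\<^sub>R v \<notin> O'}"
  obtain B where B: "\<And>x. x \<in> O' \<Longrightarrow> norm x \<le> B" using assms(2) bounded_iff by blast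
  have B0: "B \<ge> 0" using B[OF assms(3)] norm_ge_zero order_trans by blast
  define T where "T = (B + norm y + 1) / norm v"
  have "norm (y + T *\<^sub>R v) > B"
  proof -
    have "norm (T *\<^sub>R v) = B + norm y + 1"
      using assms(4) B0 by (simp add: T_def)
    then show ?thesis using norm_triangle_ineq2[of "T *\<^sub>R v" "- y"] by (simp add: add.commute)
  qed
  then have "T \<in> S" using B[of "y + T *\<^sub>R v"] B0 by (auto simp: S_def T_def)
  then have ne: "S \<noteq> {}" by auto
  have bb: "bdd_below S" by (auto simp: S_def bdd_below_def)
  have "closed S"
  proof -
    have "S = {0..} \<inter> (\<lambda>t. y + t *\<^sub>R v) -` (- O')" by (auto simp: S_def)
    moreover have "closed ((\<lambda>t. y + t *\<^sub>R v) -` (- O'))"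
      using assms(1) by (intro closed_vimage continuous_intros) auto
    ultimately show ?thesis by auto
  qed
  define s where "s = Inf S"
  have sS: "s \<in> S" unfolding s_def by (rule closed_contains_Inf[OF ne bb \<open>closed S\<close>])
  have s0: "s > 0" using sS assms(3) by (cases "s = 0") (auto simp: S_def)
  have before: "y + t *\<^sub>R v \<in> O'" if "0 \<le> t" "t < s" for t
    using that cInf_lower[OF _ bb, of t] by (force simp: S_def s_def)
  have "y + s *\<^sub>R v \<in> closure O'"
  proof (rule ccontr)
    assume "y + s *\<^sub>R v \<notin> closure O'"
    then have "s \<in> (\<lambda>t. y + t *\<^sub>R v) -` (- closure O')" by simp
    moreover have "open ((\<lambda>t. y + t *\<^sub>R v) -` (- closure O'))"
      by (intro open_vimage continuous_intros) auto
    ultimately obtain e where e: "e > 0" "\<And>t. \<bar>t - s\<bar> < e \<Longrightarrow> y + t *\<^sub>R v \<notin> closure O'"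
      unfolding open_dist by (auto simp: dist_real_def)
    define t where "t = max 0 (s - e / 2)"
    have "\<bar>t - s\<bar> < e" "0 \<le> t" "t < s" using e s0 by (auto simp: t_def)
    then show False using e(2)[of t] before[of t] closure_subset by blast
  qed
  then have "y + s *\<^sub>R v \<in> frontier O'" using sS assms(1) by (auto simp: frontier_def interior_open S_def)
  then show ?thesis using that s0 before by blast
qed

section \<open>Poincare inequalities on the overlap\<close>

text \<open>Here \<open>A\<close> and \<open>W\<close> are the patches $\Omega_1^*$ and $\Omega_2^*$.\<close>

locale thin_overlap =
  fixes A W F :: "'a::euclidean_space set" and n p0 :: 'a and \<zeta> :: "'a \<Rightarrow> real"
  assumes open_A: "open A" and open_W: "open W" and bounded_A: "bounded A"
    and F_eq: "frontier A \<inter> W = F" and F_ne: "F \<noteq> {}"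
    and norm_n: "norm n = 1" and plane: "\<And>x. x \<in> F \<Longrightarrow> (x - p0) \<bullet> n = 0"
    and ext: "exterior_normal A F n"
    and cont_\<zeta>: "continuous_on UNIV \<zeta>"
    and graph: "frontier W \<inter> A = face_map \<zeta> n ` F"
    and frontier_overlap: "frontier (A \<inter> W) = closure F \<union> closure (frontier W \<inter> A)"
begin

definition "width = overlap_width F \<zeta> n"

lemma n_n: "n \<bullet> n = 1" and n_ne: "n \<noteq> 0"
  using norm_n by (auto simp: norm_eq_1)

lemma F_borel: "F \<in> sets borel"
  using F_eq open_W borel_closed[OF frontier_closed[of A]] by (metis borel_open sets.Int)

lemma compact_closure_F: "compact (closure F)"
proof -
  have "bounded F" 
    using F_eq bounded_closure[OF bounded_A] by (auto simp: frontier_def intro: bounded_subset)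
  then show ?thesis by simp
qed

lemma closure_plane:
  assumes "x \<in> closure F"
  shows "(x - p0) \<bullet> n = 0"
proof -
  have "closed ((\<lambda>x. (x - p0) \<bullet> n) -` {0})" by (intro closed_vimage continuous_intros)
  moreover have "F \<subseteq> (\<lambda>x. (x - p0) \<bullet> n) -` {0}" using plane by auto
  ultimately show ?thesis using assms closure_minimal by blast
qed

text \<open>The width is a supremum over \<open>F\<close>, but exit points of segments are only
  known to lie over its closure. Continuity of \<zeta> extends the bound, and compactness of the
  closure makes the supremum finite.\<close>

lemma abs_\<zeta>_le: assumes "x \<in> closure F" shows "\<bar>\<zeta> x\<bar> \<le> width"
proof -
  have w: "width = (SUP x\<in>F. \<bar>\<zeta> x\<bar>)"
    unfolding width_def overlap_width_def face_map_def using norm_n by simp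
  have "compact ((\<lambda>x. \<bar>\<zeta> x\<bar>) ` closure F)"
    by (intro compact_continuous_image compact_closure_F continuous_intros continuous_on_subset[OF cont_\<zeta>]) auto
  then have "bdd_above ((\<lambda>x. \<bar>\<zeta> x\<bar>) ` closure F)"
    by (intro bounded_imp_bdd_above compact_imp_bounded)
  then have "bdd_above ((\<lambda>x. \<bar>\<zeta> x\<bar>) ` F)"
    by (rule bdd_above_mono) (use closure_subset in blast)
  then have "\<bar>\<zeta> x\<bar> \<le> width" if "x \<in> F" for x
    unfolding w using that by (rule cSUP_upper[rotated])
  then have "F \<subseteq> (\<lambda>x. \<bar>\<zeta> x\<bar>) -` {..width}" by auto
  moreover have "closed ((\<lambda>x. \<bar>\<zeta> x\<bar>) -` {..width})"
    by (intro closed_vimage continuous_intros cont_\<zeta>)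
  ultimately show ?thesis using assms closure_minimal by blast
qed

lemma width_nonneg: "width \<ge> 0"
  using abs_\<zeta>_le F_ne closure_subset by (metis abs_ge_zero all_not_in_conv order_trans subsetD)

text \<open>Limit points of the upper face remain in the closed frontier of \<open>W\<close>, hence
  outside \<open>W\<close>, and on the graph, because the image of the compact closure of
  \<open>F\<close> is closed.\<close>

lemma closure_graph:
  assumes "y \<in> closure (frontier W \<inter> A)"
  shows "y \<notin> W" "\<exists>x\<in>closure F. y = x + \<zeta> x *\<^sub>R n"
proof -
  have "closure (frontier W \<inter> A) \<subseteq> frontier W" by (intro closure_minimal) auto
  then show "y \<notin> W" using assms open_W by (auto simp: frontier_def interior_open)
  have "compact (face_map \<zeta> n ` closure F)"
    unfolding face_map_def
    by (intro compact_continuous_image compact_closure_F continuous_intros continuous_on_subset[OF cont_\<zeta>]) auto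
  then have "closure (frontier W \<inter> A) \<subseteq> face_map \<zeta> n ` closure F"
    unfolding graph by (intro closure_minimal image_mono closure_subset compact_imp_closed)
  then show "\<exists>x\<in>closure F. y = x + \<zeta> x *\<^sub>R n" using assms by (auto simp: face_map_def)
qed

lemma plane_inj:
  assumes "x \<in> closure F" "x' \<in> closure F" "x + s *\<^sub>R n = x' + s' *\<^sub>R n"
  shows "x = x'" "s = s'"
proof -
  have "(x + s *\<^sub>R n - p0) \<bullet> n = (x' + s' *\<^sub>R n - p0) \<bullet> n" using assms(3) by simp
  then show "s = s'" using closure_plane[OF assms(1)] closure_plane[OF assms(2)]
    by (simp add: inner_diff_left inner_add_left n_n)
  then show "x = x'" using assms(3) by simp
qed

lemma open_overlap: "open (A \<inter> W)" and bounded_overlap: "bounded (A \<inter> W)"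
  using open_A open_W bounded_A by (auto intro: bounded_subset)

text \<open>Starting slightly behind the face, the ray in direction \<open>- n\<close> must leave
  the overlap. It cannot leave through the closure of \<open>F\<close>, which lies at a different
  height, so it leaves through the closure of the graph; the depth reached is then a value of
  \<bar>\<zeta>\<bar>.\<close>

lemma face_segment:
  assumes x: "x \<in> F"
  obtains L where "0 < L" "L \<le> width" "x - L *\<^sub>R n \<notin> W" "\<And>t. 0 < t \<Longrightarrow> t < L \<Longrightarrow> x - t *\<^sub>R n \<in> A \<inter> W"
proof -
  have cx: "x \<in> closure F" using x closure_subset by blast
  obtain \<epsilon> where \<epsilon>: "\<epsilon> > 0" "\<And>t. 0 < t \<Longrightarrow> t < \<epsilon> \<Longrightarrow> x - t *\<^sub>R n \<in> A"
    using ext x unfolding exterior_normal_def by blast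
  have "x \<in> W" using x F_eq by blast
  then obtain r where r: "r > 0" "\<And>y. dist y x < r \<Longrightarrow> y \<in> W"
    using open_W unfolding open_dist by blast
  \<comment> \<open>Small enough for both patches: \<epsilon> keeps the point in \<open>A\<close> by
    the exterior normal, and \<open>r\<close> keeps it in \<open>W\<close> by openness.\<close>
  define t0 where "t0 = min \<epsilon> r / 2"
  have t0: "t0 > 0" "t0 < \<epsilon>" "t0 < r" using \<epsilon>(1) r(1) by (auto simp: t0_def)
  have near: "x - t *\<^sub>R n \<in> A \<inter> W" if "0 < t" "t \<le> t0" for t
  proof
    show "x - t *\<^sub>R n \<in> A" using \<epsilon>(2) that t0 by simp
    show "x - t *\<^sub>R n \<in> W" using r(2)[of "x - t *\<^sub>R n"] that t0 norm_n by (simp add: dist_norm)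
  qed
  define y where "y = x - t0 *\<^sub>R n"
  have "y \<in> A \<inter> W" using near t0 by (simp add: y_def)
  then obtain s where s: "s > 0" "y + s *\<^sub>R (- n) \<in> frontier (A \<inter> W)"
    "\<And>t. 0 \<le> t \<Longrightarrow> t < s \<Longrightarrow> y + t *\<^sub>R (- n) \<in> A \<inter> W"
    using ray_exit[OF open_overlap bounded_overlap, of y "- n"] n_ne by auto
  have ys: "y + t *\<^sub>R (- n) = x - (t0 + t) *\<^sub>R n" for t by (simp add: y_def algebra_simps)
  have "y + s *\<^sub>R (- n) \<notin> closure F"
  proof
    assume "y + s *\<^sub>R (- n) \<in> closure F"
    from plane_inj(2)[OF this cx, of "t0 + s" 0] show False
      using t0 s(1) unfolding ys by simp
  qed
  then have cg: "y + s *\<^sub>R (- n) \<in> closure (frontier W \<inter> A)" using s(2) frontier_overlap by blast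
  then obtain x' where x': "x' \<in> closure F" "y + s *\<^sub>R (- n) = x' + \<zeta> x' *\<^sub>R n"
    using closure_graph(2) by blast
  have eq: "x + (- (t0 + s)) *\<^sub>R n = x' + \<zeta> x' *\<^sub>R n" using x'(2) unfolding ys
    by (simp only: scaleR_minus_left add_uminus_conv_diff)
  then have "- (t0 + s) = \<zeta> x'" using plane_inj(2)[OF cx x'(1)] by blast
  then have "t0 + s \<le> width" using abs_\<zeta>_le[OF x'(1)] t0 s(1) by linarith
  moreover have "x - (t0 + s) *\<^sub>R n \<notin> W" using closure_graph(1)[OF cg] unfolding ys .
  moreover have "x - t *\<^sub>R n \<in> A \<inter> W" if "0 < t" "t < t0 + s" for t
  proof (cases "t \<le> t0")
    case True
    then show ?thesis using near that by blast
  next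
    case False
    then show ?thesis using s(3)[of "t - t0"] that unfolding ys by simp
  qed
  moreover have "0 < t0 + s" using t0 s(1) by simp
  ultimately show ?thesis using that by blast
qed

text \<open>The line through \<open>y\<close> in direction \<open>n\<close> leaves the overlap at a
  point on either side. Both cannot lie on the plane, which the line meets once, nor both on the
  graph of the single-valued \<zeta>. Hence one lies on each; the sign \<sigma> points to the one on
  the graph, which is outside \<open>W\<close>, and the whole chord has length at most
  \<open>width\<close>.\<close>

lemma overlap_segment:
  assumes y: "y \<in> A \<inter> W"
  obtains L \<sigma> where "\<sigma> = 1 \<or> \<sigma> = -1" "0 < L" "L \<le> width" "y + L *\<^sub>R (\<sigma> *\<^sub>R n) \<notin> W"
    "\<And>t. 0 < t \<Longrightarrow> t < L \<Longrightarrow> y + t *\<^sub>R (\<sigma> *\<^sub>R n) \<in> A \<inter> W"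
proof -
  have ex: "\<exists>s>0. y + s *\<^sub>R (\<sigma> *\<^sub>R n) \<in> frontier (A \<inter> W) \<and> (\<forall>t. 0 \<le> t \<and> t < s \<longrightarrow> y + t *\<^sub>R (\<sigma> *\<^sub>R n) \<in> A \<inter> W)"
    if "\<sigma> \<noteq> 0" for \<sigma>
  proof -
    have "\<sigma> *\<^sub>R n \<noteq> 0" using n_ne that by simp
    from ray_exit[OF open_overlap bounded_overlap y this] obtain s where
      "s > 0" "y + s *\<^sub>R (\<sigma> *\<^sub>R n) \<in> frontier (A \<inter> W)"
      "\<And>t. 0 \<le> t \<Longrightarrow> t < s \<Longrightarrow> y + t *\<^sub>R (\<sigma> *\<^sub>R n) \<in> A \<inter> W" by metis
    then show ?thesis by (intro exI[of _ s] conjI allI impI) auto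
  qed
  obtain s1 where s1: "s1 > 0" "y + s1 *\<^sub>R (1 *\<^sub>R n) \<in> frontier (A \<inter> W)"
    "\<And>t. 0 \<le> t \<Longrightarrow> t < s1 \<Longrightarrow> y + t *\<^sub>R (1 *\<^sub>R n) \<in> A \<inter> W" using ex[of 1] by auto
  obtain s2 where s2: "s2 > 0" "y + s2 *\<^sub>R ((-1) *\<^sub>R n) \<in> frontier (A \<inter> W)"
    "\<And>t. 0 \<le> t \<Longrightarrow> t < s2 \<Longrightarrow> y + t *\<^sub>R ((-1) *\<^sub>R n) \<in> A \<inter> W" using ex[of "-1"] by auto
  define P1 where "P1 = y + s1 *\<^sub>R (1 *\<^sub>R n)"
  define P2 where "P2 = y + s2 *\<^sub>R ((-1) *\<^sub>R n)"
  have P: "P1 = P2 + (s1 + s2) *\<^sub>R n" "P2 = P1 + (- (s1 + s2)) *\<^sub>R n" by (simp_all add: P1_def P2_def algebra_simps)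
  have "P1 \<in> closure F \<union> closure (frontier W \<inter> A)" "P2 \<in> closure F \<union> closure (frontier W \<inter> A)"
    using s1(2) s2(2) frontier_overlap by (auto simp: P1_def P2_def)
  then consider "P1 \<in> closure F" "P2 \<in> closure F" | "P1 \<in> closure F" "P2 \<in> closure (frontier W \<inter> A)"
    | "P1 \<in> closure (frontier W \<inter> A)" "P2 \<in> closure F"
    | "P1 \<in> closure (frontier W \<inter> A)" "P2 \<in> closure (frontier W \<inter> A)" by blast
  then show ?thesis
  proof cases
    case 1
    have "0 = s1 + s2" by (rule plane_inj(2)[OF 1]) (use P(1) in simp)
    then show ?thesis using s1(1) s2(1) by simp
  next
    case 2
    obtain x where x: "x \<in> closure F" "P2 = x + \<zeta> x *\<^sub>R n" using closure_graph(2)[OF 2(2)] by blast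
    have "- (s1 + s2) = \<zeta> x" by (rule plane_inj(2)[OF 2(1) x(1)]) (use P(2) x(2) in argo)
    then have "s2 \<le> width" using abs_\<zeta>_le[OF x(1)] s1(1) by linarith
    then show ?thesis using that[of "-1" s2] s2 closure_graph(1)[OF 2(2)] by (auto simp: P2_def)
  next
    case 3
    obtain x where x: "x \<in> closure F" "P1 = x + \<zeta> x *\<^sub>R n" using closure_graph(2)[OF 3(1)] by blast
    have "s1 + s2 = \<zeta> x" by (rule plane_inj(2)[OF 3(2) x(1)]) (use P(1) x(2) in argo)
    then have "s1 \<le> width" using abs_\<zeta>_le[OF x(1)] s2(1) by linarith
    then show ?thesis using that[of 1 s1] s1 closure_graph(1)[OF 3(1)] by (auto simp: P1_def)
  next
    case 4
    obtain x where x: "x \<in> closure F" "P1 = x + \<zeta> x *\<^sub>R n" using closure_graph(2)[OF 4(1)] by blast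
    obtain x' where x': "x' \<in> closure F" "P2 = x' + \<zeta> x' *\<^sub>R n" using closure_graph(2)[OF 4(2)] by blast
    have "x + \<zeta> x *\<^sub>R n = x' + (\<zeta> x' + (s1 + s2)) *\<^sub>R n"
      using x(2) x'(2) P(1) by (simp add: algebra_simps)
    then have "x = x'" "\<zeta> x = \<zeta> x' + (s1 + s2)" using plane_inj[OF x(1) x'(1)] by blast+
    then show ?thesis using s1(1) s2(1) by simp
  qed
qed

section \<open>From segment estimates to integral estimates for a test function\<close>

context
  fixes \<phi> :: "'a \<Rightarrow> real"
  assumes \<phi>: "\<phi> \<in> test_functions W"
begin

private definition "\<kappa> z = indicator (A \<inter> W) z * ennreal ((pderiv_dir n \<phi> z)\<^sup>2)"

private lemma pderiv_dir_scale: "pderiv_dir (\<sigma> *\<^sub>R n) \<phi> z = \<sigma> * pderiv_dir n \<phi> z"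
  by (simp add: grad_inner[OF test_functions_differentiable[OF \<phi>], symmetric])

private lemma cont_pderiv: "continuous_on UNIV (pderiv_dir t \<phi>)"
proof -
  have "pderiv_dir t \<phi> = (\<lambda>x. \<Sum>b\<in>Basis. pderiv_dir b \<phi> x * (b \<bullet> t))"
  proof
    fix x
    show "pderiv_dir t \<phi> x = (\<Sum>b\<in>Basis. pderiv_dir b \<phi> x * (b \<bullet> t))"
      using grad_inner[OF test_functions_differentiable[OF \<phi>], of x t] by (simp add: grad_def inner_sum_left)
  qed
  then show ?thesis
    using test_functions_continuous[OF test_functions_pderiv_dir[OF \<phi>]] by (auto intro!: continuous_intros)
qed

private lemma \<kappa>_meas[measurable]: "\<kappa> \<in> borel_measurable borel"
proof -
  have [measurable]: "pderiv_dir n \<phi> \<in> borel_measurable borel" "A \<inter> W \<in> sets borel"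
    using cont_pderiv open_overlap by (auto intro: borel_measurable_continuous_onI)
  show ?thesis unfolding \<kappa>_def[abs_def] by measurable
qed

text \<open>The segment depends on \<open>y\<close> in an uncontrolled way. Enlarging it to the
  symmetric interval of half-length \<open>width\<close> removes \<sigma> and \<open>L\<close> from
  the bound and prepares an application of Fubini.\<close>

private lemma segment_estimate:
  assumes "\<sigma> = 1 \<or> \<sigma> = -1" "0 < L" "L \<le> width" "y + L *\<^sub>R (\<sigma> *\<^sub>R n) \<notin> W"
    "\<And>t. 0 < t \<Longrightarrow> t < L \<Longrightarrow> y + t *\<^sub>R (\<sigma> *\<^sub>R n) \<in> A \<inter> W"
  shows "ennreal ((\<phi> y)\<^sup>2) \<le> ennreal width * (\<integral>\<^sup>+t. indicator {-width..width} t * \<kappa> (y + t *\<^sub>R n) \<partial>lborel)"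
proof -
  have "ennreal ((\<phi> y)\<^sup>2) \<le> ennreal L * (\<integral>\<^sup>+t. indicator {0<..<L} t *
      (indicator (A \<inter> W) (y + t *\<^sub>R (\<sigma> *\<^sub>R n)) * ennreal ((pderiv_dir (\<sigma> *\<^sub>R n) \<phi> (y + t *\<^sub>R (\<sigma> *\<^sub>R n)))\<^sup>2)) \<partial>lborel)"
    by (rule segment_poincare[OF test_functions_Ck1[OF \<phi>] assms(2) test_functions_vanish[OF \<phi> assms(4)] assms(5) cont_pderiv])
  also have "\<dots> \<le> ennreal width * (\<integral>\<^sup>+t. indicator {-width..width} (\<sigma> * t) * \<kappa> (y + (\<sigma> * t) *\<^sub>R n) \<partial>lborel)"
    using assms(1-3) by (intro mult_mono nn_integral_mono ennreal_leI)
      (auto simp: pderiv_dir_scale \<kappa>_def indicator_def mult.commute)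
  \<comment> \<open>The substitution multiplies \<open>t\<close> by a sign and preserves Lebesgue
    measure.\<close>
  also have "(\<integral>\<^sup>+t. indicator {-width..width} (\<sigma> * t) * \<kappa> (y + (\<sigma> * t) *\<^sub>R n) \<partial>lborel) =
      (\<integral>\<^sup>+t. indicator {-width..width} t * \<kappa> (y + t *\<^sub>R n) \<partial>lborel)"
    using assms(1) by (subst (2) nn_integral_real_affine[where c = \<sigma> and t = 0]) auto
  finally show ?thesis .
qed

private lemma nn_integral_\<kappa>: "(\<integral>\<^sup>+x. \<kappa> x \<partial>lborel) \<le> ennreal ((L2_norm (lebesgue_on (A \<inter> W)) (grad \<phi>))\<^sup>2)"
proof -
  have gL: "grad \<phi> \<in> L2 (lebesgue_on (A \<inter> W))" by (rule grad_test_functions_L2[OF open_overlap \<phi>])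
  have "(\<integral>\<^sup>+x. \<kappa> x \<partial>lborel) = (\<integral>\<^sup>+x. \<kappa> x \<partial>lebesgue)"
    by (subst nn_integral_completion) auto
  also have "\<dots> = (\<integral>\<^sup>+x. ennreal ((pderiv_dir n \<phi> x)\<^sup>2) \<partial>lebesgue_on (A \<inter> W))"
    using open_overlap by (subst nn_integral_restrict_space) (auto simp: \<kappa>_def[abs_def] mult.commute)
  also have "\<dots> \<le> (\<integral>\<^sup>+x. ennreal ((norm (grad \<phi> x))\<^sup>2) \<partial>lebesgue_on (A \<inter> W))"
  proof (intro nn_integral_mono ennreal_leI)
    fix x
    have "\<bar>pderiv_dir n \<phi> x\<bar> \<le> norm (grad \<phi> x)"
      using Cauchy_Schwarz_ineq2[of "grad \<phi> x" n] norm_n grad_inner[OF test_functions_differentiable[OF \<phi>], of x n] by simp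
    then have "\<bar>pderiv_dir n \<phi> x\<bar>\<^sup>2 \<le> (norm (grad \<phi> x))\<^sup>2" by (intro power_mono) auto
    then show "(pderiv_dir n \<phi> x)\<^sup>2 \<le> (norm (grad \<phi> x))\<^sup>2" by simp
  qed
  also have "\<dots> = ennreal ((L2_norm (lebesgue_on (A \<inter> W)) (grad \<phi>))\<^sup>2)"
    unfolding L2_norm_power2 using L2_integrable[OF gL] by (intro nn_integral_eq_integral) auto
  finally show ?thesis .
qed

text \<open>Integrate the segment estimate over \<open>y\<close> and interchange the integrals. By
  translation invariance the inner integral no longer depends on \<open>t\<close>, so the interval
  contributes its length \<open>2 * width\<close>; the factor \<open>width\<close> from
  Cauchy-Schwarz completes the square of \<open>sqrt 2 * width\<close>.\<close>

lemma overlap_poincare: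
  "L2_norm (lebesgue_on (A \<inter> W)) \<phi> \<le> sqrt 2 * width * L2_norm (lebesgue_on (A \<inter> W)) (grad \<phi>)"
proof -
  let ?N = "L2_norm (lebesgue_on (A \<inter> W)) (grad \<phi>)"
  have \<phi>L: "\<phi> \<in> L2 (lebesgue_on (A \<inter> W))" by (rule test_functions_L2[OF open_overlap \<phi>])
  have "ennreal ((L2_norm (lebesgue_on (A \<inter> W)) \<phi>)\<^sup>2) = (\<integral>\<^sup>+x. ennreal ((\<phi> x)\<^sup>2) \<partial>lebesgue_on (A \<inter> W))"
    unfolding L2_norm_power2 using L2_integrable[OF \<phi>L] by (subst nn_integral_eq_integral) auto
  also have "\<dots> \<le> (\<integral>\<^sup>+y. ennreal width * (\<integral>\<^sup>+t. indicator {-width..width} t * \<kappa> (y + t *\<^sub>R n) \<partial>lborel) \<partial>lebesgue_on (A \<inter> W))"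
  proof (intro nn_integral_mono)
    fix y assume "y \<in> space (lebesgue_on (A \<inter> W))"
    then have "y \<in> A \<inter> W" by simp
    then show "ennreal ((\<phi> y)\<^sup>2) \<le> ennreal width * (\<integral>\<^sup>+t. indicator {-width..width} t * \<kappa> (y + t *\<^sub>R n) \<partial>lborel)"
      by (rule overlap_segment) (rule segment_estimate)
  qed
  also have "\<dots> \<le> (\<integral>\<^sup>+y. ennreal width * (\<integral>\<^sup>+t. indicator {-width..width} t * \<kappa> (y + t *\<^sub>R n) \<partial>lborel) \<partial>lborel)"
  proof -
    define R where "R y = ennreal width * (\<integral>\<^sup>+t. indicator {-width..width} t * \<kappa> (y + t *\<^sub>R n) \<partial>lborel)" for y
    have [measurable]: "R \<in> borel_measurable borel" unfolding R_def by measurable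
    have "(\<integral>\<^sup>+y. R y \<partial>lebesgue_on (A \<inter> W)) = (\<integral>\<^sup>+y. R y * indicator (A \<inter> W) y \<partial>lebesgue)"
      using open_overlap by (intro nn_integral_restrict_space) auto
    also have "\<dots> \<le> (\<integral>\<^sup>+y. R y \<partial>lebesgue)"
      by (intro nn_integral_mono) (auto simp: indicator_def)
    also have "\<dots> = (\<integral>\<^sup>+y. R y \<partial>lborel)"
      by (rule nn_integral_completion)
    finally show ?thesis unfolding R_def .
  qed
  also have "\<dots> = ennreal width * (\<integral>\<^sup>+y. (\<integral>\<^sup>+t. indicator {-width..width} t * \<kappa> (y + t *\<^sub>R n) \<partial>lborel) \<partial>lborel)"
    by (rule nn_integral_cmult) measurable
  also have "(\<integral>\<^sup>+y. (\<integral>\<^sup>+t. indicator {-width..width} t * \<kappa> (y + t *\<^sub>R n) \<partial>lborel) \<partial>lborel) =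
      (\<integral>\<^sup>+t. (\<integral>\<^sup>+y. indicator {-width..width} t * \<kappa> (y + t *\<^sub>R n) \<partial>lborel) \<partial>lborel)"
    by (rule lborel_pair.Fubini'[symmetric]) measurable
  also have "\<dots> = (\<integral>\<^sup>+t. indicator {-width..width} t * (\<integral>\<^sup>+y. \<kappa> y \<partial>lborel) \<partial>lborel)"
    by (intro nn_integral_cong, subst nn_integral_cmult) (auto simp: nn_integral_translate)
  also have "\<dots> = ennreal (2 * width) * (\<integral>\<^sup>+y. \<kappa> y \<partial>lborel)"
    using width_nonneg by (subst nn_integral_multc) auto
  also have "ennreal width * (ennreal (2 * width) * (\<integral>\<^sup>+y. \<kappa> y \<partial>lborel)) \<le> ennreal width * (ennreal (2 * width) * ennreal (?N\<^sup>2))"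
    by (intro mult_left_mono nn_integral_\<kappa>) auto
  also have "\<dots> = ennreal ((sqrt 2 * width * ?N)\<^sup>2)"
    using width_nonneg by (simp add: ennreal_mult[symmetric] power_mult_distrib) (simp add: power2_eq_square mult_ac)
  finally have "(L2_norm (lebesgue_on (A \<inter> W)) \<phi>)\<^sup>2 \<le> (sqrt 2 * width * ?N)\<^sup>2"
    by (subst (asm) ennreal_le_iff) auto
  then show ?thesis
    by (rule power2_le_imp_le) (simp add: L2_norm_nonneg width_nonneg)
qed

text \<open>A point of the slab and its foot point on the face share a normal line, over which the
  squared derivative is integrated. After interchanging the integrals every point is counted with
  the height of the slab, which is 1, so only the factor \<open>width\<close> from Cauchy-Schwarz
  remains. Finiteness of this bound also yields membership in the square-integrable functions on the
  face.\<close>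

lemma face_poincare:
  "\<phi> \<in> L2 (face_measure n F)"
  "L2_norm (face_measure n F) \<phi> \<le> sqrt width * L2_norm (lebesgue_on (A \<inter> W)) (grad \<phi>)"
proof -
  let ?N = "L2_norm (lebesgue_on (A \<inter> W)) (grad \<phi>)"
  let ?\<tau> = "\<lambda>x. (x - p0) \<bullet> n"
  have [measurable]: "\<phi> \<in> borel_measurable borel" by (rule test_functions_measurable[OF \<phi>])
  have \<phi>m: "\<phi> \<in> borel_measurable (face_measure n F)"
    by (rule face_measure_measurable[OF F_borel F_ne plane]) auto
  have "(\<integral>\<^sup>+x. ennreal ((\<phi> x)\<^sup>2) \<partial>face_measure n F) = (\<integral>\<^sup>+x. indicator {0..1} (?\<tau> x) *
    (indicator F (x - ?\<tau> x *\<^sub>R n) * ennreal ((\<phi> (x - ?\<tau> x *\<^sub>R n))\<^sup>2)) \<partial>lborel)"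
    by (rule face_measure_nn_integral[OF F_borel F_ne plane]) auto
  also have "\<dots> \<le> (\<integral>\<^sup>+x. ennreal width * (\<integral>\<^sup>+t. indicator {0..1} (?\<tau> x) * \<kappa> (x + t *\<^sub>R n) \<partial>lborel) \<partial>lborel)"
  proof (rule nn_integral_mono)
    fix x
    let ?y = "x - ?\<tau> x *\<^sub>R n"
    show "indicator {0..1} (?\<tau> x) * (indicator F ?y * ennreal ((\<phi> ?y)\<^sup>2))
      \<le> ennreal width * (\<integral>\<^sup>+t. indicator {0..1} (?\<tau> x) * \<kappa> (x + t *\<^sub>R n) \<partial>lborel)"
    proof (cases "?\<tau> x \<in> {0..1} \<and> ?y \<in> F")
      case True
      obtain L where L: "0 < L" "L \<le> width" "?y - L *\<^sub>R n \<notin> W" "\<And>t. 0 < t \<Longrightarrow> t < L \<Longrightarrow> ?y - t *\<^sub>R n \<in> A \<inter> W"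
        using face_segment[of ?y] True by blast
      have "ennreal ((\<phi> ?y)\<^sup>2) \<le> ennreal width * (\<integral>\<^sup>+t. indicator {-width..width} t * \<kappa> (?y + t *\<^sub>R n) \<partial>lborel)"
        by (rule segment_estimate[of "-1" L]) (use L in auto)
      also have "\<dots> \<le> ennreal width * (\<integral>\<^sup>+t. \<kappa> (?y + t *\<^sub>R n) \<partial>lborel)"
        by (intro mult_left_mono nn_integral_mono) (auto simp: indicator_def)
      \<comment> \<open>The line is reparametrized from its foot point to \<open>x\<close>, after
        which the bound no longer mentions the projection.\<close>
      also have "(\<integral>\<^sup>+t. \<kappa> (?y + t *\<^sub>R n) \<partial>lborel) = (\<integral>\<^sup>+t. \<kappa> (x + (t + (- ?\<tau> x)) *\<^sub>R n) \<partial>lborel)"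
        by (simp add: algebra_simps)
      also have "\<dots> = (\<integral>\<^sup>+t. \<kappa> (x + t *\<^sub>R n) \<partial>lborel)"
        by (rule nn_integral_translate) measurable
      finally show ?thesis using True by simp
    qed (auto simp: indicator_def)
  qed
  also have "\<dots> = ennreal width * (\<integral>\<^sup>+x. (\<integral>\<^sup>+t. indicator {0..1} (?\<tau> x) * \<kappa> (x + t *\<^sub>R n) \<partial>lborel) \<partial>lborel)"
    by (rule nn_integral_cmult) measurable
  also have "(\<integral>\<^sup>+x. (\<integral>\<^sup>+t. indicator {0..1} (?\<tau> x) * \<kappa> (x + t *\<^sub>R n) \<partial>lborel) \<partial>lborel) =
      (\<integral>\<^sup>+t. (\<integral>\<^sup>+x. indicator {0..1} (?\<tau> x) * \<kappa> (x + t *\<^sub>R n) \<partial>lborel) \<partial>lborel)"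
    by (rule lborel_pair.Fubini'[symmetric]) measurable
  \<comment> \<open>Translation by \<open>t n\<close> removes \<open>t\<close> from the argument of
    \<kappa> and puts it into the slab condition, which for fixed \<open>x\<close> is then a
    condition on \<open>t\<close> of length 1.\<close>
  also have "\<dots> = (\<integral>\<^sup>+t. (\<integral>\<^sup>+x. indicator {0..1} (?\<tau> x - t) * \<kappa> x \<partial>lborel) \<partial>lborel)"
  proof (rule nn_integral_cong)
    fix t :: real
    have "(\<integral>\<^sup>+x. indicator {0..1} (?\<tau> x - t) * \<kappa> x \<partial>lborel) = (\<integral>\<^sup>+x. indicator {0..1} (?\<tau> (x + t *\<^sub>R n) - t) * \<kappa> (x + t *\<^sub>R n) \<partial>lborel)"
      by (rule nn_integral_translate[symmetric]) measurable
    then show "(\<integral>\<^sup>+x. indicator {0..1} (?\<tau> x) * \<kappa> (x + t *\<^sub>R n) \<partial>lborel) = (\<integral>\<^sup>+x. indicator {0..1} (?\<tau> x - t) * \<kappa> x \<partial>lborel)"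
      by (simp add: inner_diff_left inner_add_left n_n)
  qed
  also have "\<dots> = (\<integral>\<^sup>+x. (\<integral>\<^sup>+t. indicator {0..1} (?\<tau> x - t) * \<kappa> x \<partial>lborel) \<partial>lborel)"
    by (rule lborel_pair.Fubini') measurable
  also have "\<dots> = (\<integral>\<^sup>+x. \<kappa> x \<partial>lborel)"
  proof (rule nn_integral_cong)
    fix x
    have "(\<integral>\<^sup>+t. indicator {0..1} (?\<tau> x - t) * \<kappa> x \<partial>lborel) = (\<integral>\<^sup>+t. indicator {?\<tau> x - 1..?\<tau> x} t * \<kappa> x \<partial>lborel)"
      by (intro nn_integral_cong) (auto simp: indicator_def)
    also have "\<dots> = \<kappa> x" by (subst nn_integral_multc) auto
    finally show "(\<integral>\<^sup>+t. indicator {0..1} (?\<tau> x - t) * \<kappa> x \<partial>lborel) = \<kappa> x" .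
  qed
  also have "ennreal width * (\<integral>\<^sup>+x. \<kappa> x \<partial>lborel) \<le> ennreal width * ennreal (?N\<^sup>2)"
    by (intro mult_left_mono nn_integral_\<kappa>) auto
  also have "\<dots> = ennreal ((sqrt width * ?N)\<^sup>2)"
    using width_nonneg by (simp add: ennreal_mult[symmetric] power_mult_distrib)
  finally have le: "(\<integral>\<^sup>+x. ennreal ((\<phi> x)\<^sup>2) \<partial>face_measure n F) \<le> ennreal ((sqrt width * ?N)\<^sup>2)" .
  have "integrable (face_measure n F) (\<lambda>x. (norm (\<phi> x))\<^sup>2)"
  proof (rule integrableI_bounded)
    show "(\<lambda>x. (norm (\<phi> x))\<^sup>2) \<in> borel_measurable (face_measure n F)" using \<phi>m by measurable
    show "(\<integral>\<^sup>+x. ennreal (norm ((norm (\<phi> x))\<^sup>2)) \<partial>face_measure n F) < \<infinity>"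
      using le by (simp add: le_less_trans ennreal_less_top)
  qed
  then show \<phi>L: "\<phi> \<in> L2 (face_measure n F)" using \<phi>m by (rule L2_I[rotated])
  have "ennreal ((L2_norm (face_measure n F) \<phi>)\<^sup>2) = (\<integral>\<^sup>+x. ennreal ((\<phi> x)\<^sup>2) \<partial>face_measure n F)"
    unfolding L2_norm_power2 using L2_integrable[OF \<phi>L] by (subst nn_integral_eq_integral) auto
  with le have "ennreal ((L2_norm (face_measure n F) \<phi>)\<^sup>2) \<le> ennreal ((sqrt width * ?N)\<^sup>2)" by simp
  then have "(L2_norm (face_measure n F) \<phi>)\<^sup>2 \<le> (sqrt width * ?N)\<^sup>2"
    by (subst (asm) ennreal_le_iff) auto
  then show "L2_norm (face_measure n F) \<phi> \<le> sqrt width * ?N"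
    by (rule power2_le_imp_le) (simp add: L2_norm_nonneg width_nonneg)
qed

end

end

section \<open>Approximation by test functions\<close>

text \<open>A smooth substitute for the smaller (in absolute value) of two numbers: it vanishes when one
  of them does, and is close to both when they are close to each other.\<close>

definition smooth_min :: "real \<Rightarrow> real \<Rightarrow> real \<Rightarrow> real" where
  "smooth_min \<epsilon> a b = a * b * (a + b) / (a\<^sup>2 + b\<^sup>2 + \<epsilon>\<^sup>2)"

lemma smooth_min_zero: "smooth_min \<epsilon> 0 b = 0" "smooth_min \<epsilon> a 0 = 0"
  by (simp_all add: smooth_min_def)

text \<open>Over the common denominator \<open>S\<close> the difference has numerator
  a\<twosuperior>(b - a) - a\<epsilon>\<twosuperior>. Here a\<twosuperior> is at most
  \<open>S\<close>, and so is \<bar>a\<bar>\<epsilon> by the inequality between arithmetic and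
  geometric mean.\<close>

lemma smooth_min_approx:
  assumes "\<epsilon> > 0"
  shows "\<bar>smooth_min \<epsilon> a b - a\<bar> \<le> \<bar>b - a\<bar> + \<epsilon>"
proof -
  define S where "S = a\<^sup>2 + b\<^sup>2 + \<epsilon>\<^sup>2"
  have S: "S > 0" using assms by (auto simp: S_def intro: add_nonneg_pos)
  have "smooth_min \<epsilon> a b - a = (a\<^sup>2 * (b - a) - a * \<epsilon>\<^sup>2) / S"
  proof -
    have "a = a * S / S" using S by simp
    then have "smooth_min \<epsilon> a b - a = (a * b * (a + b) - a * S) / S"
      unfolding smooth_min_def S_def[symmetric] by (metis diff_divide_distrib)
    also have "a * b * (a + b) - a * S = a\<^sup>2 * (b - a) - a * \<epsilon>\<^sup>2"
      by (simp add: S_def power2_eq_square algebra_simps)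
    finally show ?thesis .
  qed
  moreover have "\<bar>a\<^sup>2 * (b - a) - a * \<epsilon>\<^sup>2\<bar> \<le> (\<bar>b - a\<bar> + \<epsilon>) * S"
  proof -
    have "\<bar>a\<^sup>2 * (b - a) - a * \<epsilon>\<^sup>2\<bar> \<le> a\<^sup>2 * \<bar>b - a\<bar> + (\<bar>a\<bar> * \<epsilon>) * \<epsilon>"
      using abs_triangle_ineq4[of "a\<^sup>2 * (b - a)" "a * \<epsilon>\<^sup>2"] assms by (simp add: abs_mult power2_eq_square mult_ac)
    moreover have "a\<^sup>2 * \<bar>b - a\<bar> \<le> S * \<bar>b - a\<bar>" by (intro mult_right_mono) (auto simp: S_def)
    moreover have "(\<bar>a\<bar> * \<epsilon>) * \<epsilon> \<le> S * \<epsilon>"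
    proof (intro mult_right_mono)
      have "2 * (\<bar>a\<bar> * \<epsilon>) \<le> a\<^sup>2 + \<epsilon>\<^sup>2" using sum_squares_bound[of "\<bar>a\<bar>" \<epsilon>] by simp
      moreover have "\<bar>a\<bar> * \<epsilon> \<ge> 0" using assms by simp
      ultimately show "\<bar>a\<bar> * \<epsilon> \<le> S" unfolding S_def by (smt (verit) zero_le_power2)
    qed (use assms in auto)
    ultimately show ?thesis by (simp add: algebra_simps)
  qed
  ultimately show ?thesis using S by (simp add: abs_divide pos_divide_le_eq)
qed

text \<open>The fraction is the partial derivative of \<open>smooth_min\<close> with respect to
  \<open>a\<close>. It is homogeneous of degree zero in \<open>a\<close>, \<open>b\<close>,
  \<epsilon>, so a bound free of \<epsilon> can be expected; since \<bar>ab\<bar> is at most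
  \<open>S / 2\<close>, the two terms contribute at most 2 and 3/2.\<close>

lemma smooth_min_deriv_bound:
  fixes a b \<epsilon> :: real
  assumes "\<epsilon> > 0"
  defines "S \<equiv> a\<^sup>2 + b\<^sup>2 + \<epsilon>\<^sup>2"
  shows "\<bar>((2 * a * b + b\<^sup>2) * S - a * b * (a + b) * (2 * a)) / S\<^sup>2\<bar> \<le> 4"
proof -
  have S: "S > 0" using assms by (auto intro: add_nonneg_pos)
  have "2 * (\<bar>a\<bar> * \<bar>b\<bar>) \<le> a\<^sup>2 + b\<^sup>2" using sum_squares_bound[of "\<bar>a\<bar>" "\<bar>b\<bar>"] by simp
  then have "2 * (\<bar>a\<bar> * \<bar>b\<bar>) \<le> S" by (rule order_trans) (simp add: S_def)
  then have ab: "\<bar>a * b\<bar> \<le> S / 2" by (simp add: abs_mult)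
  have sq: "a\<^sup>2 \<le> S" "b\<^sup>2 \<le> S" by (auto simp: S_def)
  have "\<bar>2 * a * b + b\<^sup>2\<bar> \<le> 2 * S"
    using ab sq abs_triangle_ineq[of "2 * a * b" "b\<^sup>2"] by (simp add: abs_mult)
  then have 1: "\<bar>(2 * a * b + b\<^sup>2) * S\<bar> \<le> 2 * S * S"
    using S by (simp add: abs_mult)
  have "\<bar>a * b * (a + b) * (2 * a)\<bar> = \<bar>a * b\<bar> * \<bar>2 * a\<^sup>2 + 2 * (a * b)\<bar>"
    by (simp add: abs_mult[symmetric] power2_eq_square algebra_simps)
  also have "\<dots> \<le> (S / 2) * (3 * S)"
  proof (intro mult_mono ab)
    show "\<bar>2 * a\<^sup>2 + 2 * (a * b)\<bar> \<le> 3 * S"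
      using ab sq abs_triangle_ineq[of "2 * a\<^sup>2" "2 * (a * b)"] by (simp add: abs_mult)
  qed (use S in auto)
  finally have 2: "\<bar>a * b * (a + b) * (2 * a)\<bar> \<le> 3 / 2 * (S * S)" by simp
  have "\<bar>(2 * a * b + b\<^sup>2) * S - a * b * (a + b) * (2 * a)\<bar> \<le> 4 * (S * S)"
    using 1 2 S mult_pos_pos[OF S S] abs_triangle_ineq4[of "(2 * a * b + b\<^sup>2) * S" "a * b * (a + b) * (2 * a)"]
    by linarith
  then show ?thesis using S by (simp add: abs_divide pos_divide_le_eq power2_eq_square)
qed

lemma grad_smooth_min_bound:
  assumes \<epsilon>: "\<epsilon> > 0" and "\<psi> differentiable (at x)" "\<eta> differentiable (at x)"
  shows "norm (grad (\<lambda>x. smooth_min \<epsilon> (\<psi> x) (\<eta> x)) x) \<le> 4 * norm (grad \<psi> x) + 4 * norm (grad \<eta> x)"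
proof -
  define a b where "a = \<psi> x" and "b = \<eta> x"
  define S where "S = a\<^sup>2 + b\<^sup>2 + \<epsilon>\<^sup>2"
  have S: "S > 0" using \<epsilon> by (auto simp: S_def intro: add_nonneg_pos)
  \<comment> \<open>The coefficients \<open>c\<close> and \<open>d\<close> are the two partial
    derivatives of \<open>smooth_min\<close>, exchanged by the symmetry in \<open>a\<close> and
    \<open>b\<close>.\<close>
  define c where "c = ((2 * a * b + b\<^sup>2) * S - a * b * (a + b) * (2 * a)) / S\<^sup>2"
  define d where "d = ((2 * b * a + a\<^sup>2) * S - b * a * (b + a) * (2 * b)) / S\<^sup>2"
  have c: "\<bar>c\<bar> \<le> 4" unfolding c_def S_def by (rule smooth_min_deriv_bound[OF \<epsilon>])
  have d: "\<bar>d\<bar> \<le> 4" using smooth_min_deriv_bound[OF \<epsilon>, of b a] by (simp add: d_def S_def add.commute)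
  have D\<psi>: "(\<psi> has_derivative frechet_derivative \<psi> (at x)) (at x)" and D\<eta>: "(\<eta> has_derivative frechet_derivative \<eta> (at x)) (at x)"
    using assms by (auto simp: frechet_derivative_works)
  note num = has_derivative_mult[OF has_derivative_mult[OF D\<psi> D\<eta>] has_derivative_add[OF D\<psi> D\<eta>]]
  note den = has_derivative_add[OF has_derivative_add[OF has_derivative_mult[OF D\<psi> D\<psi>] has_derivative_mult[OF D\<eta> D\<eta>]]
      has_derivative_const[of "\<epsilon> * \<epsilon>"]]
  have "\<psi> x * \<psi> x + \<eta> x * \<eta> x + \<epsilon> * \<epsilon> \<noteq> 0"
    using S by (simp add: S_def a_def b_def power2_eq_square)
  note quot = has_derivative_divide'[OF num den this]
  have D: "((\<lambda>x. smooth_min \<epsilon> (\<psi> x) (\<eta> x)) has_derivative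
      (\<lambda>h. c * frechet_derivative \<psi> (at x) h + d * frechet_derivative \<eta> (at x) h)) (at x)"
    unfolding smooth_min_def power2_eq_square
  proof (rule has_derivative_eq_rhs[OF quot], rule ext)
    fix h
    have S': "a * a + b * b + \<epsilon> * \<epsilon> = S" by (simp add: S_def power2_eq_square)
    show "(((\<psi> x * \<eta> x) * (frechet_derivative \<psi> (at x) h + frechet_derivative \<eta> (at x) h) +
          (\<psi> x * frechet_derivative \<eta> (at x) h + frechet_derivative \<psi> (at x) h * \<eta> x) * (\<psi> x + \<eta> x)) *
         (\<psi> x * \<psi> x + \<eta> x * \<eta> x + \<epsilon> * \<epsilon>) -
         \<psi> x * \<eta> x * (\<psi> x + \<eta> x) *
         (\<psi> x * frechet_derivative \<psi> (at x) h + frechet_derivative \<psi> (at x) h * \<psi> x +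
          (\<eta> x * frechet_derivative \<eta> (at x) h + frechet_derivative \<eta> (at x) h * \<eta> x) + 0)) /
        ((\<psi> x * \<psi> x + \<eta> x * \<eta> x + \<epsilon> * \<epsilon>) * (\<psi> x * \<psi> x + \<eta> x * \<eta> x + \<epsilon> * \<epsilon>)) =
        c * frechet_derivative \<psi> (at x) h + d * frechet_derivative \<eta> (at x) h"
      unfolding a_def[symmetric] b_def[symmetric]
      unfolding S' c_def d_def times_divide_eq_left add_divide_distrib[symmetric] power2_eq_square[of S]
      by (rule arg_cong2[where f = "(/)"]) (simp_all add: power2_eq_square algebra_simps)
  qed
  have "grad (\<lambda>x. smooth_min \<epsilon> (\<psi> x) (\<eta> x)) x = c *\<^sub>R grad \<psi> x + d *\<^sub>R grad \<eta> x"
    unfolding grad_def pderiv_dir_eq[OF D]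
    by (simp add: pderiv_dir_def scaleR_left_distrib sum.distrib scaleR_sum_right)
  then have "norm (grad (\<lambda>x. smooth_min \<epsilon> (\<psi> x) (\<eta> x)) x) \<le> \<bar>c\<bar> * norm (grad \<psi> x) + \<bar>d\<bar> * norm (grad \<eta> x)"
    using norm_triangle_ineq[of "c *\<^sub>R grad \<psi> x" "d *\<^sub>R grad \<eta> x"] by simp
  also have "\<dots> \<le> 4 * norm (grad \<psi> x) + 4 * norm (grad \<eta> x)"
    using c d by (intro add_mono mult_right_mono) auto
  finally show ?thesis .
qed

text \<open>The limit gradient \<open>G\<close> is a parameter instead of
  \<open>weak_gradient D v\<close>, so that gradients chosen on different domains can be subtracted
  without changing representatives.\<close>

definition vanishing_limit ::
  "'a::euclidean_space set \<Rightarrow> 'a set \<Rightarrow> ('a \<Rightarrow> real) \<Rightarrow> ('a \<Rightarrow> 'a) \<Rightarrow> bool" where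
  "vanishing_limit D \<Gamma> v G \<longleftrightarrow> (\<exists>\<eta>. (\<forall>k::nat. smooth_on UNIV (\<eta> k) \<and> \<eta> k \<in> L2 (lebesgue_on D) \<and>
      grad (\<eta> k) \<in> L2 (lebesgue_on D) \<and> (\<exists>U. open U \<and> \<Gamma> \<subseteq> U \<and> (\<forall>x\<in>U. \<eta> k x = 0))) \<and>
    (\<lambda>k. L2_norm (lebesgue_on D) (\<lambda>x. \<eta> k x - v x)) \<longlonglongrightarrow> 0 \<and>
    (\<lambda>k. L2_norm (lebesgue_on D) (\<lambda>x. grad (\<eta> k) x - G x)) \<longlonglongrightarrow> 0)"

lemma zero_on_boundary_part_vanishing_limit:
  assumes D: "open D" and z: "zero_on_boundary_part D \<Gamma> v"
  shows "vanishing_limit D \<Gamma> v (weak_gradient D v)"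
proof -
  obtain \<eta> where v: "v \<in> sobolev 1 D" and \<eta>: "\<And>k. smooth_on UNIV (\<eta> k) \<and> \<eta> k \<in> sobolev 1 D \<and>
      (\<exists>U. open U \<and> \<Gamma> \<subseteq> U \<and> (\<forall>x\<in>U. \<eta> k x = 0))"
    and lim: "(\<lambda>k::nat. H1_norm D (\<lambda>x. \<eta> k x - v x)) \<longlonglongrightarrow> 0"
    using z unfolding zero_on_boundary_part_def by blast
  have sm: "smooth_on D (\<eta> k)" for k using \<eta> smooth_on_subset by blast
  have "\<eta> k \<in> sobolev 1 D" for k using \<eta> by blast
  note H = H1_tendsto[OF D v this sm lim]
  show ?thesis unfolding vanishing_limit_def
    using \<eta> H sobolev_1_weak_gradient(1)[OF D] by (intro exI[of _ \<eta>]) blast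
qed

text \<open>The complement of the compact support of a test function of \<Omega> is an open
  neighbourhood of the frontier of \<Omega>, and restricting to \<open>D\<close> does not increase
  norms.\<close>

lemma H10_vanishing_limit:
  assumes \<Omega>: "open \<Omega>" and D: "open D" "D \<subseteq> \<Omega>" and u: "u \<in> H10 \<Omega>" and \<Gamma>: "\<Gamma> \<subseteq> frontier \<Omega>"
  shows "vanishing_limit D \<Gamma> u (weak_gradient \<Omega> u)"
proof -
  obtain \<theta> where us: "u \<in> sobolev 1 \<Omega>" and \<theta>: "\<And>k. \<theta> k \<in> test_functions \<Omega>"
    and lim: "(\<lambda>k::nat. H1_norm \<Omega> (\<lambda>x. \<theta> k x - u x)) \<longlonglongrightarrow> 0"
    using u unfolding H10_def by blast
  have sm: "smooth_on UNIV (\<theta> k)" for k using \<theta> by (auto simp: test_functions_def)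
  have \<theta>1: "\<theta> k \<in> sobolev 1 \<Omega>" for k using test_functions_H10[OF \<Omega> \<theta>] by (simp add: H10_def)
  note H = H1_tendsto[OF \<Omega> us \<theta>1 smooth_on_subset[OF sm subset_UNIV] lim]
  note sv = sobolev_1_weak_gradient[OF \<Omega> us]
  have sets: "D \<in> sets lebesgue" "\<Omega> \<in> sets lebesgue" using \<Omega> D by auto
  have vanish: "\<exists>U. open U \<and> \<Gamma> \<subseteq> U \<and> (\<forall>x\<in>U. \<theta> k x = 0)" for k
  proof (intro exI[of _ "- closure {x. \<theta> k x \<noteq> 0}"] conjI ballI)
    have "closure {x. \<theta> k x \<noteq> 0} \<subseteq> \<Omega>" using \<theta>[of k] by (simp add: test_functions_def)
    then show "\<Gamma> \<subseteq> - closure {x. \<theta> k x \<noteq> 0}" using \<Gamma> \<Omega> by (auto simp: frontier_def interior_open)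
    fix x assume "x \<in> - closure {x. \<theta> k x \<noteq> 0}"
    then show "\<theta> k x = 0" using closure_subset[of "{x. \<theta> k x \<noteq> 0}"] by auto
  qed auto
  have "(\<lambda>k. L2_norm (lebesgue_on D) (\<lambda>x. \<theta> k x - u x)) \<longlonglongrightarrow> 0"
    by (rule tendsto_sandwich[OF _ _ tendsto_const H(2)])
      (auto simp: L2_norm_nonneg intro!: always_eventually L2_norm_restrict_le[OF _ D(2) sets] L2_diff sv test_functions_L2[OF \<Omega> \<theta>])
  moreover have "(\<lambda>k. L2_norm (lebesgue_on D) (\<lambda>x. grad (\<theta> k) x - weak_gradient \<Omega> u x)) \<longlonglongrightarrow> 0"
    by (rule tendsto_sandwich[OF _ _ tendsto_const H(3)])
      (auto simp: L2_norm_nonneg intro!: always_eventually L2_norm_restrict_le[OF _ D(2) sets] L2_diff sv H(1))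
  ultimately show ?thesis unfolding vanishing_limit_def
    using sm vanish test_functions_L2[OF D(1) \<theta>] grad_test_functions_L2[OF D(1) \<theta>]
    by (intro exI[of _ \<theta>]) blast
qed

lemma grad_diff:
  assumes "f differentiable (at x)" "g differentiable (at x)"
  shows "grad (\<lambda>x. f x - g x) x = grad f x - grad g x"
proof -
  have "((\<lambda>x. f x - g x) has_derivative (\<lambda>h. frechet_derivative f (at x) h - frechet_derivative g (at x) h)) (at x)"
    using assms by (intro has_derivative_diff) (auto simp: frechet_derivative_works)
  from pderiv_dir_eq[OF this] have "pderiv_dir b (\<lambda>x. f x - g x) x = pderiv_dir b f x - pderiv_dir b g x" for b
    by (simp add: pderiv_dir_def)
  then show ?thesis
    unfolding grad_def by (simp add: scaleR_left_diff_distrib sum_subtractf)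
qed

lemma vanishing_limit_diff:
  assumes u: "vanishing_limit D \<Gamma> u G" "u \<in> L2 (lebesgue_on D)" "G \<in> L2 (lebesgue_on D)"
    and v: "vanishing_limit D \<Gamma> v H" "v \<in> L2 (lebesgue_on D)" "H \<in> L2 (lebesgue_on D)"
  shows "vanishing_limit D \<Gamma> (\<lambda>x. u x - v x) (\<lambda>x. G x - H x)"
proof -
  obtain \<eta> where \<eta>: "\<And>k::nat. smooth_on UNIV (\<eta> k) \<and> \<eta> k \<in> L2 (lebesgue_on D) \<and>
      grad (\<eta> k) \<in> L2 (lebesgue_on D) \<and> (\<exists>U. open U \<and> \<Gamma> \<subseteq> U \<and> (\<forall>x\<in>U. \<eta> k x = 0))"
    and \<eta>1: "(\<lambda>k. L2_norm (lebesgue_on D) (\<lambda>x. \<eta> k x - u x)) \<longlonglongrightarrow> 0"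
    and \<eta>2: "(\<lambda>k. L2_norm (lebesgue_on D) (\<lambda>x. grad (\<eta> k) x - G x)) \<longlonglongrightarrow> 0"
    using u(1) unfolding vanishing_limit_def by blast
  obtain \<theta> where \<theta>: "\<And>k::nat. smooth_on UNIV (\<theta> k) \<and> \<theta> k \<in> L2 (lebesgue_on D) \<and>
      grad (\<theta> k) \<in> L2 (lebesgue_on D) \<and> (\<exists>U. open U \<and> \<Gamma> \<subseteq> U \<and> (\<forall>x\<in>U. \<theta> k x = 0))"
    and \<theta>1: "(\<lambda>k. L2_norm (lebesgue_on D) (\<lambda>x. \<theta> k x - v x)) \<longlonglongrightarrow> 0"
    and \<theta>2: "(\<lambda>k. L2_norm (lebesgue_on D) (\<lambda>x. grad (\<theta> k) x - H x)) \<longlonglongrightarrow> 0"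
    using v(1) unfolding vanishing_limit_def by blast
  define f where "f k x = \<eta> k x - \<theta> k x" for k x
  have gf: "grad (f k) = (\<lambda>x. grad (\<eta> k) x - grad (\<theta> k) x)" for k
    unfolding f_def using \<eta>[of k] \<theta>[of k] smooth_on_imp_differentiable[of UNIV] by (intro ext grad_diff) auto
  have "smooth_on UNIV (f k) \<and> f k \<in> L2 (lebesgue_on D) \<and>
      grad (f k) \<in> L2 (lebesgue_on D) \<and> (\<exists>U. open U \<and> \<Gamma> \<subseteq> U \<and> (\<forall>x\<in>U. f k x = 0))" for k
  proof (intro conjI)
    obtain U where U: "open U \<and> \<Gamma> \<subseteq> U \<and> (\<forall>x\<in>U. \<eta> k x = 0)" using \<eta>[of k] by blast
    obtain V where V: "open V \<and> \<Gamma> \<subseteq> V \<and> (\<forall>x\<in>V. \<theta> k x = 0)" using \<theta>[of k] by blast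
    show "\<exists>U. open U \<and> \<Gamma> \<subseteq> U \<and> (\<forall>x\<in>U. f k x = 0)"
      by (rule exI[of _ "U \<inter> V"]) (use U V in \<open>auto simp: f_def\<close>)
    show "smooth_on UNIV (f k)" unfolding f_def using \<eta> \<theta> by (intro smooth_on_diff) auto
    show "f k \<in> L2 (lebesgue_on D)" unfolding f_def using \<eta> \<theta> by (intro L2_diff) auto
    show "grad (f k) \<in> L2 (lebesgue_on D)" unfolding gf using \<eta> \<theta> by (intro L2_diff) auto
  qed
  moreover have "(\<lambda>k. L2_norm (lebesgue_on D) (\<lambda>x. f k x - (u x - v x))) \<longlonglongrightarrow> 0"
  proof (rule tendsto_sandwich[OF _ _ tendsto_const])
    show "(\<lambda>k. L2_norm (lebesgue_on D) (\<lambda>x. \<eta> k x - u x) + L2_norm (lebesgue_on D) (\<lambda>x. \<theta> k x - v x)) \<longlonglongrightarrow> 0"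
      using tendsto_add[OF \<eta>1 \<theta>1] by simp
    have "L2_norm (lebesgue_on D) (\<lambda>x. f k x - (u x - v x)) \<le>
        L2_norm (lebesgue_on D) (\<lambda>x. \<eta> k x - u x) + L2_norm (lebesgue_on D) (\<lambda>x. \<theta> k x - v x)" for k
      using L2_norm_triangle_diff[OF L2_diff[of "\<eta> k" _ u] L2_diff[of "\<theta> k" _ v], of "lebesgue_on D"] \<eta> \<theta> u(2) v(2)
      by (simp add: f_def algebra_simps)
    then show "\<forall>\<^sub>F k in sequentially. L2_norm (lebesgue_on D) (\<lambda>x. f k x - (u x - v x)) \<le>
        L2_norm (lebesgue_on D) (\<lambda>x. \<eta> k x - u x) + L2_norm (lebesgue_on D) (\<lambda>x. \<theta> k x - v x)" by simp
  qed (simp add: L2_norm_nonneg)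
  moreover have "(\<lambda>k. L2_norm (lebesgue_on D) (\<lambda>x. grad (f k) x - (G x - H x))) \<longlonglongrightarrow> 0"
  proof (rule tendsto_sandwich[OF _ _ tendsto_const])
    show "(\<lambda>k. L2_norm (lebesgue_on D) (\<lambda>x. grad (\<eta> k) x - G x) + L2_norm (lebesgue_on D) (\<lambda>x. grad (\<theta> k) x - H x)) \<longlonglongrightarrow> 0"
      using tendsto_add[OF \<eta>2 \<theta>2] by simp
    have "L2_norm (lebesgue_on D) (\<lambda>x. grad (f k) x - (G x - H x)) \<le>
        L2_norm (lebesgue_on D) (\<lambda>x. grad (\<eta> k) x - G x) + L2_norm (lebesgue_on D) (\<lambda>x. grad (\<theta> k) x - H x)" for k
      using L2_norm_triangle_diff[OF L2_diff[of "grad (\<eta> k)" _ G] L2_diff[of "grad (\<theta> k)" _ H], of "lebesgue_on D"] \<eta> \<theta> u(3) v(3)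
      by (simp add: gf algebra_simps)
    then show "\<forall>\<^sub>F k in sequentially. L2_norm (lebesgue_on D) (\<lambda>x. grad (f k) x - (G x - H x)) \<le>
        L2_norm (lebesgue_on D) (\<lambda>x. grad (\<eta> k) x - G x) + L2_norm (lebesgue_on D) (\<lambda>x. grad (\<theta> k) x - H x)" by simp
  qed (simp add: L2_norm_nonneg)
  ultimately show ?thesis unfolding vanishing_limit_def by blast
qed

text \<open>Cutting off at the frontier creates no singularity, as \<open>f\<close> already vanishes
  near it. The support lies in \<open>closure D - N\<close>, a compact subset of
  \<open>D\<close>.\<close>

lemma vanishing_near_frontier_test:
  assumes D: "open D" "bounded D" and f: "smooth_on UNIV f" and N: "open N" "frontier D \<subseteq> N" "\<And>x. x \<in> N \<Longrightarrow> f x = 0"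
  shows "(\<lambda>x. if x \<in> D then f x else 0) \<in> test_functions D" (is "?g \<in> _")
proof -
  have cl: "closure D = D \<union> frontier D" using D(1) closure_subset by (auto simp: frontier_def interior_open)
  have "smooth_on UNIV ?g"
  proof (rule smooth_on_local)
    fix x
    have "smooth_on D ?g"
      by (rule smooth_on_cong[OF D(1) _ smooth_on_subset[OF f]]) auto
    moreover have "smooth_on N ?g"
      by (rule smooth_on_cong[OF N(1) _ smooth_on_const[of _ 0]]) (use N(3) in auto)
    moreover have o: "open (- closure D)" by auto
    then have "smooth_on (- closure D) ?g"
      by (rule smooth_on_cong[OF _ _ smooth_on_const[of _ 0]]) (use closure_subset in auto)
    ultimately show "\<exists>T. open T \<and> x \<in> T \<and> smooth_on T ?g"
      using o D(1) N(1,2) cl by (cases "x \<in> D"; cases "x \<in> frontier D") (blast intro: exI)+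
  qed
  moreover have sub: "closure {x. ?g x \<noteq> 0} \<subseteq> closure D - N"
    by (intro closure_minimal) (use closure_subset N in \<open>auto simp: closed_Diff split: if_splits\<close>)
  moreover have "closure D - N \<subseteq> D" using cl N(2) by auto
  moreover have "compact (closure {x. ?g x \<noteq> 0})"
    using sub D(2) by (meson bounded_closure bounded_subset closed_closure compact_eq_bounded_closed Diff_subset)
  ultimately show ?thesis by (auto simp: test_functions_def)
qed

text \<open>The functions \<open>smooth_min\<close> of the two approximating sequences vanish near
  both parts of the boundary and converge to \<open>w\<close> in the square norm, since both
  sequences do. Their gradients are bounded, and against test functions they converge after an
  integration by parts; together this is weak convergence.\<close>

lemma vanishing_limits_combine:
  fixes w :: "'a::euclidean_space \<Rightarrow> real"
  assumes D: "open D" "bounded D" and w: "w \<in> L2 (lebesgue_on D)" "has_weak_gradient D w G" "G \<in> L2 (lebesgue_on D)"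
    and 1: "vanishing_limit D \<Gamma>1 w G1" "G1 \<in> L2 (lebesgue_on D)"
    and 2: "vanishing_limit D \<Gamma>2 w G2" "G2 \<in> L2 (lebesgue_on D)"
    and \<Gamma>: "frontier D \<subseteq> \<Gamma>1 \<union> \<Gamma>2"
  obtains \<phi> \<delta> where "\<And>k::nat. \<phi> k \<in> test_functions D" "\<delta> \<longlonglongrightarrow> 0"
    "\<And>k. L2_norm (lebesgue_on D) (grad (\<phi> k)) \<le>
       4 * L2_norm (lebesgue_on D) G1 + 4 * L2_norm (lebesgue_on D) G2 + \<delta> k"
    "\<And>z. z \<in> L2 (lebesgue_on D) \<Longrightarrow> (\<lambda>k. \<integral>x. (grad (\<phi> k) x - G x) \<bullet> z x \<partial>lebesgue_on D) \<longlonglongrightarrow> 0"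
proof -
  let ?M = "lebesgue_on D"
  obtain \<eta> where \<eta>: "\<And>k::nat. smooth_on UNIV (\<eta> k) \<and> \<eta> k \<in> L2 ?M \<and>
      grad (\<eta> k) \<in> L2 ?M \<and> (\<exists>U. open U \<and> \<Gamma>1 \<subseteq> U \<and> (\<forall>x\<in>U. \<eta> k x = 0))"
    and \<eta>1: "(\<lambda>k. L2_norm ?M (\<lambda>x. \<eta> k x - w x)) \<longlonglongrightarrow> 0"
    and \<eta>2: "(\<lambda>k. L2_norm ?M (\<lambda>x. grad (\<eta> k) x - G1 x)) \<longlonglongrightarrow> 0"
    using 1(1) unfolding vanishing_limit_def by blast
  obtain \<psi> where \<psi>: "\<And>k::nat. smooth_on UNIV (\<psi> k) \<and> \<psi> k \<in> L2 ?M \<and>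
      grad (\<psi> k) \<in> L2 ?M \<and> (\<exists>U. open U \<and> \<Gamma>2 \<subseteq> U \<and> (\<forall>x\<in>U. \<psi> k x = 0))"
    and \<psi>1: "(\<lambda>k. L2_norm ?M (\<lambda>x. \<psi> k x - w x)) \<longlonglongrightarrow> 0"
    and \<psi>2: "(\<lambda>k. L2_norm ?M (\<lambda>x. grad (\<psi> k) x - G2 x)) \<longlonglongrightarrow> 0"
    using 2(1) unfolding vanishing_limit_def by blast
  \<comment> \<open>The regularization may tend to zero at any rate, because the gradient bound of
    \<open>smooth_min\<close> does not depend on it.\<close>
  define \<epsilon> where "\<epsilon> k = 1 / real (Suc k)" for k
  have \<epsilon>: "\<epsilon> k > 0" for k by (simp add: \<epsilon>_def)
  define f where "f k x = smooth_min (\<epsilon> k) (\<psi> k x) (\<eta> k x)" for k x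
  define \<phi> where "\<phi> k x = (if x \<in> D then f k x else 0)" for k x
  have f_smooth: "smooth_on UNIV (f k)" for k
  proof -
    have "(\<psi> k x)\<^sup>2 + (\<eta> k x)\<^sup>2 + (\<epsilon> k)\<^sup>2 \<noteq> 0" for x
      using \<epsilon>[of k] by (metis add_nonneg_pos less_irrefl sum_power2_ge_zero zero_less_power)
    then show ?thesis
      unfolding f_def smooth_min_def power2_eq_square using \<eta>[of k] \<psi>[of k]
      by (intro smooth_on_divide smooth_on_mult smooth_on_add smooth_on_const) auto
  qed
  have \<phi>_test: "\<phi> k \<in> test_functions D" for k
  proof -
    obtain U where U: "open U \<and> \<Gamma>1 \<subseteq> U \<and> (\<forall>x\<in>U. \<eta> k x = 0)" using \<eta>[of k] by blast
    obtain V where V: "open V \<and> \<Gamma>2 \<subseteq> V \<and> (\<forall>x\<in>V. \<psi> k x = 0)" using \<psi>[of k] by blast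
    have "open (U \<union> V)" "frontier D \<subseteq> U \<union> V" using U V \<Gamma> by auto
    moreover have "f k x = 0" if "x \<in> U \<union> V" for x
      using that U V by (auto simp: f_def smooth_min_zero)
    ultimately show ?thesis
      unfolding \<phi>_def[abs_def] by (intro vanishing_near_frontier_test[OF D f_smooth])
  qed
  have grad_\<phi>: "grad (\<phi> k) x = grad (f k) x" if "x \<in> D" for k x
    unfolding grad_def using that pderiv_dir_cong_open[OF D(1) that, of "\<phi> k" "f k"] by (simp add: \<phi>_def)
  have \<phi>L: "\<phi> k \<in> L2 ?M" "grad (\<phi> k) \<in> L2 ?M" for k
    using test_functions_L2[OF D(1) \<phi>_test] grad_test_functions_L2[OF D(1) \<phi>_test] by auto
  define \<delta> where "\<delta> k = 4 * L2_norm ?M (\<lambda>x. grad (\<eta> k) x - G1 x) + 4 * L2_norm ?M (\<lambda>x. grad (\<psi> k) x - G2 x)" for k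
  have \<delta>: "\<delta> \<longlonglongrightarrow> 0"
    unfolding \<delta>_def using tendsto_add[OF tendsto_mult_left[OF \<eta>2, of 4] tendsto_mult_left[OF \<psi>2, of 4]] by simp
  have grad_bound: "L2_norm ?M (grad (\<phi> k)) \<le> 4 * L2_norm ?M G1 + 4 * L2_norm ?M G2 + \<delta> k" for k
  proof -
    have m: "(\<lambda>x. norm (grad (\<psi> k) x)) \<in> L2 ?M" "(\<lambda>x. norm (grad (\<eta> k) x)) \<in> L2 ?M"
      using \<eta>[of k] \<psi>[of k] by (auto simp: L2_def)
    have "L2_norm ?M (grad (\<phi> k)) \<le> 1 * L2_norm ?M (\<lambda>x. 4 * norm (grad (\<psi> k) x) + 4 * norm (grad (\<eta> k) x))"
    proof (rule L2_norm_bound)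
      show "(\<lambda>x. 4 * norm (grad (\<psi> k) x) + 4 * norm (grad (\<eta> k) x)) \<in> L2 ?M"
        by (intro L2_add L2_cmult m)
      show "AE x in ?M. norm (grad (\<phi> k) x) \<le> 1 * norm (4 * norm (grad (\<psi> k) x) + 4 * norm (grad (\<eta> k) x))"
      proof (intro AE_I2)
        fix x assume "x \<in> space ?M"
        then have "grad (\<phi> k) x = grad (f k) x" using grad_\<phi> by simp
        moreover have "norm (grad (f k) x) \<le> 4 * norm (grad (\<psi> k) x) + 4 * norm (grad (\<eta> k) x)"
          unfolding f_def using \<eta>[of k] \<psi>[of k] smooth_on_imp_differentiable[of UNIV]
          by (intro grad_smooth_min_bound \<epsilon>) auto
        ultimately show "norm (grad (\<phi> k) x) \<le> 1 * norm (4 * norm (grad (\<psi> k) x) + 4 * norm (grad (\<eta> k) x))"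
          by simp
      qed
    qed simp
    also have "\<dots> \<le> L2_norm ?M (\<lambda>x. 4 * norm (grad (\<psi> k) x)) + L2_norm ?M (\<lambda>x. 4 * norm (grad (\<eta> k) x))"
      using L2_norm_triangle[OF L2_cmult[OF m(1)] L2_cmult[OF m(2)]] by simp
    also have "\<dots> = 4 * L2_norm ?M (grad (\<psi> k)) + 4 * L2_norm ?M (grad (\<eta> k))"
      by (simp add: L2_norm_def power_mult_distrib real_sqrt_mult)
    also have "\<dots> \<le> 4 * (L2_norm ?M (\<lambda>x. grad (\<psi> k) x - G2 x) + L2_norm ?M G2) +
        4 * (L2_norm ?M (\<lambda>x. grad (\<eta> k) x - G1 x) + L2_norm ?M G1)"
      using L2_norm_triangle[OF L2_diff[of "grad (\<psi> k)" ?M G2] 2(2)] L2_norm_triangle[OF L2_diff[of "grad (\<eta> k)" ?M G1] 1(2)]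
        \<eta>[of k] \<psi>[of k] 1(2) 2(2) by simp
    finally show ?thesis by (simp add: \<delta>_def)
  qed
  \<comment> \<open>Boundedness of \<open>D\<close> makes the constant error \<epsilon> of
    \<open>smooth_min\<close> square integrable.\<close>
  have one: "(\<lambda>x. 1 :: real) \<in> L2 ?M"
  proof -
    have "integrable lebesgue (indicator D :: 'a \<Rightarrow> real)"
      using lmeasurable_open[OF D(2,1)] by (intro integrable_real_indicator) (auto simp: fmeasurable_def)
    then show ?thesis using D(1) by (simp add: L2_def integrable_restrict_space)
  qed
  have conv: "(\<lambda>k. L2_norm ?M (\<lambda>x. \<phi> k x - w x)) \<longlonglongrightarrow> 0"
  proof (rule tendsto_sandwich[OF _ _ tendsto_const])
    \<comment> \<open>The distance of \<open>smooth_min\<close> to \<psi> is at most \<bar>\<eta> -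
      \<psi>\<bar> + \<epsilon>. Passing through \<open>w\<close> splits \<bar>\<eta> - \<psi>\<bar>
      in two, and the distance from \<psi> to \<open>w\<close> enters a second time.\<close>
    let ?b = "\<lambda>k. 2 * L2_norm ?M (\<lambda>x. \<psi> k x - w x) + L2_norm ?M (\<lambda>x. \<eta> k x - w x) + \<epsilon> k * L2_norm ?M (\<lambda>x. 1 :: real)"
    have "\<epsilon> \<longlonglongrightarrow> 0" unfolding \<epsilon>_def by real_asymp
    then have "?b \<longlonglongrightarrow> 2 * 0 + 0 + 0 * L2_norm ?M (\<lambda>x. 1 :: real)"
      using \<psi>1 \<eta>1 by (intro tendsto_intros)
    then show "?b \<longlonglongrightarrow> 0" by simp
    have "L2_norm ?M (\<lambda>x. \<phi> k x - w x) \<le> ?b k" for k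
    proof -
      have m: "(\<lambda>x. \<bar>\<psi> k x - w x\<bar>) \<in> L2 ?M" "(\<lambda>x. \<bar>\<eta> k x - w x\<bar>) \<in> L2 ?M"
        using L2_diff[of "\<psi> k" ?M w] L2_diff[of "\<eta> k" ?M w] \<eta>[of k] \<psi>[of k] w(1) by (auto simp: L2_def)
      have "L2_norm ?M (\<lambda>x. \<phi> k x - w x) \<le> 1 * L2_norm ?M (\<lambda>x. (2 * \<bar>\<psi> k x - w x\<bar> + \<bar>\<eta> k x - w x\<bar>) + \<epsilon> k * 1)"
      proof (rule L2_norm_bound)
        show "(\<lambda>x. (2 * \<bar>\<psi> k x - w x\<bar> + \<bar>\<eta> k x - w x\<bar>) + \<epsilon> k * 1) \<in> L2 ?M"
          by (intro L2_add L2_cmult m one)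
        show "AE x in ?M. norm (\<phi> k x - w x) \<le> 1 * norm ((2 * \<bar>\<psi> k x - w x\<bar> + \<bar>\<eta> k x - w x\<bar>) + \<epsilon> k * 1)"
        proof (intro AE_I2)
          fix x assume "x \<in> space ?M"
          then have "\<phi> k x = smooth_min (\<epsilon> k) (\<psi> k x) (\<eta> k x)" by (simp add: \<phi>_def f_def)
          then show "norm (\<phi> k x - w x) \<le> 1 * norm ((2 * \<bar>\<psi> k x - w x\<bar> + \<bar>\<eta> k x - w x\<bar>) + \<epsilon> k * 1)"
            using smooth_min_approx[OF \<epsilon>[of k], of "\<psi> k x" "\<eta> k x"] \<epsilon>[of k]
            unfolding real_norm_def mult_1 mult_1_right by (smt (verit))
        qed
      qed simp
      also have "\<dots> \<le> (L2_norm ?M (\<lambda>x. 2 * \<bar>\<psi> k x - w x\<bar>) + L2_norm ?M (\<lambda>x. \<bar>\<eta> k x - w x\<bar>)) + L2_norm ?M (\<lambda>x. \<epsilon> k * 1)"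
        using L2_norm_triangle[OF L2_add[OF L2_cmult[OF m(1), of 2] m(2)] L2_cmult[OF one, of "\<epsilon> k"]]
          L2_norm_triangle[OF L2_cmult[OF m(1), of 2] m(2)] by simp
      also have "\<dots> = ?b k"
        using \<epsilon>[of k] by (simp add: L2_norm_def power_mult_distrib real_sqrt_mult)
      finally show ?thesis .
    qed
    then show "\<forall>\<^sub>F k in sequentially. L2_norm ?M (\<lambda>x. \<phi> k x - w x) \<le> ?b k" by simp
  qed (simp add: L2_norm_nonneg)
  obtain B where B: "\<And>k. \<bar>\<delta> k\<bar> \<le> B"
    using convergent_imp_Bseq[OF convergentI[OF \<delta>]] by (auto simp: Bseq_def)
  have eL: "(\<lambda>x. grad (\<phi> k) x - G x) \<in> L2 ?M" for k by (intro L2_diff \<phi>L w(3))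
  have comp: "(\<lambda>k. \<integral>x. ((grad (\<phi> k) x - G x) \<bullet> b) * z x \<partial>?M) \<longlonglongrightarrow> 0"
    if b: "b \<in> Basis" and z: "z \<in> L2 ?M" for b z
  proof (rule L2_weak_convergence[OF D(1) _ _ _ z])
    show "(\<lambda>x. (grad (\<phi> k) x - G x) \<bullet> b) \<in> L2 ?M" for k by (intro L2_inner_left eL)
    show "L2_norm ?M (\<lambda>x. (grad (\<phi> k) x - G x) \<bullet> b) \<le>
        4 * L2_norm ?M G1 + 4 * L2_norm ?M G2 + B + L2_norm ?M G" for k
      using L2_norm_component_le[OF eL b, of k] L2_norm_triangle_diff[OF \<phi>L(2) w(3), of k] grad_bound[of k] B[of k]
      by linarith
    fix \<theta> :: "'a \<Rightarrow> real" assume \<theta>: "\<theta> \<in> test_functions D"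
    have d\<theta>: "pderiv_dir b \<theta> \<in> L2 ?M" by (rule test_functions_L2[OF D(1) test_functions_pderiv_dir[OF \<theta> b]])
    \<comment> \<open>With the derivative moved onto \<theta>, only the convergence of the functions
      themselves enters.\<close>
    have eq: "(\<integral>x. ((grad (\<phi> k) x - G x) \<bullet> b) * \<theta> x \<partial>?M) = - (\<integral>x. (\<phi> k x - w x) * pderiv_dir b \<theta> x \<partial>?M)" for k
    proof -
      have "smooth_on D (\<phi> k)" using \<phi>_test[of k] smooth_on_subset by (auto simp: test_functions_def)
      from has_weak_gradient_diff[OF D(1) smooth_has_weak_gradient[OF D(1) this] w(2)]
      show ?thesis using b \<theta> by (simp add: has_weak_gradient_def has_weak_pderiv_def)
    qed
    show "(\<lambda>k. \<integral>x. ((grad (\<phi> k) x - G x) \<bullet> b) * \<theta> x \<partial>?M) \<longlonglongrightarrow> 0"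
    proof (rule Lim_null_comparison)
      show "(\<lambda>k. L2_norm ?M (\<lambda>x. \<phi> k x - w x) * L2_norm ?M (pderiv_dir b \<theta>)) \<longlonglongrightarrow> 0"
        using tendsto_mult_right[OF conv, of "L2_norm ?M (pderiv_dir b \<theta>)"] by simp
      show "\<forall>\<^sub>F k in sequentially. norm (\<integral>x. ((grad (\<phi> k) x - G x) \<bullet> b) * \<theta> x \<partial>?M) \<le>
          L2_norm ?M (\<lambda>x. \<phi> k x - w x) * L2_norm ?M (pderiv_dir b \<theta>)"
        using L2_Cauchy_Schwarz[OF L2_diff[OF \<phi>L(1) w(1)] d\<theta>] by (simp add: eq)
    qed
  qed
  show ?thesis
  proof (rule that[OF \<phi>_test \<delta> grad_bound])
    fix z :: "'a \<Rightarrow> 'a" assume z: "z \<in> L2 ?M"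
    have "(\<integral>x. (grad (\<phi> k) x - G x) \<bullet> z x \<partial>?M) = (\<Sum>b\<in>Basis. \<integral>x. ((grad (\<phi> k) x - G x) \<bullet> b) * (z x \<bullet> b) \<partial>?M)" for k
    proof -
      have "(\<lambda>x. (grad (\<phi> k) x - G x) \<bullet> z x) = (\<lambda>x. \<Sum>b\<in>Basis. ((grad (\<phi> k) x - G x) \<bullet> b) * (z x \<bullet> b))"
        by (rule ext) (rule euclidean_inner)
      then show ?thesis
        by (simp only:) (intro Bochner_Integration.integral_sum L2_integrable_mult L2_inner_left eL z)
    qed
    moreover have "(\<lambda>k. \<Sum>b\<in>Basis. \<integral>x. ((grad (\<phi> k) x - G x) \<bullet> b) * (z x \<bullet> b) \<partial>?M) \<longlonglongrightarrow> 0"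
      by (intro tendsto_null_sum comp L2_inner_left z)
    ultimately show "(\<lambda>k. \<integral>x. (grad (\<phi> k) x - G x) \<bullet> z x \<partial>?M) \<longlonglongrightarrow> 0" by simp
  qed
qed

section \<open>Green's formula on the overlap\<close>

lemma L2_sum:
  assumes "finite I" "\<And>i. i \<in> I \<Longrightarrow> h i \<in> L2 M"
  shows "(\<lambda>x. \<Sum>i\<in>I. h i x) \<in> L2 M"
  using assms
proof (induction I rule: finite_induct)
  case empty
  show ?case by (simp add: L2_def)
next
  case (insert i I)
  then show ?case by (simp add: L2_add)
qed

lemma L2_tendsto_integral:
  fixes f :: "nat \<Rightarrow> 'a \<Rightarrow> real"
  assumes f: "\<And>k. f k \<in> L2 M" "f' \<in> L2 M" and g: "g \<in> L2 M"
    and lim: "(\<lambda>k. L2_norm M (\<lambda>x. f k x - f' x)) \<longlonglongrightarrow> 0"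
  shows "(\<lambda>k. \<integral>x. f k x * g x \<partial>M) \<longlonglongrightarrow> (\<integral>x. f' x * g x \<partial>M)"
proof -
  have "(\<lambda>k. (\<integral>x. f k x * g x \<partial>M) - (\<integral>x. f' x * g x \<partial>M)) \<longlonglongrightarrow> 0"
  proof (rule Lim_null_comparison)
    show "(\<lambda>k. L2_norm M (\<lambda>x. f k x - f' x) * L2_norm M g) \<longlonglongrightarrow> 0"
      using tendsto_mult_right[OF lim, of "L2_norm M g"] by simp
    have "(\<integral>x. f k x * g x \<partial>M) - (\<integral>x. f' x * g x \<partial>M) = (\<integral>x. (f k x - f' x) \<bullet> g x \<partial>M)" for k
      using L2_integrable_mult[OF f(1) g, of k] L2_integrable_mult[OF f(2) g] by (simp add: left_diff_distrib)
    then show "\<forall>\<^sub>F k in sequentially. norm ((\<integral>x. f k x * g x \<partial>M) - (\<integral>x. f' x * g x \<partial>M)) \<le>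
        L2_norm M (\<lambda>x. f k x - f' x) * L2_norm M g"
      using L2_Cauchy_Schwarz[OF L2_diff[OF f] g] by simp
  qed
  then show ?thesis by (simp add: LIM_zero_iff)
qed

context thin_overlap
begin

text \<open>For an approximant \<psi> of the trace, the product with \<phi> extended by zero is a
  test function of \<open>W\<close>, to which the one-sided divergence theorem applies. The two
  volume terms converge by the Sobolev convergence, the face term by that of the restrictions,
  paired with \<phi> in the square-integrable functions on \<open>F\<close>.\<close>

lemma green_component:
  assumes v: "has_trace_on_face W n F v g" and \<phi>: "\<phi> \<in> test_functions W" and b: "b \<in> Basis"
  shows "(\<integral>x. (weak_gradient W v x \<bullet> b) * \<phi> x \<partial>lebesgue_on (A \<inter> W)) +
      (\<integral>x. v x * pderiv_dir b \<phi> x \<partial>lebesgue_on (A \<inter> W)) = (b \<bullet> n) * (\<integral>x. g x * \<phi> x \<partial>face_measure n F)"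
proof -
  let ?M = "lebesgue_on (A \<inter> W)"
  have sets: "A \<inter> W \<in> sets lebesgue" "W \<in> sets lebesgue" using open_overlap open_W by auto
  obtain \<psi> where v1: "v \<in> sobolev 1 W" and g: "g \<in> L2 (face_measure n F)"
    and \<psi>: "\<And>k. smooth_on W (\<psi> k)" "\<And>k. \<psi> k \<in> sobolev 1 W" "\<And>k. \<psi> k \<in> L2 (face_measure n F)"
    and lim: "(\<lambda>k::nat. H1_norm W (\<lambda>x. \<psi> k x - v x)) \<longlonglongrightarrow> 0"
    and lim_face: "(\<lambda>k. L2_norm (face_measure n F) (\<lambda>x. \<psi> k x - g x)) \<longlonglongrightarrow> 0"
    using v unfolding has_trace_on_face_def by blast
  note H = H1_tendsto[OF open_W v1 \<psi>(2,1) lim]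
  note sv = sobolev_1_weak_gradient[OF open_W v1]
  note restr = L2_restrict[OF _ Int_lower2 sets] and restr_le = L2_norm_restrict_le[OF _ Int_lower2 sets]
  have \<phi>L: "\<phi> \<in> L2 ?M" "pderiv_dir b \<phi> \<in> L2 ?M"
    using test_functions_L2[OF open_overlap] \<phi> test_functions_pderiv_dir[OF \<phi> b] by auto
  have \<psi>L: "\<psi> k \<in> L2 (lebesgue_on W)" for k using sobolev_1_weak_gradient(1)[OF open_W \<psi>(2)] .
  have lim1: "(\<lambda>k. \<integral>x. \<psi> k x * pderiv_dir b \<phi> x \<partial>?M) \<longlonglongrightarrow> (\<integral>x. v x * pderiv_dir b \<phi> x \<partial>?M)"
  proof (rule L2_tendsto_integral[OF restr[OF \<psi>L] restr[OF sv(1)] \<phi>L(2)])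
    show "(\<lambda>k. L2_norm ?M (\<lambda>x. \<psi> k x - v x)) \<longlonglongrightarrow> 0"
      by (rule tendsto_sandwich[OF _ _ tendsto_const H(2)])
        (auto simp: L2_norm_nonneg intro!: always_eventually restr_le L2_diff sv \<psi>L)
  qed
  have lim2: "(\<lambda>k. \<integral>x. (grad (\<psi> k) x \<bullet> b) * \<phi> x \<partial>?M) \<longlonglongrightarrow> (\<integral>x. (weak_gradient W v x \<bullet> b) * \<phi> x \<partial>?M)"
  proof (rule L2_tendsto_integral[OF L2_inner_left[OF restr[OF H(1)]] L2_inner_left[OF restr[OF sv(3)]] \<phi>L(1)])
    have d: "(\<lambda>x. grad (\<psi> k) x - weak_gradient W v x) \<in> L2 (lebesgue_on W)" for k by (intro L2_diff H sv)
    have "L2_norm ?M (\<lambda>x. grad (\<psi> k) x \<bullet> b - weak_gradient W v x \<bullet> b) \<le>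
        L2_norm (lebesgue_on W) (\<lambda>x. grad (\<psi> k) x - weak_gradient W v x)" for k
      using L2_norm_component_le[OF restr[OF d[of k]] b] restr_le[OF d[of k]] by (simp add: inner_diff_left)
    then show "(\<lambda>k. L2_norm ?M (\<lambda>x. grad (\<psi> k) x \<bullet> b - weak_gradient W v x \<bullet> b)) \<longlonglongrightarrow> 0"
      by (intro tendsto_sandwich[OF _ _ tendsto_const H(3)]) (auto simp: L2_norm_nonneg)
  qed
  have lim3: "(\<lambda>k. \<integral>x. \<psi> k x * \<phi> x \<partial>face_measure n F) \<longlonglongrightarrow> (\<integral>x. g x * \<phi> x \<partial>face_measure n F)"
    by (rule L2_tendsto_integral[OF \<psi>(3) g face_poincare(1)[OF \<phi>] lim_face])
  have eq: "(\<integral>x. (grad (\<psi> k) x \<bullet> b) * \<phi> x \<partial>?M) + (\<integral>x. \<psi> k x * pderiv_dir b \<phi> x \<partial>?M) =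
      (b \<bullet> n) * (\<integral>x. \<psi> k x * \<phi> x \<partial>face_measure n F)" for k
  proof -
    define p where "p x = (if x \<in> W then \<psi> k x * \<phi> x else 0)" for x
    have p: "p \<in> test_functions W" "\<And>x. x \<in> W \<Longrightarrow> pderiv_dir b p x = \<psi> k x * pderiv_dir b \<phi> x + pderiv_dir b (\<psi> k) x * \<phi> x"
      using smooth_mult_test[OF open_W \<psi>(1)[of k] \<phi>] unfolding p_def by auto
    have supp: "compact (closure {x. p x \<noteq> 0})" "closure {x. p x \<noteq> 0} \<subseteq> W"
      using p(1) by (auto simp: test_functions_def)
    have part: "(\<integral>x. indicator A x * pderiv_dir b p x \<partial>lborel) = (b \<bullet> n) *
       (\<integral>x. indicator {0..1} ((x - p0) \<bullet> n) *
          (indicator F (x - ((x - p0) \<bullet> n) *\<^sub>R n) * p (x - ((x - p0) \<bullet> n) *\<^sub>R n)) \<partial>lborel)"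
      using integral_pderiv_over_part[OF open_A open_W F_eq norm_n plane ext test_functions_Ck1[OF p(1)] supp] by auto
    have face: "(\<integral>x. p x \<partial>face_measure n F) = (\<integral>x. indicator {0..1} ((x - p0) \<bullet> n) *
          (indicator F (x - ((x - p0) \<bullet> n) *\<^sub>R n) * p (x - ((x - p0) \<bullet> n) *\<^sub>R n)) \<partial>lborel)"
      by (rule face_measure_integral[OF F_borel F_ne plane]) (auto intro: test_functions_measurable[OF p(1)])
    have "(\<integral>x. p x \<partial>face_measure n F) = (\<integral>x. \<psi> k x * \<phi> x \<partial>face_measure n F)"
    proof (rule Bochner_Integration.integral_cong[OF refl])
      fix x assume "x \<in> space (face_measure n F)"
      then have "x \<in> F" by (simp add: face_measure_def Let_def space_restrict_space)
      then show "p x = \<psi> k x * \<phi> x" using F_eq by (auto simp: p_def)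
    qed
    moreover have "(\<integral>x. indicator A x * pderiv_dir b p x \<partial>lborel) = (\<integral>x. indicator A x * pderiv_dir b p x \<partial>?M)"
    proof (rule integral_lebesgue_on_borel[symmetric])
      have "pderiv_dir b p \<in> borel_measurable borel"
        by (rule test_functions_measurable[OF test_functions_pderiv_dir[OF p(1) b]])
      then show "(\<lambda>x. indicator A x * pderiv_dir b p x) \<in> borel_measurable borel"
        using open_A by (intro borel_measurable_times borel_measurable_indicator) auto
      show "indicator A x * pderiv_dir b p x = 0" if "x \<notin> A \<inter> W" for x
        using that test_functions_vanish[OF test_functions_pderiv_dir[OF p(1) b]] by (cases "x \<in> A") auto
    qed (rule sets)
    moreover have "(\<integral>x. indicator A x * pderiv_dir b p x \<partial>?M) = (\<integral>x. (grad (\<psi> k) x \<bullet> b) * \<phi> x + \<psi> k x * pderiv_dir b \<phi> x \<partial>?M)"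
      using p(2) by (intro Bochner_Integration.integral_cong) (auto simp: grad_inner_Basis[OF b])
    moreover have "\<dots> = (\<integral>x. (grad (\<psi> k) x \<bullet> b) * \<phi> x \<partial>?M) + (\<integral>x. \<psi> k x * pderiv_dir b \<phi> x \<partial>?M)"
      by (intro Bochner_Integration.integral_add L2_integrable_mult L2_inner_left \<phi>L restr H(1) \<psi>L)
    ultimately show ?thesis using part face by simp
  qed
  show ?thesis
    by (rule LIMSEQ_unique[OF tendsto_add[OF lim2 lim1]]) (simp only: eq, intro tendsto_mult_left lim3)
qed

text \<open>The weak equation cannot be restricted to the overlap directly, as \<phi> need not
  vanish on the face. The gradient trace makes the components of the gradient weakly differentiable,
  so the equation first turns into one that holds almost everywhere on \<open>W\<close>; multiplied
  by \<phi> and integrated over the overlap it gives the claim through Green's formula.\<close>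

lemma overlap_flux_identity:
  assumes G: "has_gradient_trace_on_face W n F u G" and f: "f \<in> L2 (lebesgue_on W)"
    and eqn: "\<And>\<phi>. \<phi> \<in> test_functions W \<Longrightarrow>
      \<rho> * (\<integral>x. weak_gradient W u x \<bullet> grad \<phi> x \<partial>lebesgue_on W) = (\<integral>x. f x * \<phi> x \<partial>lebesgue_on W)"
    and \<phi>: "\<phi> \<in> test_functions W"
  shows "\<rho> * (\<integral>x. weak_gradient W u x \<bullet> grad \<phi> x \<partial>lebesgue_on (A \<inter> W)) =
    (\<integral>x. f x * \<phi> x \<partial>lebesgue_on (A \<inter> W)) + \<rho> * (\<integral>x. (G x \<bullet> n) * \<phi> x \<partial>face_measure n F)"
proof -
  have sets: "A \<inter> W \<in> sets lebesgue" "W \<in> sets lebesgue" using open_overlap open_W by auto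
  define V where "V = weak_gradient W u"
  define Vb where "Vb b x = V x \<bullet> b" for b x
  have tr: "has_trace_on_face W n F (Vb b) (\<lambda>x. G x \<bullet> b)" if "b \<in> Basis" for b
    using G that unfolding has_gradient_trace_on_face_def Vb_def V_def by blast
  have GL: "G \<in> L2 (face_measure n F)" using G unfolding has_gradient_trace_on_face_def by blast
  have sob: "Vb b \<in> sobolev 1 W" if "b \<in> Basis" for b using tr[OF that] by (simp add: has_trace_on_face_def)
  note sv = sobolev_1_weak_gradient[OF open_W sob]
  \<comment> \<open>The weak divergence of the gradient \<open>V\<close> of \<open>u\<close>, that
    is, its weak Laplacian.\<close>
  define \<Delta> where "\<Delta> x = (\<Sum>b\<in>Basis. weak_gradient W (Vb b) x \<bullet> b)" for x
  have bL: "(\<lambda>x. weak_gradient W (Vb b) x \<bullet> b) \<in> L2 (lebesgue_on W)" if "b \<in> Basis" for b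
    by (intro L2_inner_left sv(3) that)
  have \<Delta>L: "\<Delta> \<in> L2 (lebesgue_on W)" unfolding \<Delta>_def by (intro L2_sum bL) auto
  have inner_eq: "V x \<bullet> grad \<theta> x = (\<Sum>b\<in>Basis. Vb b x * pderiv_dir b \<theta> x)" for \<theta> x
    by (subst euclidean_inner) (simp add: Vb_def grad_inner_Basis)
  have sum_int: "(\<integral>x. V x \<bullet> grad \<theta> x \<partial>lebesgue_on E) = (\<Sum>b\<in>Basis. \<integral>x. Vb b x * pderiv_dir b \<theta> x \<partial>lebesgue_on E)"
    "(\<integral>x. \<Delta> x * \<theta> x \<partial>lebesgue_on E) = (\<Sum>b\<in>Basis. \<integral>x. (weak_gradient W (Vb b) x \<bullet> b) * \<theta> x \<partial>lebesgue_on E)"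
    if "\<theta> \<in> test_functions W" "open E" "E \<subseteq> W" for \<theta> E
  proof -
    have E: "E \<in> sets lebesgue" using that by auto
    show "(\<integral>x. V x \<bullet> grad \<theta> x \<partial>lebesgue_on E) = (\<Sum>b\<in>Basis. \<integral>x. Vb b x * pderiv_dir b \<theta> x \<partial>lebesgue_on E)"
      unfolding inner_eq
      by (intro Bochner_Integration.integral_sum L2_integrable_mult L2_restrict[OF sv(1) that(3) E sets(2)]
          test_functions_L2[OF that(2) test_functions_pderiv_dir[OF that(1)]])
    show "(\<integral>x. \<Delta> x * \<theta> x \<partial>lebesgue_on E) = (\<Sum>b\<in>Basis. \<integral>x. (weak_gradient W (Vb b) x \<bullet> b) * \<theta> x \<partial>lebesgue_on E)"
      unfolding \<Delta>_def sum_distrib_right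
      by (intro Bochner_Integration.integral_sum L2_integrable_mult L2_restrict[OF bL that(3) E sets(2)]
          test_functions_L2[OF that(2) that(1)])
  qed
  have AE: "AE x in lebesgue_on W. f x + \<rho> * \<Delta> x = 0"
  proof (rule locally_integrable_zero_AE[OF open_W])
    show "locally_integrable_on (\<lambda>x. f x + \<rho> * \<Delta> x) W"
      by (intro L2_imp_locally_integrable[OF open_W] L2_add L2_cmult f \<Delta>L)
    fix \<theta> :: "'a \<Rightarrow> real" assume \<theta>: "\<theta> \<in> test_functions W"
    have "(\<integral>x. Vb b x * pderiv_dir b \<theta> x \<partial>lebesgue_on W) = - (\<integral>x. (weak_gradient W (Vb b) x \<bullet> b) * \<theta> x \<partial>lebesgue_on W)"
      if "b \<in> Basis" for b
      using sv(2)[OF that] that \<theta> by (simp add: has_weak_gradient_def has_weak_pderiv_def)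
    then have "(\<integral>x. V x \<bullet> grad \<theta> x \<partial>lebesgue_on W) = - (\<integral>x. \<Delta> x * \<theta> x \<partial>lebesgue_on W)"
      using sum_int[OF \<theta> open_W] by (simp add: sum_negf)
    then have "(\<integral>x. f x * \<theta> x \<partial>lebesgue_on W) + \<rho> * (\<integral>x. \<Delta> x * \<theta> x \<partial>lebesgue_on W) = 0"
      using eqn[OF \<theta>] by (simp add: V_def)
    moreover have "(\<integral>x. (f x + \<rho> * \<Delta> x) * \<theta> x \<partial>lebesgue_on W) =
        (\<integral>x. f x * \<theta> x \<partial>lebesgue_on W) + \<rho> * (\<integral>x. \<Delta> x * \<theta> x \<partial>lebesgue_on W)"
      using L2_integrable_mult[OF f test_functions_L2[OF open_W \<theta>]] L2_integrable_mult[OF \<Delta>L test_functions_L2[OF open_W \<theta>]]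
      by (simp add: distrib_right mult.assoc)
    ultimately show "(\<integral>x. (f x + \<rho> * \<Delta> x) * \<theta> x \<partial>lebesgue_on W) = 0" by simp
  qed
  let ?M = "lebesgue_on (A \<inter> W)"
  have \<phi>L: "\<phi> \<in> L2 ?M" by (rule test_functions_L2[OF open_overlap \<phi>])
  have fL: "f \<in> L2 ?M" and \<Delta>L': "\<Delta> \<in> L2 ?M"
    using L2_restrict[OF f Int_lower2 sets] L2_restrict[OF \<Delta>L Int_lower2 sets] by auto
  have "AE x in lebesgue. x \<in> A \<inter> W \<longrightarrow> f x + \<rho> * \<Delta> x = 0"
    using AE sets by (auto simp: AE_restrict_space_iff elim: eventually_mono)
  then have "AE x in ?M. f x + \<rho> * \<Delta> x = 0"
    using sets by (simp add: AE_restrict_space_iff)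
  then have "(\<integral>x. f x * \<phi> x \<partial>?M) = (\<integral>x. - \<rho> * (\<Delta> x * \<phi> x) \<partial>?M)"
  proof (intro integral_cong_AE)
    assume "AE x in ?M. f x + \<rho> * \<Delta> x = 0"
    then show "AE x in ?M. f x * \<phi> x = - \<rho> * (\<Delta> x * \<phi> x)"
      by eventually_elim (simp add: add_eq_0_iff mult.assoc[symmetric])
  qed (use L2_measurable[OF fL] L2_measurable[OF \<Delta>L'] L2_measurable[OF \<phi>L] in \<open>auto\<close>)
  then have f_eq: "(\<integral>x. f x * \<phi> x \<partial>?M) = - \<rho> * (\<integral>x. \<Delta> x * \<phi> x \<partial>?M)" by simp
  have "(\<integral>x. \<Delta> x * \<phi> x \<partial>?M) + (\<integral>x. V x \<bullet> grad \<phi> x \<partial>?M) = (\<Sum>b\<in>Basis. (b \<bullet> n) * (\<integral>x. (G x \<bullet> b) * \<phi> x \<partial>face_measure n F))"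
    unfolding sum_int[OF \<phi> open_overlap Int_lower2] sum.distrib[symmetric]
    by (intro sum.cong refl green_component tr \<phi>)
  also have "\<dots> = (\<integral>x. (G x \<bullet> n) * \<phi> x \<partial>face_measure n F)"
  proof -
    have "(G x \<bullet> n) * \<phi> x = (\<Sum>b\<in>Basis. (b \<bullet> n) * ((G x \<bullet> b) * \<phi> x))" for x
      by (subst euclidean_inner) (simp add: sum_distrib_right sum_distrib_left inner_commute mult_ac)
    then have "(\<integral>x. (G x \<bullet> n) * \<phi> x \<partial>face_measure n F) = (\<Sum>b\<in>Basis. \<integral>x. (b \<bullet> n) * ((G x \<bullet> b) * \<phi> x) \<partial>face_measure n F)"
      by (simp only:) (intro Bochner_Integration.integral_sum integrable_mult_right L2_integrable_mult L2_inner_left GL face_poincare(1)[OF \<phi>])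
    then show ?thesis by simp
  qed
  finally have "\<rho> * (\<integral>x. V x \<bullet> grad \<phi> x \<partial>?M) = \<rho> * (\<integral>x. (G x \<bullet> n) * \<phi> x \<partial>face_measure n F) - \<rho> * (\<integral>x. \<Delta> x * \<phi> x \<partial>?M)"
    by (simp add: algebra_simps flip: distrib_left)
  then show ?thesis using f_eq by (simp add: V_def)
qed

text \<open>Cauchy-Schwarz on the overlap and on the face, followed by the two Poincare
  inequalities. The volume term carries \<open>sqrt 2 * width\<close> and the face term
  \<open>sqrt width\<close>; both are majorized by \<open>sqrt 2 * sqrt width\<close>.\<close>

lemma overlap_flux_bound:
  assumes G: "has_gradient_trace_on_face W n F u G" and f: "f \<in> L2 (lebesgue_on W)"
    and eqn: "\<And>\<phi>. \<phi> \<in> test_functions W \<Longrightarrow>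
      \<rho> * (\<integral>x. weak_gradient W u x \<bullet> grad \<phi> x \<partial>lebesgue_on W) = (\<integral>x. f x * \<phi> x \<partial>lebesgue_on W)"
    and \<phi>: "\<phi> \<in> test_functions W" and \<rho>: "\<rho> > 0" and w1: "width < 1"
  shows "\<bar>\<rho> * (\<integral>x. weak_gradient W u x \<bullet> grad \<phi> x \<partial>lebesgue_on (A \<inter> W))\<bar> \<le>
    sqrt 2 * sqrt width * (L2_norm (lebesgue_on (A \<inter> W)) f + L2_norm (face_measure n F) (\<lambda>x. \<rho> *\<^sub>R G x)) *
      L2_norm (lebesgue_on W) (grad \<phi>)"
proof -
  let ?M = "lebesgue_on (A \<inter> W)" and ?N = "face_measure n F"
  have sets: "A \<inter> W \<in> sets lebesgue" "W \<in> sets lebesgue" using open_overlap open_W by auto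
  note w0 = width_nonneg
  have fL: "f \<in> L2 ?M" by (rule L2_restrict[OF f Int_lower2 sets])
  have \<phi>L: "\<phi> \<in> L2 ?M" by (rule test_functions_L2[OF open_overlap \<phi>])
  have GL: "G \<in> L2 ?N" using G unfolding has_gradient_trace_on_face_def by blast
  let ?g = "L2_norm ?M (grad \<phi>)"
  \<comment> \<open>This uses that the width is below 1.\<close>
  have "width \<le> sqrt width"
    using w0 w1 by (intro real_le_rsqrt) (simp add: power2_eq_square mult_left_le)
  then have sw: "sqrt 2 * width \<le> sqrt 2 * sqrt width" "sqrt width \<le> sqrt 2 * sqrt width"
    using w0 by (auto simp: mult_le_cancel_right1)
  have "\<bar>\<integral>x. f x * \<phi> x \<partial>?M\<bar> \<le> L2_norm ?M f * L2_norm ?M \<phi>"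
    using L2_Cauchy_Schwarz[OF fL \<phi>L] by simp
  also have "\<dots> \<le> L2_norm ?M f * (sqrt 2 * sqrt width * ?g)"
    by (intro mult_left_mono order_trans[OF overlap_poincare[OF \<phi>]] mult_right_mono sw L2_norm_nonneg)
  finally have 1: "\<bar>\<integral>x. f x * \<phi> x \<partial>?M\<bar> \<le> L2_norm ?M f * (sqrt 2 * sqrt width * ?g)" .
  have "\<bar>\<integral>x. ((\<rho> *\<^sub>R G x) \<bullet> n) * \<phi> x \<partial>?N\<bar> \<le> L2_norm ?N (\<lambda>x. (\<rho> *\<^sub>R G x) \<bullet> n) * L2_norm ?N \<phi>"
    using L2_Cauchy_Schwarz[OF L2_inner_left[OF L2_scaleR[OF GL], of \<rho> n] face_poincare(1)[OF \<phi>]] by simp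
  also have "\<dots> \<le> L2_norm ?N (\<lambda>x. \<rho> *\<^sub>R G x) * (sqrt 2 * sqrt width * ?g)"
  proof (rule mult_mono)
    show "L2_norm ?N (\<lambda>x. (\<rho> *\<^sub>R G x) \<bullet> n) \<le> L2_norm ?N (\<lambda>x. \<rho> *\<^sub>R G x)"
    proof -
      have "norm ((\<rho> *\<^sub>R G x) \<bullet> n) \<le> 1 * norm (\<rho> *\<^sub>R G x)" for x
        using Cauchy_Schwarz_ineq2[of "\<rho> *\<^sub>R G x" n] unfolding norm_n real_norm_def by (simp only: mult_1 mult_1_right)
      then have "L2_norm ?N (\<lambda>x. (\<rho> *\<^sub>R G x) \<bullet> n) \<le> 1 * L2_norm ?N (\<lambda>x. \<rho> *\<^sub>R G x)"
        by (intro L2_norm_bound L2_scaleR GL AE_I2) simp_all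
      then show ?thesis by simp
    qed
    show "L2_norm ?N \<phi> \<le> sqrt 2 * sqrt width * ?g"
      using face_poincare(2)[OF \<phi>] mult_right_mono[OF sw(2) L2_norm_nonneg[of ?M "grad \<phi>"]] by linarith
  qed (auto simp: L2_norm_nonneg)
  finally have 2: "\<bar>\<rho> * (\<integral>x. (G x \<bullet> n) * \<phi> x \<partial>?N)\<bar> \<le> L2_norm ?N (\<lambda>x. \<rho> *\<^sub>R G x) * (sqrt 2 * sqrt width * ?g)"
    by (simp add: mult.assoc)
  have "\<bar>\<rho> * (\<integral>x. weak_gradient W u x \<bullet> grad \<phi> x \<partial>?M)\<bar> \<le>
      (L2_norm ?M f + L2_norm ?N (\<lambda>x. \<rho> *\<^sub>R G x)) * (sqrt 2 * sqrt width * ?g)"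
  proof -
    have "\<rho> * (\<integral>x. weak_gradient W u x \<bullet> grad \<phi> x \<partial>?M) =
        (\<integral>x. f x * \<phi> x \<partial>?M) + \<rho> * (\<integral>x. (G x \<bullet> n) * \<phi> x \<partial>?N)"
      by (rule overlap_flux_identity[OF G f _ \<phi>]) (rule eqn)
    then show ?thesis unfolding distrib_right using 1 2 by linarith
  qed
  also have "\<dots> \<le> (L2_norm ?M f + L2_norm ?N (\<lambda>x. \<rho> *\<^sub>R G x)) * (sqrt 2 * sqrt width * L2_norm (lebesgue_on W) (grad \<phi>))"
    using L2_norm_restrict_le[OF grad_test_functions_L2[OF open_W \<phi>] Int_lower2 sets] w0
    by (intro mult_left_mono) (auto simp: L2_norm_nonneg)
  finally show ?thesis by (simp add: mult_ac)
qed

end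

section \<open>The estimate\<close>

text \<open>A point of \<open>R\<close> all of whose coordinates along \<open>E\<close> are strictly
  between their bounds is relatively interior. So at a point of the relative boundary some
  coordinate takes an extreme value, and \<open>e\<close> or \<open>- e\<close> for this coordinate
  is a supporting direction tangent to the plane.\<close>

lemma rectangular_face_facts:
  fixes n :: "'a::euclidean_space"
  assumes "rectangular_face n R"
  shows "norm n = 1" "\<exists>p0. \<forall>x\<in>R. (x - p0) \<bullet> n = 0" "rel_interior R \<noteq> {}"
    and "q \<in> R \<Longrightarrow> q \<notin> rel_interior R \<Longrightarrow> \<exists>v. norm v = 1 \<and> v \<bullet> n = 0 \<and> (\<forall>x\<in>R. (x - q) \<bullet> v \<le> 0)"
proof -
  show "norm n = 1" using assms by (simp add: rectangular_face_def)
  obtain p E and M :: "'a \<Rightarrow> real" where E: "finite E" "pairwise orthogonal E"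
    "\<And>e. e \<in> E \<Longrightarrow> norm e = 1 \<and> e \<bullet> n = 0 \<and> M e > 0"
    and R: "R = {p + (\<Sum>e\<in>E. s e *\<^sub>R e) | s. \<forall>e\<in>E. 0 \<le> s e \<and> s e \<le> M e}"
    using assms unfolding rectangular_face_def by blast
  have coord: "(p + (\<Sum>e\<in>E. s e *\<^sub>R e) - p) \<bullet> e = s e" if "e \<in> E" for s e
  proof -
    have "(\<Sum>e\<in>E. s e *\<^sub>R e) \<bullet> e = (\<Sum>e'\<in>E. if e' = e then s e else 0)"
      unfolding inner_sum_left
    proof (rule sum.cong[OF refl])
      fix e' assume "e' \<in> E"
      then show "s e' *\<^sub>R e' \<bullet> e = (if e' = e then s e else 0)"
        using E(2,3) that by (auto simp: pairwise_def orthogonal_def norm_eq_1)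
    qed
    then show ?thesis using that E(1) by simp
  qed
  have coord_R: "0 \<le> (x - p) \<bullet> e \<and> (x - p) \<bullet> e \<le> M e" if "x \<in> R" "e \<in> E" for x e
    using that(1) coord[OF that(2)] that(2) unfolding R by force
  show "\<exists>p0. \<forall>x\<in>R. (x - p0) \<bullet> n = 0"
  proof (intro exI[of _ p] ballI)
    fix x assume "x \<in> R"
    then obtain s where "x = p + (\<Sum>e\<in>E. s e *\<^sub>R e)" unfolding R by blast
    then show "(x - p) \<bullet> n = 0" using E(3) by (simp add: inner_sum_left)
  qed
  define P where "P = {p + (\<Sum>e\<in>E. s e *\<^sub>R e) | s. True}"
  have "affine P"
    unfolding affine_def
  proof (intro ballI allI impI)
    fix x y u v assume "x \<in> P" "y \<in> P" and uv: "u + v = (1::real)"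
    then obtain s t where "x = p + (\<Sum>e\<in>E. s e *\<^sub>R e)" "y = p + (\<Sum>e\<in>E. t e *\<^sub>R e)"
      unfolding P_def by blast
    then have "u *\<^sub>R x + v *\<^sub>R y = (u + v) *\<^sub>R p + (\<Sum>e\<in>E. (u * s e + v * t e) *\<^sub>R e)"
      by (simp add: algebra_simps scaleR_sum_right sum.distrib)
    then show "u *\<^sub>R x + v *\<^sub>R y \<in> P" unfolding P_def uv by auto
  qed
  moreover have "R \<subseteq> P" unfolding R P_def by blast
  ultimately have hull: "affine hull R \<subseteq> P" by (rule hull_minimal[rotated])
  \<comment> \<open>An open set of the whole space whose trace on the affine hull is contained in
    \<open>R\<close>; it witnesses relative interiority.\<close>
  define T where "T = (\<Inter>e\<in>E. (\<lambda>x. (x - p) \<bullet> e) -` {0<..<M e})"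
  have "open T" unfolding T_def using E(1) by (intro open_INT ballI open_vimage continuous_intros) auto
  have TP: "T \<inter> P \<subseteq> R"
  proof
    fix x assume x: "x \<in> T \<inter> P"
    then obtain s where s: "x = p + (\<Sum>e\<in>E. s e *\<^sub>R e)" unfolding P_def by blast
    have "\<forall>e\<in>E. 0 \<le> s e \<and> s e \<le> M e"
      using x coord[of _ s] unfolding s T_def by force
    then show "x \<in> R" unfolding R s by blast
  qed
  have int: "x \<in> rel_interior R" if "x \<in> T" "x \<in> R" for x
    unfolding mem_rel_interior using \<open>open T\<close> that TP hull by blast
  show "rel_interior R \<noteq> {}"
  proof -
    define c where "c = p + (\<Sum>e\<in>E. (M e / 2) *\<^sub>R e)"
    have c: "(c - p) \<bullet> e = M e / 2" if "e \<in> E" for e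
      using coord[OF that, of "\<lambda>e. M e / 2"] by (simp only: c_def)
    have "0 < (c - p) \<bullet> e \<and> (c - p) \<bullet> e < M e" if "e \<in> E" for e
      unfolding c[OF that] using E(3)[OF that] by simp
    then have "c \<in> T" unfolding T_def by auto
    moreover have "c \<in> R" unfolding c_def R using E(3) by (auto intro!: exI[of _ "\<lambda>e. M e / 2"] simp: less_imp_le)
    ultimately show ?thesis using int by blast
  qed
  show "\<exists>v. norm v = 1 \<and> v \<bullet> n = 0 \<and> (\<forall>x\<in>R. (x - q) \<bullet> v \<le> 0)" if q: "q \<in> R" "q \<notin> rel_interior R"
  proof -
    obtain e where e: "e \<in> E" "\<not> (0 < (q - p) \<bullet> e \<and> (q - p) \<bullet> e < M e)"
      using int q unfolding T_def by force
    have split: "(x - q) \<bullet> e = (x - p) \<bullet> e - (q - p) \<bullet> e" for x by (simp add: inner_diff_left)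
    consider "(q - p) \<bullet> e = 0" | "(q - p) \<bullet> e = M e" using e coord_R[OF q(1) e(1)] by linarith
    then show ?thesis
    proof cases
      case 1
      then show ?thesis using E(3)[OF e(1)] coord_R[OF _ e(1)] split by (intro exI[of _ "- e"]) auto
    next
      case 2
      then show ?thesis using E(3)[OF e(1)] coord_R[OF _ e(1)] split by (intro exI[of _ e]) auto
    qed
  qed
qed

text \<open>Near an edge point of the interface the complement of the interface is connected, so such a
  point cannot lie in the interior of \<open>\<Omega>\<close>.\<close>

lemma interface_edge_not_interior:
  fixes \<Omega> \<Omega>1 \<Omega>2 :: "'a::euclidean_space set"
  assumes op: "open \<Omega>" "open \<Omega>1" "open \<Omega>2" and disj: "\<Omega>1 \<inter> \<Omega>2 = {}"
    and cover: "\<Omega> \<subseteq> \<Omega>1 \<union> \<Omega>2 \<union> (frontier \<Omega>1 \<inter> frontier \<Omega>2)"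
    and rect: "rectangular_face n (frontier \<Omega>1 \<inter> frontier \<Omega>2)"
    and q: "q \<in> frontier \<Omega>1 \<inter> frontier \<Omega>2" "q \<notin> rel_interior (frontier \<Omega>1 \<inter> frontier \<Omega>2)"
  shows "q \<notin> \<Omega>"
proof
  assume "q \<in> \<Omega>"
  define R where "R = frontier \<Omega>1 \<inter> frontier \<Omega>2"
  obtain r where r: "r > 0" "ball q r \<subseteq> \<Omega>" using \<open>q \<in> \<Omega>\<close> op(1) open_contains_ball by blast
  note rf = rectangular_face_facts[OF rect]
  obtain p0 where p0: "\<And>x. x \<in> R \<Longrightarrow> (x - p0) \<bullet> n = 0" using rf(2) unfolding R_def by blast
  have plane: "(x - q) \<bullet> n = 0" if "x \<in> R" for x
    using p0[OF that] p0[of q] q(1) by (simp add: R_def inner_diff_left)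
  obtain v where v: "norm v = 1" "v \<bullet> n = 0" "\<And>x. x \<in> R \<Longrightarrow> (x - q) \<bullet> v \<le> 0"
    using rf(4)[OF q] unfolding R_def by blast
  have nn: "n \<bullet> n = 1" "v \<bullet> v = 1" using rf(1) v(1) by (auto simp: norm_eq_1)
  define H where "H a = ball q r \<inter> {x. a \<bullet> x > a \<bullet> q}" for a
  have conn: "connected (H a)" for a
    unfolding H_def by (intro convex_connected convex_Int convex_ball convex_halfspace_gt)
  have mem: "q + (r / 4) *\<^sub>R (a + b) \<in> H a \<inter> H b"
    if "norm a = 1" "norm b = 1" "a \<bullet> b = 0" for a b
  proof -
    have "norm (a + b) \<le> 2" using norm_triangle_ineq[of a b] that by simp
    then have "r / 4 * norm (a + b) \<le> r / 4 * 2" using r(1) by (intro mult_left_mono) auto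
    then have "norm ((r / 4) *\<^sub>R (a + b)) < r" using r(1) by simp
    then have "q + (r / 4) *\<^sub>R (a + b) \<in> ball q r" by (simp add: dist_norm)
    moreover have "a \<bullet> a = 1" "b \<bullet> b = 1" using that by (auto simp: norm_eq_1)
    ultimately show ?thesis using that r(1) by (simp add: H_def inner_add_right inner_commute[of b a])
  qed
  \<comment> \<open>Half balls around \<open>q\<close>: two on either side of the plane, and a third
    beyond the edge that overlaps both. Their union avoids the interface and is connected.\<close>
  define S where "S = (H n \<union> H v) \<union> H (- n)"
  have "connected (H n \<union> H v)"
    using conn mem[of n v] rf(1) v by (intro connected_Un) (auto simp: inner_commute)
  moreover have "(H n \<union> H v) \<inter> H (- n) \<noteq> {}" using mem[of v "- n"] rf(1) v by auto
  ultimately have "connected S" unfolding S_def by (rule connected_Un[OF _ conn])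
  have "S \<inter> R = {}"
    using plane v(3) by (force simp: S_def H_def inner_diff_left inner_commute[of n] inner_commute[of v])
  moreover have "S \<subseteq> \<Omega>" using r(2) by (auto simp: S_def H_def)
  ultimately have "S \<subseteq> \<Omega>1 \<union> \<Omega>2" using cover unfolding R_def by blast
  with \<open>connected S\<close> op(2,3) disj have "S \<inter> \<Omega>1 = {} \<or> S \<inter> \<Omega>2 = {}"
    unfolding connected_def by (metis Int_assoc inf_commute inf_bot_right)
  \<comment> \<open>A connected set covered by two disjoint open sets misses one of them. Near
    \<open>q\<close> that subdomain would be confined to the plane, which is impossible for a
    nonempty open set: a small step along \<open>n\<close> leaves the plane.\<close>
  then obtain \<Omega>j where j: "S \<inter> \<Omega>j = {}" "open \<Omega>j" "q \<in> frontier \<Omega>j" using op q(1) by auto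
  then have "q \<in> closure \<Omega>j" by (simp add: frontier_def)
  then obtain y where y: "y \<in> \<Omega>j" "dist y q < r" using r(1) closure_approachable by blast
  have "open (\<Omega>j \<inter> ball q r)" using j(2) by auto
  moreover have "y \<in> \<Omega>j \<inter> ball q r" using y by (simp add: dist_commute)
  ultimately obtain e where e: "e > 0" "ball y e \<subseteq> \<Omega>j \<inter> ball q r" using open_contains_ball by blast
  have "y + (e / 2) *\<^sub>R n \<in> ball y e" using e(1) rf(1) by (simp add: dist_norm)
  then have "y + (e / 2) *\<^sub>R n \<in> \<Omega>j \<inter> ball q r" using e(2) by blast
  then have 1: "\<not> (n \<bullet> (y + (e / 2) *\<^sub>R n) > n \<bullet> q)" "\<not> (n \<bullet> (y + (e / 2) *\<^sub>R n) < n \<bullet> q)"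
    using j(1) by (auto simp: S_def H_def)
  have 2: "\<not> (n \<bullet> y > n \<bullet> q)" "\<not> (n \<bullet> y < n \<bullet> q)"
    using j(1) \<open>y \<in> \<Omega>j \<inter> ball q r\<close> by (auto simp: S_def H_def)
  show False using 1 2 e(1) nn by (simp add: inner_add_right)
qed

theorem mainTheorem3:
  fixes \<Omega> \<Omega>1 \<Omega>2 :: "'a::euclidean_space set"
    and \<rho>1 \<rho>2 C lam :: real and l :: nat
  assumes "DIM('a) \<in> {2, 3}"
    and "bounded_lipschitz_domain \<Omega>"
    and "two_subdomains \<Omega> \<Omega>1 \<Omega>2"
    and "\<rho>1 > 0" and "\<rho>2 > 0"
    and "C > 0" and "lam \<ge> 1"
    and "l \<ge> 2"
  shows "\<exists>c2>0. \<forall>(h::real) \<Omega>1s \<Omega>2s n \<zeta> f u u2 G.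
    h > 0 \<longrightarrow>
    overlapping_patches \<Omega> \<Omega>1 \<Omega>2 \<Omega>1s \<Omega>2s n \<zeta> \<longrightarrow>
    0 < overlap_width (inner_face \<Omega>1s \<Omega>2s) \<zeta> n \<longrightarrow>
    overlap_width (inner_face \<Omega>1s \<Omega>2s) \<zeta> n < 1 \<longrightarrow>
    overlap_width (inner_face \<Omega>1s \<Omega>2s) \<zeta> n \<le> C * h powr lam \<longrightarrow>
    f \<in> L2 (lebesgue_on \<Omega>) \<longrightarrow>
    weak_solution \<Omega> (diffusion_coeff \<Omega>1 \<rho>1 \<rho>2) f u \<longrightarrow>
    u \<in> H10 \<Omega> \<inter> sobolev 2 \<Omega> \<longrightarrow>
    u \<in> sobolev l \<Omega>1 \<longrightarrow> u \<in> sobolev l \<Omega>2 \<longrightarrow>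
    auxiliary_solution \<Omega> \<Omega>1s \<Omega>2s \<rho>2 f u u2 \<longrightarrow>
    u2 \<in> sobolev l \<Omega>2s \<longrightarrow>
    has_gradient_trace_on_face \<Omega>2s n (inner_face \<Omega>1s \<Omega>2s) u2 G \<longrightarrow>
    L2_norm (lebesgue_on \<Omega>2s)
      (\<lambda>x. diffusion_coeff \<Omega>1 \<rho>1 \<rho>2 x *\<^sub>R weak_gradient \<Omega>2s (\<lambda>y. u2 y - u y) x)
    \<le> c2 * overlap_width (inner_face \<Omega>1s \<Omega>2s) \<zeta> n powr (1/2) *
        (L2_norm (lebesgue_on (\<Omega>1s \<inter> \<Omega>2s)) f +
         L2_norm (face_measure n (inner_face \<Omega>1s \<Omega>2s)) (\<lambda>x. \<rho>2 *\<^sub>R G x))"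
proof -

  \<comment> \<open>Constants depending only on the two coefficients\<close>
  define \<rho> where "\<rho> = diffusion_coeff \<Omega>1 \<rho>1 \<rho>2"
  define m where "m = min \<rho>1 \<rho>2"
  define Mx where "Mx = max \<rho>1 \<rho>2"
  have m0: "m > 0" "Mx > 0" and \<rho>b: "m \<le> \<rho> x" "\<rho> x \<le> Mx" "\<rho> x > 0" for x
    using assms(4,5) by (auto simp: m_def Mx_def \<rho>_def diffusion_coeff_def)
  \<comment> \<open>The first factor is the size of the right-hand side of the energy identity
    relative to the flux \<rho>2 \<nabla>u2; \<open>sqrt 2\<close> comes from the flux
    bound.\<close>
  define K where "K = \<bar>\<rho>1 - \<rho>2\<bar> / \<rho>2 * sqrt 2"
  \<comment> \<open>\<open>Mx\<close> bounds \<rho> in the norm to be estimated,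
    \<open>1 / m\<close> comes from coercivity, and 8 from the gradient bound on the test functions.
    Adding 1 keeps the constant positive when the two coefficients coincide.\<close>
  define c2 where "c2 = Mx * (8 * K / m) + 1"
  have K0: "K \<ge> 0" using assms(5) by (simp add: K_def)
  have c20: "c2 > 0" using K0 m0 by (simp add: c2_def add_nonneg_pos)
  have \<Omega>: "open \<Omega>" "bounded \<Omega>" using assms(2) by (auto simp: bounded_lipschitz_domain_def domain_def)
  have sub: "open \<Omega>1" "open \<Omega>2" "\<Omega>1 \<subseteq> \<Omega>" "\<Omega>1 \<inter> \<Omega>2 = {}" "\<Omega> \<subseteq> \<Omega>1 \<union> \<Omega>2 \<union> (frontier \<Omega>1 \<inter> frontier \<Omega>2)"
    using assms(3) by (auto simp: two_subdomains_def domain_def)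
  show ?thesis
  proof (intro exI[of _ c2] conjI c20 allI impI)
    fix h :: real and \<Omega>1s W n \<zeta> f u u2 G
    assume patches: "overlapping_patches \<Omega> \<Omega>1 \<Omega>2 \<Omega>1s W n \<zeta>"
      and width1: "overlap_width (inner_face \<Omega>1s W) \<zeta> n < 1"
      and f\<Omega>: "f \<in> L2 (lebesgue_on \<Omega>)"
      and sol: "weak_solution \<Omega> (diffusion_coeff \<Omega>1 \<rho>1 \<rho>2) f u"
      and uH: "u \<in> H10 \<Omega> \<inter> sobolev 2 \<Omega>"
      and aux: "auxiliary_solution \<Omega> \<Omega>1s W \<rho>2 f u u2"
      and tr: "has_gradient_trace_on_face W n (inner_face \<Omega>1s W) u2 G"
    define F where "F = inner_face \<Omega>1s W"
    have eq1: "\<Omega>1s = \<Omega>1" and W: "open W" "W \<subseteq> \<Omega>" "\<Omega>2 \<subseteq> W"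
      and rect: "rectangular_face n (frontier \<Omega>1 \<inter> frontier \<Omega>2)"
      and F_ri: "F = rel_interior (frontier \<Omega>1 \<inter> frontier \<Omega>2)"
      using patches by (auto simp: overlapping_patches_def F_def)
    have F_def': "frontier \<Omega>1 \<inter> W = F" by (simp add: F_def eq1 inner_face_def)
    note rf = rectangular_face_facts[OF rect]
    obtain p0 where p0: "\<And>x. x \<in> frontier \<Omega>1 \<inter> frontier \<Omega>2 \<Longrightarrow> (x - p0) \<bullet> n = 0" using rf(2) by blast
    interpret thin_overlap \<Omega>1 W F n p0 \<zeta>
    proof
      show "bounded \<Omega>1" using \<Omega>(2) sub(3) bounded_subset by blast
      show "F \<noteq> {}" using rf(3) F_ri by simp
      show "(x - p0) \<bullet> n = 0" if "x \<in> F" for x using that p0 rel_interior_subset unfolding F_ri by blast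
      show "continuous_on UNIV \<zeta>" using patches smooth_on_imp_continuous_on by (auto simp: overlapping_patches_def)
      have i: "inner_face W \<Omega>1 = frontier W \<inter> \<Omega>1" by (simp add: inner_face_def)
      show "exterior_normal \<Omega>1 F n" "frontier W \<inter> \<Omega>1 = face_map \<zeta> n ` F"
        "frontier (\<Omega>1 \<inter> W) = closure F \<union> closure (frontier W \<inter> \<Omega>1)"
        using patches unfolding overlapping_patches_def F_def[symmetric] unfolding eq1 i by blast+
    qed (use sub W F_def' rf(1) in auto)
    have W_sets: "W \<in> sets lebesgue" "\<Omega> \<in> sets lebesgue" "\<Omega>1 \<inter> W \<in> sets lebesgue" using W \<Omega> sub by auto
    have bW: "bounded W" using \<Omega>(2) W(2) bounded_subset by blast
    have f: "f \<in> L2 (lebesgue_on W)" by (rule L2_restrict[OF f\<Omega> W(2) W_sets(1,2)])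
    have us: "u \<in> sobolev 1 \<Omega>" using uH by (simp add: H10_def)
    note su = sobolev_1_weak_gradient[OF \<Omega>(1) us]
    have u2s: "u2 \<in> sobolev 1 W" using aux by (simp add: auxiliary_solution_def)
    note su2 = sobolev_1_weak_gradient[OF W(1) u2s]

    \<comment> \<open>The difference \<open>w\<close> and two representatives of its
      gradient\<close>
    define w where "w x = u2 x - u x" for x
    define gw where "gw = weak_gradient W w"
    \<comment> \<open>The field obtained from the gradients of \<open>u2\<close> and
      \<open>u\<close>, as opposed to the representative \<open>gw\<close> chosen for
      \<open>w\<close> on \<open>W\<close>. The equations and the outer boundary condition speak of
      the former, the condition on the inner face of the latter; they agree almost
      everywhere.\<close>
    define G1 where "G1 x = weak_gradient W u2 x - weak_gradient \<Omega> u x" for x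
    have ws: "w \<in> sobolev 1 W" using aux by (simp add: auxiliary_solution_def zero_on_boundary_part_def w_def[abs_def])
    note sw = sobolev_1_weak_gradient[OF W(1) ws]
    have wgu: "has_weak_gradient W u (weak_gradient \<Omega> u)"
      by (rule has_weak_gradient_subset[OF \<Omega>(1) W(1,2) su(2)])
    have wgw: "has_weak_gradient W w G1"
      unfolding w_def[abs_def] G1_def by (rule has_weak_gradient_diff[OF W(1) su2(2) wgu])
    have uL: "u \<in> L2 (lebesgue_on W)" "weak_gradient \<Omega> u \<in> L2 (lebesgue_on W)"
      by (rule L2_restrict[OF su(1) W(2) W_sets(1,2)], rule L2_restrict[OF su(3) W(2) W_sets(1,2)])
    have G1L: "G1 \<in> L2 (lebesgue_on W)" unfolding G1_def by (intro L2_diff su2 uL)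
    have G1_gw: "AE x in lebesgue_on W. gw x = G1 x" unfolding gw_def by (rule weak_gradient_AE_eq[OF W(1) wgw])
    have gwL: "gw \<in> L2 (lebesgue_on W)" unfolding gw_def by (rule sw(3))
    have norm_eq: "L2_norm (lebesgue_on W) G1 = L2_norm (lebesgue_on W) gw"
      by (rule L2_norm_cong_AE[symmetric]) (use G1_gw L2_measurable[OF gwL] L2_measurable[OF G1L] in auto)
    \<comment> \<open>A frontier point of \<open>W\<close> inside \<Omega> is not in \<Omega>2,
      which lies in \<open>W\<close>. It is not on the interface either: the relative interior of
      the face belongs to \<open>W\<close>, and edge points are not in \<Omega>. Hence it is in
      \<Omega>1.\<close>
    have frontier_W: "frontier W \<subseteq> (frontier W \<inter> frontier \<Omega>) \<union> inner_face W \<Omega>1s"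
    proof
      fix q assume q: "q \<in> frontier W"
      have "q \<in> closure \<Omega>" using q W(2) closure_mono by (auto simp: frontier_def)
      show "q \<in> (frontier W \<inter> frontier \<Omega>) \<union> inner_face W \<Omega>1s"
      proof (cases "q \<in> \<Omega>")
        case False
        then show ?thesis using q \<open>q \<in> closure \<Omega>\<close> \<Omega>(1) by (auto simp: frontier_def interior_open)
      next
        case True
        have "q \<notin> W" using q W(1) by (auto simp: frontier_def interior_open)
        have "q \<notin> frontier \<Omega>1 \<inter> frontier \<Omega>2"
        proof
          assume *: "q \<in> frontier \<Omega>1 \<inter> frontier \<Omega>2"
          have "q \<notin> rel_interior (frontier \<Omega>1 \<inter> frontier \<Omega>2)"
            using \<open>q \<notin> W\<close> F_def' F_ri by blast
          then show False using interface_edge_not_interior[OF \<Omega>(1) sub(1,2,4,5) rect *] True by blast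
        qed
        then have "q \<in> \<Omega>1" using True sub(5) \<open>q \<notin> W\<close> W(3) by blast
        then show ?thesis using q by (simp add: inner_face_def eq1)
      qed
    qed

    \<comment> \<open>Test functions of \<open>W\<close> approximating \<open>w\<close>\<close>
    have v1: "vanishing_limit W (frontier W \<inter> frontier \<Omega>) w G1"
      unfolding w_def[abs_def] G1_def
    proof (rule vanishing_limit_diff)
      show "vanishing_limit W (frontier W \<inter> frontier \<Omega>) u2 (weak_gradient W u2)"
        using aux by (intro zero_on_boundary_part_vanishing_limit W) (simp add: auxiliary_solution_def)
      show "vanishing_limit W (frontier W \<inter> frontier \<Omega>) u (weak_gradient \<Omega> u)"
        using uH by (intro H10_vanishing_limit \<Omega> W) auto
    qed (use su2 uL in auto)
    have v2: "vanishing_limit W (inner_face W \<Omega>1s) w gw"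
      unfolding gw_def using aux
      by (intro zero_on_boundary_part_vanishing_limit W) (simp add: auxiliary_solution_def w_def[abs_def])
    let ?N = "L2_norm (lebesgue_on W) gw"
    obtain \<phi> \<delta> where \<phi>: "\<And>k::nat. \<phi> k \<in> test_functions W" and \<delta>: "\<delta> \<longlonglongrightarrow> 0"
      and bound': "\<And>k. L2_norm (lebesgue_on W) (grad (\<phi> k)) \<le> 4 * L2_norm (lebesgue_on W) G1 + 4 * ?N + \<delta> k"
      and weak: "\<And>z. z \<in> L2 (lebesgue_on W) \<Longrightarrow> (\<lambda>k. \<integral>x. (grad (\<phi> k) x - gw x) \<bullet> z x \<partial>lebesgue_on W) \<longlonglongrightarrow> 0"
      by (rule vanishing_limits_combine[OF W(1) bW sw(1) sw(2)[folded gw_def] gwL v1 G1L v2 gwL frontier_W]) (rule that)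
    have bound: "L2_norm (lebesgue_on W) (grad (\<phi> k)) \<le> 8 * ?N + \<delta> k" for k
      using bound'[of k] norm_eq by linarith

    \<comment> \<open>The two weak equations and the energy identity\<close>
    have grad_eq: "AE x in lebesgue_on E. weak_gradient E \<theta> x = grad \<theta> x" if "\<theta> \<in> test_functions W" "open E" for \<theta> E
    proof -
      have "smooth_on E \<theta>" using that(1) smooth_on_subset by (auto simp: test_functions_def)
      then show ?thesis by (intro weak_gradient_AE_eq smooth_has_weak_gradient that(2))
    qed
    have wgm: "weak_gradient E \<theta> \<in> borel_measurable (lebesgue_on E)" if "\<theta> \<in> test_functions W" "open E" for \<theta> E
    proof -
      have "smooth_on E \<theta>" using that(1) smooth_on_subset by (auto simp: test_functions_def)
      then show ?thesis
        using has_weak_gradient_measurable[OF that(2) has_weak_gradient_weak_gradient[OF smooth_has_weak_gradient[OF that(2)]]] by blast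
    qed
    have eq_u2: "\<rho>2 * (\<integral>x. weak_gradient W u2 x \<bullet> grad \<theta> x \<partial>lebesgue_on W) = (\<integral>x. f x * \<theta> x \<partial>lebesgue_on W)"
      if \<theta>: "\<theta> \<in> test_functions W" for \<theta>
    proof -
      have "(\<integral>x. \<rho>2 * (weak_gradient W u2 x \<bullet> weak_gradient W \<theta> x) \<partial>lebesgue_on W) = (\<integral>x. f x * \<theta> x \<partial>lebesgue_on W)"
        using aux test_functions_H10[OF W(1) \<theta>] by (simp add: auxiliary_solution_def)
      moreover have "(\<integral>x. \<rho>2 * (weak_gradient W u2 x \<bullet> weak_gradient W \<theta> x) \<partial>lebesgue_on W) =
          (\<integral>x. \<rho>2 * (weak_gradient W u2 x \<bullet> grad \<theta> x) \<partial>lebesgue_on W)"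
      proof (rule integral_cong_AE)
        show "AE x in lebesgue_on W. \<rho>2 * (weak_gradient W u2 x \<bullet> weak_gradient W \<theta> x) = \<rho>2 * (weak_gradient W u2 x \<bullet> grad \<theta> x)"
          using grad_eq[OF \<theta> W(1)] by eventually_elim simp
      qed (use L2_measurable[OF su2(3)] wgm[OF \<theta> W(1)] L2_measurable[OF grad_test_functions_L2[OF W(1) \<theta>]] in auto)
      ultimately show ?thesis by simp
    qed
    have \<rho>m: "\<rho> \<in> borel_measurable borel"
      unfolding \<rho>_def diffusion_coeff_def[abs_def] using sub(1) by (intro measurable_If) auto
    have \<rho>L: "(\<lambda>x. \<rho> x *\<^sub>R g x) \<in> L2 (lebesgue_on E)" if "g \<in> L2 (lebesgue_on E)" for g :: "'a \<Rightarrow> 'a" and E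
      using L2_measurable[OF that] borel_measurable_lebesgue_on[OF \<rho>m, of E] \<rho>b(2) less_imp_le[OF \<rho>b(3)]
      by (intro L2_bound[OF _ that, of _ Mx]) (auto intro!: mult_right_mono)
    have eq_u: "(\<integral>x. (\<rho> x *\<^sub>R weak_gradient \<Omega> u x) \<bullet> grad \<theta> x \<partial>lebesgue_on W) = (\<integral>x. f x * \<theta> x \<partial>lebesgue_on W)"
      if \<theta>: "\<theta> \<in> test_functions W" for \<theta>
    proof -
      have \<theta>': "\<theta> \<in> test_functions \<Omega>" using test_functions_mono[OF W(2)] \<theta> by blast
      have "(\<integral>x. \<rho> x * (weak_gradient \<Omega> u x \<bullet> weak_gradient \<Omega> \<theta> x) \<partial>lebesgue_on \<Omega>) = (\<integral>x. f x * \<theta> x \<partial>lebesgue_on \<Omega>)"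
        using sol test_functions_H10[OF \<Omega>(1) \<theta>'] by (simp add: weak_solution_def \<rho>_def)
      moreover have "(\<integral>x. \<rho> x * (weak_gradient \<Omega> u x \<bullet> weak_gradient \<Omega> \<theta> x) \<partial>lebesgue_on \<Omega>) =
          (\<integral>x. (\<rho> x *\<^sub>R weak_gradient \<Omega> u x) \<bullet> grad \<theta> x \<partial>lebesgue_on \<Omega>)"
        using L2_measurable[OF su(3)] borel_measurable_lebesgue_on[OF \<rho>m, of \<Omega>] wgm[OF \<theta> \<Omega>(1)]
          L2_measurable[OF grad_test_functions_L2[OF \<Omega>(1) \<theta>]] grad_eq[OF \<theta> \<Omega>(1)]
        by (intro integral_cong_AE) (auto elim: eventually_mono)
      moreover have "(\<integral>x. (\<rho> x *\<^sub>R weak_gradient \<Omega> u x) \<bullet> grad \<theta> x \<partial>lebesgue_on \<Omega>) =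
          (\<integral>x. (\<rho> x *\<^sub>R weak_gradient \<Omega> u x) \<bullet> grad \<theta> x \<partial>lebesgue_on W)"
        using test_functions_vanish[OF test_functions_pderiv_dir[OF \<theta>]] W W_sets
        by (intro integral_lebesgue_on_vanish) (auto simp: grad_def)
      moreover have "(\<integral>x. f x * \<theta> x \<partial>lebesgue_on \<Omega>) = (\<integral>x. f x * \<theta> x \<partial>lebesgue_on W)"
        using test_functions_vanish[OF \<theta>] W W_sets by (intro integral_lebesgue_on_vanish) auto
      ultimately show ?thesis by simp
    qed
    \<comment> \<open>Both equations have the same right-hand side on \<open>W\<close>. What remains
      is (\<rho> - \<rho>2) \<nabla>u2, which vanishes off \<Omega>1, so the integral localizes to
      the overlap.\<close>
    have energy: "(\<integral>x. (\<rho> x *\<^sub>R gw x) \<bullet> grad \<theta> x \<partial>lebesgue_on W) =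
        (\<rho>1 - \<rho>2) * (\<integral>x. weak_gradient W u2 x \<bullet> grad \<theta> x \<partial>lebesgue_on (\<Omega>1 \<inter> W))"
      if \<theta>: "\<theta> \<in> test_functions W" for \<theta>
    proof -
      have g\<theta>: "grad \<theta> \<in> L2 (lebesgue_on W)" by (rule grad_test_functions_L2[OF W(1) \<theta>])
      have "(\<integral>x. (\<rho> x *\<^sub>R gw x) \<bullet> grad \<theta> x \<partial>lebesgue_on W) = (\<integral>x. (\<rho> x *\<^sub>R G1 x) \<bullet> grad \<theta> x \<partial>lebesgue_on W)"
        using L2_measurable[OF \<rho>L[OF gwL]] L2_measurable[OF \<rho>L[OF G1L]] L2_measurable[OF g\<theta>] G1_gw
        by (intro integral_cong_AE borel_measurable_inner) (auto elim: eventually_mono)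
      also have "\<dots> = (\<integral>x. (\<rho> x *\<^sub>R weak_gradient W u2 x) \<bullet> grad \<theta> x - (\<rho> x *\<^sub>R weak_gradient \<Omega> u x) \<bullet> grad \<theta> x \<partial>lebesgue_on W)"
        by (simp add: G1_def inner_diff_left right_diff_distrib)
      also have "\<dots> = (\<integral>x. (\<rho> x *\<^sub>R weak_gradient W u2 x) \<bullet> grad \<theta> x \<partial>lebesgue_on W) - (\<integral>x. f x * \<theta> x \<partial>lebesgue_on W)"
        using L2_integrable_inner[OF \<rho>L[OF su2(3)] g\<theta>] L2_integrable_inner[OF \<rho>L[OF uL(2)] g\<theta>] eq_u[OF \<theta>]
        by (subst Bochner_Integration.integral_diff) auto
      also have "\<dots> = (\<integral>x. (\<rho> x *\<^sub>R weak_gradient W u2 x) \<bullet> grad \<theta> x \<partial>lebesgue_on W) - (\<integral>x. \<rho>2 * (weak_gradient W u2 x \<bullet> grad \<theta> x) \<partial>lebesgue_on W)"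
        using eq_u2[OF \<theta>] by simp
      also have "\<dots> = (\<integral>x. (\<rho> x *\<^sub>R weak_gradient W u2 x) \<bullet> grad \<theta> x - \<rho>2 * (weak_gradient W u2 x \<bullet> grad \<theta> x) \<partial>lebesgue_on W)"
        using L2_integrable_inner[OF \<rho>L[OF su2(3)] g\<theta>] L2_integrable_inner[OF su2(3) g\<theta>]
        by (intro Bochner_Integration.integral_diff[symmetric] integrable_mult_right)
      also have "\<dots> = (\<integral>x. indicator (\<Omega>1 \<inter> W) x * ((\<rho>1 - \<rho>2) * (weak_gradient W u2 x \<bullet> grad \<theta> x)) \<partial>lebesgue_on W)"
        by (intro Bochner_Integration.integral_cong) (auto simp: \<rho>_def diffusion_coeff_def algebra_simps indicator_def)
      also have "\<dots> = (\<integral>x. (\<rho>1 - \<rho>2) * (weak_gradient W u2 x \<bullet> grad \<theta> x) \<partial>lebesgue_on (\<Omega>1 \<inter> W))"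
        by (rule integrable_lebesgue_on_indicator(2)[OF Int_lower2 W_sets(3,1)])
      finally show ?thesis by simp
    qed

    \<comment> \<open>The flux bound and the passage to the limit\<close>
    define Q where "Q = K * sqrt width * (L2_norm (lebesgue_on (\<Omega>1 \<inter> W)) f + L2_norm (face_measure n F) (\<lambda>x. \<rho>2 *\<^sub>R G x))"
    note w0 = width_nonneg
    have w1: "width < 1" unfolding width_def using width1 by (simp add: F_def)
    have Q0: "Q \<ge> 0" unfolding Q_def using K0 w0 by (intro mult_nonneg_nonneg add_nonneg_nonneg) (auto simp: L2_norm_nonneg)
    have flux: "(\<integral>x. (\<rho> x *\<^sub>R gw x) \<bullet> grad (\<phi> k) x \<partial>lebesgue_on W) \<le> Q * (8 * ?N + \<delta> k)" for k
    proof -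
      let ?I = "\<integral>x. weak_gradient W u2 x \<bullet> grad (\<phi> k) x \<partial>lebesgue_on (\<Omega>1 \<inter> W)"
      \<comment> \<open>The factor \<rho>2 is inserted because the flux bound is stated for \<rho>2
        \<nabla>u2.\<close>
      have "(\<rho>1 - \<rho>2) * ?I \<le> \<bar>\<rho>1 - \<rho>2\<bar> / \<rho>2 * \<bar>\<rho>2 * ?I\<bar>"
        using assms(5) abs_ge_self[of "(\<rho>1 - \<rho>2) * ?I"] by (simp add: abs_mult)
      also have "\<dots> \<le> \<bar>\<rho>1 - \<rho>2\<bar> / \<rho>2 * (sqrt 2 * sqrt width * (L2_norm (lebesgue_on (\<Omega>1 \<inter> W)) f +
          L2_norm (face_measure n F) (\<lambda>x. \<rho>2 *\<^sub>R G x)) * L2_norm (lebesgue_on W) (grad (\<phi> k)))"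
        using assms(5) tr by (intro mult_left_mono overlap_flux_bound[OF _ f eq_u2 \<phi> _ w1]) (auto simp: F_def)
      also have "\<dots> = Q * L2_norm (lebesgue_on W) (grad (\<phi> k))" by (simp add: Q_def K_def)
      also have "\<dots> \<le> Q * (8 * ?N + \<delta> k)" by (intro mult_left_mono bound Q0)
      finally show ?thesis unfolding energy[OF \<phi>] .
    qed
    \<comment> \<open>Weak convergence is applied to the fixed field \<rho> \<open>gw\<close>; this
      replaces testing with \<open>w\<close> itself.\<close>
    have "(\<lambda>k. \<integral>x. (\<rho> x *\<^sub>R gw x) \<bullet> grad (\<phi> k) x \<partial>lebesgue_on W) \<longlonglongrightarrow> (\<integral>x. (\<rho> x *\<^sub>R gw x) \<bullet> gw x \<partial>lebesgue_on W)"
    proof -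
      have "(\<integral>x. (grad (\<phi> k) x - gw x) \<bullet> (\<rho> x *\<^sub>R gw x) \<partial>lebesgue_on W) =
        (\<integral>x. (\<rho> x *\<^sub>R gw x) \<bullet> grad (\<phi> k) x \<partial>lebesgue_on W) - (\<integral>x. (\<rho> x *\<^sub>R gw x) \<bullet> gw x \<partial>lebesgue_on W)" for k
        using L2_integrable_inner[OF \<rho>L[OF gwL] grad_test_functions_L2[OF W(1) \<phi>], of k] L2_integrable_inner[OF \<rho>L[OF gwL] gwL]
        by (subst Bochner_Integration.integral_diff[symmetric])
          (auto intro!: Bochner_Integration.integral_cong simp: inner_diff_left inner_diff_right inner_commute algebra_simps)
      with weak[OF \<rho>L[OF gwL]] show ?thesis by (simp add: LIM_zero_iff)
    qed
    moreover have "(\<lambda>k. Q * (8 * ?N + \<delta> k)) \<longlonglongrightarrow> Q * (8 * ?N + 0)"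
      by (intro tendsto_intros \<delta>)
    ultimately have upper: "(\<integral>x. (\<rho> x *\<^sub>R gw x) \<bullet> gw x \<partial>lebesgue_on W) \<le> Q * (8 * ?N)"
      using flux by (intro LIMSEQ_le[where Y = "\<lambda>k. Q * (8 * ?N + \<delta> k)"]) auto
    have "m * ?N\<^sup>2 = (\<integral>x. m * (norm (gw x))\<^sup>2 \<partial>lebesgue_on W)" by (simp add: L2_norm_power2)
    also have "\<dots> \<le> (\<integral>x. (\<rho> x *\<^sub>R gw x) \<bullet> gw x \<partial>lebesgue_on W)"
      using L2_integrable[OF gwL] L2_integrable_inner[OF \<rho>L[OF gwL] gwL] \<rho>b(1)
      by (intro integral_mono) (auto simp: power2_norm_eq_inner intro!: mult_right_mono)
    finally have "m * ?N\<^sup>2 \<le> Q * (8 * ?N)" using upper by linarith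
    \<comment> \<open>One power of the norm is cancelled, which requires the case of norm zero to be
      treated apart.\<close>
    then have "?N \<le> 8 * Q / m"
    proof (cases "?N = 0")
      case True
      then show ?thesis using Q0 m0 by simp
    next
      case False
      then have "?N > 0" using L2_norm_nonneg[of "lebesgue_on W" gw] by simp
      with \<open>m * ?N\<^sup>2 \<le> Q * (8 * ?N)\<close> have "m * ?N \<le> 8 * Q" by (simp add: power2_eq_square)
      then show ?thesis using m0 by (simp add: field_simps)
    qed
    have "L2_norm (lebesgue_on W) (\<lambda>x. \<rho> x *\<^sub>R gw x) \<le> Mx * ?N"
      using \<rho>b(2) less_imp_le[OF \<rho>b(3)] m0 by (intro L2_norm_bound gwL) (auto intro!: mult_right_mono)
    also have "\<dots> \<le> Mx * (8 * Q / m)" using \<open>?N \<le> 8 * Q / m\<close> m0 by (intro mult_left_mono) auto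
    also have "\<dots> = (c2 - 1) * (sqrt width * (L2_norm (lebesgue_on (\<Omega>1 \<inter> W)) f + L2_norm (face_measure n F) (\<lambda>x. \<rho>2 *\<^sub>R G x)))"
      by (simp add: c2_def Q_def)
    also have "\<dots> \<le> c2 * (sqrt width * (L2_norm (lebesgue_on (\<Omega>1 \<inter> W)) f + L2_norm (face_measure n F) (\<lambda>x. \<rho>2 *\<^sub>R G x)))"
      using w0 by (intro mult_right_mono mult_nonneg_nonneg add_nonneg_nonneg) (auto simp: L2_norm_nonneg)
    finally show "L2_norm (lebesgue_on W) (\<lambda>x. diffusion_coeff \<Omega>1 \<rho>1 \<rho>2 x *\<^sub>R weak_gradient W (\<lambda>y. u2 y - u y) x)
      \<le> c2 * overlap_width (inner_face \<Omega>1s W) \<zeta> n powr (1/2) *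
        (L2_norm (lebesgue_on (\<Omega>1s \<inter> W)) f +
         L2_norm (face_measure n (inner_face \<Omega>1s W)) (\<lambda>x. \<rho>2 *\<^sub>R G x))"
      unfolding F_def[symmetric] width_def[symmetric] unfolding eq1 powr_half_sqrt[OF w0]
      by (simp add: \<rho>_def gw_def w_def[abs_def] mult.assoc)
  qed
qed

end
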